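(* Let $X(t)$, $t\ge 0$, be a Lévy process in $\mathbb{R}^d$ with $X(0)=0$ and Lévy measure $\nu$, and let $$\beta_\nu=\sup\left\{\beta>0:\ \int_{\|x\|>1}\|x\|^\beta\,\nu(dx)<\infty\right\}.$$ For $s\ge 0$ let $Z_s$ be the closed convex hull of $\{X(t):0\le t\le s\}$. If $0\le p<\beta_\nu$, then $\mathbf{E}\,V_j(Z_s)^p<\infty$ for all $j=0,\dots,d$ and all $s\ge 0$, where $V_j$ denotes the $j$-th intrinsic volume.
   Context: A convex body is a non-empty compact convex set in $\mathbb{R}^d$. The intrinsic volumes $V_0,\dots,V_d$ of a convex body $K$ are determined by the Steiner formula $V_d(K+tB^d)=\sum_{j=0}^d t^{d-j}\kappa_{d-j}V_j(K)$, $t\ge 0$, where $V_d$ is Lebesgue measure, $B^d$ is the centred closed unit ball in $\mathbb{R}^d$, $K+L=\{x+y:x\in K,\,y\in L\}$ is the Minkowski sum, and $\kappa_{m}$ is the $m$-dimensional volume of the unit ball $B^{m}$ (with $\kappa_0=1$). Lévy processes have right-continuous paths with left limits, so $Z_s$ is a random convex body. The supremum $\beta_\nu$ may equal $+\infty$. *)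

theory Defs
  imports "HOL-Probability.Probability" "HOL-Library.Set_Algebras"
begin

text \<open>
  Addition of sets is the Minkowski sum of \<^theory>\<open>HOL-Library.Set_Algebras\<close>, and
  \<^term>\<open>unit_ball_vol (real m)\<close> is the volume of the unit ball of dimension \<open>m\<close>
  (equal to 1 for \<open>m = 0\<close>). The Steiner formula only constrains \<open>V\<^sub>0, \<dots>, V\<^sub>d\<close>, so \<open>V\<^sub>j\<close> is set to 0
  for \<open>j > d\<close> in order to make the description unique.
\<close>

definition intrinsic_volume :: "nat \<Rightarrow> 'a::euclidean_space set \<Rightarrow> real" where
  "intrinsic_volume j K =
     (THE V :: nat \<Rightarrow> real.
        (\<forall>t\<ge>0. measure lebesgue (K + (\<lambda>x. t *\<^sub>R x) ` cball 0 1) =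
           (\<Sum>i\<le>DIM('a). t ^ (DIM('a) - i) * unit_ball_vol (real (DIM('a) - i)) * V i)) \<and>
        (\<forall>i>DIM('a). V i = 0)) j"

text \<open>
  Only the values \<open>X t\<close> with \<open>t \<ge> 0\<close> matter. The process starts at the origin almost surely;
  all paths are right-continuous with left limits.
\<close>

locale levy_process = prob_space M
  for M :: "'w measure" and X :: "real \<Rightarrow> 'w \<Rightarrow> 'a::euclidean_space" +
  assumes random_variable_X: "t \<ge> 0 \<Longrightarrow> random_variable borel (X t)"
    and start_zero: "AE \<omega> in M. X 0 \<omega> = 0"
    and indep_increments:
      "0 \<le> \<tau> 0 \<Longrightarrow> (\<And>i. i < n \<Longrightarrow> \<tau> i < \<tau> (Suc i)) \<Longrightarrow>
         indep_vars (\<lambda>_. borel) (\<lambda>i \<omega>. X (\<tau> (Suc i)) \<omega> - X (\<tau> i) \<omega>) {..<(n::nat)}"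
    and stationary_increments:
      "0 \<le> t \<Longrightarrow> 0 \<le> h \<Longrightarrow>
         distr M borel (\<lambda>\<omega>. X (t + h) \<omega> - X t \<omega>) = distr M borel (\<lambda>\<omega>. X h \<omega> - X 0 \<omega>)"
    and stochastically_continuous:
      "0 \<le> t \<Longrightarrow> 0 < \<epsilon> \<Longrightarrow>
         ((\<lambda>u. prob {\<omega> \<in> space M. norm (X u \<omega> - X t \<omega>) > \<epsilon>}) \<longlongrightarrow> 0) (at t within {0..})"
    and right_continuous_paths:
      "\<omega> \<in> space M \<Longrightarrow> 0 \<le> t \<Longrightarrow> ((\<lambda>u. X u \<omega>) \<longlongrightarrow> X t \<omega>) (at_right t)"
    and left_limits_paths:
      "\<omega> \<in> space M \<Longrightarrow> 0 < t \<Longrightarrow> \<exists>l. ((\<lambda>u. X u \<omega>) \<longlongrightarrow> l) (at_left t)"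

text \<open>
  \<open>\<nu>\<close> is the Levy measure of the process, i.e. the measure in the Levy-Khintchine representation
  with drift \<open>\<gamma>\<close>, Gaussian covariance operator \<open>A\<close> and truncation to the closed unit ball. Another
  truncation would only change \<open>\<gamma>\<close>.
\<close>

definition levy_exponent ::
    "'a \<Rightarrow> ('a \<Rightarrow> 'a) \<Rightarrow> 'a measure \<Rightarrow> 'a::euclidean_space \<Rightarrow> complex" where
  "levy_exponent \<gamma> A \<nu> u =
     \<i> * of_real (\<gamma> \<bullet> u) - of_real (u \<bullet> A u) / 2 +
     (CLINT x|\<nu>. iexp (u \<bullet> x) - 1 - \<i> * of_real (indicator (cball 0 1) x * (u \<bullet> x)))"

definition is_levy_measure_of ::
    "'w measure \<Rightarrow> (real \<Rightarrow> 'w \<Rightarrow> 'a::euclidean_space) \<Rightarrow> 'a measure \<Rightarrow> bool" where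
  "is_levy_measure_of M X \<nu> \<longleftrightarrow>
     sets \<nu> = sets borel \<and> emeasure \<nu> {0} = 0 \<and>
     (\<integral>\<^sup>+x. ennreal (min 1 ((norm x)\<^sup>2)) \<partial>\<nu>) < \<infinity> \<and>
     (\<exists>\<gamma> A. linear A \<and> (\<forall>x y. A x \<bullet> y = x \<bullet> A y) \<and> (\<forall>x. 0 \<le> x \<bullet> A x) \<and>
        (\<forall>t\<ge>0. \<forall>u. (CLINT \<omega>|M. iexp (u \<bullet> X t \<omega>)) = exp (of_real t * levy_exponent \<gamma> A \<nu> u)))"

text \<open>The supremum of the empty set is 0 in \<^typ>\<open>ennreal\<close>.\<close>

definition tail_index :: "'a::euclidean_space measure \<Rightarrow> ennreal" where
  "tail_index \<nu> =
     Sup {ennreal \<beta> | \<beta>. \<beta> > 0 \<and> (\<integral>\<^sup>+x\<in>{x. norm x > 1}. ennreal (norm x powr \<beta>) \<partial>\<nu>) < \<infinity>}"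

definition path_hull :: "(real \<Rightarrow> 'w \<Rightarrow> 'a::euclidean_space) \<Rightarrow> real \<Rightarrow> 'w \<Rightarrow> 'a set" where
  "path_hull X s \<omega> = closure (convex hull ((\<lambda>t. X t \<omega>) ` {0..s}))"

end

theory Submission
  imports Defs
begin

text \<open>
  A greedy choice of points on the path yields an orthogonal box containing the hull, and inserting the
  chosen times in increasing order shows that the volume of a parallel body of the hull is at most a
  constant times \<open>\<Prod>\<^sub>i max 1 \<parallel>X(t\<^sub>i) - X(t\<^sub>i\<^sub>-\<^sub>1)\<parallel>\<close> for some times \<open>t\<^sub>0 \<le> \<dots> \<le> t\<^sub>d\<close>. By a first passage
  argument, the probability that increments of sizes \<open>a\<^sub>1, \<dots>, a\<^sub>d\<close> occur one after the other is at
  most the product of the probabilities \<open>q(a\<^sub>i)\<close> that the path on \<open>[0, s]\<close> has diameter at least \<open>a\<^sub>i\<close>.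
  Hence no power of the exponent is lost, and it suffices that \<open>q(a) = O(a\<^sup>-\<^sup>\<beta>)\<close> for some \<open>\<beta> > p\<close>.

  If no step of a fine grid reaches \<open>a\<close>, a swing of size \<open>3a\<close> contains two successive swings of size
  \<open>a\<close>, so \<open>q(3a) \<le> q(a)\<^sup>2 + O(a\<^sup>-\<^sup>\<beta>)\<close>, which gives the tail bound because \<open>q\<close> tends to 0. The bound for
  the steps comes from the characteristic function: \<open>E (1 - cos (v X\<^sub>t))\<^sup>m\<close> is, up to \<open>O(t\<^sup>2)\<close>, equal
  to \<open>t\<close> times the \<open>\<nu>\<close>-integral of the same function.

  The intrinsic volumes are fixed linear combinations of the volumes of finitely many parallel bodies.
\<close>

section \<open>Convex hulls and products of increments\<close>

text \<open>Bounding the volume of the hull by the \<open>d\<close>-th power of its diameter would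
  require moments of order \<open>d * p\<close>. But a heavy-tailed process becomes large through
  single jumps, and one jump stretches the hull in one direction only; a large volume needs several
  swings whose sizes multiply to it. A product of \<open>d\<close> factors with tails of order
  \<open>a^-\<beta>\<close> has the same tail up to a power of \<open>log a\<close>, which the room
  between \<open>p\<close> and \<beta> absorbs. The greedy choice orders the points by geometry,
  whereas independence needs the order of time; passing from one to the other costs a factor 2 per
  point.

  The order in \<open>t\<close> is decisive for the grid: \<open>n\<close> steps of length
  \<open>s / n\<close> are summed, so a single step needs a tail of order
  \<open>t * a^-\<beta>\<close> with an error \<open>o(t)\<close> that is uniform in
  \<open>a\<close>. For \<open>m = 1\<close> the Gaussian part would contribute
  \<open>t * a^-2\<close> at frequencies of order \<open>1 / a\<close>, too much for \<beta> > 2.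
  Since \<open>(1 - cos \<theta>)^m\<close> with \<open>m \<ge> 2\<close> vanishes at least to
  fourth order at 0, this term drops out and only the Levy measure remains.\<close>

fun chain :: "('b::linorder \<Rightarrow> 'a::real_normed_vector) \<Rightarrow> 'b set \<Rightarrow> real list \<Rightarrow> bool" where
  "chain x T [] \<longleftrightarrow> True"
| "chain x T (a # as) \<longleftrightarrow> (\<exists>u\<in>T. \<exists>v\<in>T. u \<le> v \<and> a \<le> norm (x v - x u) \<and> chain x (T \<inter> {v..}) as)"

text \<open>The cut-off \<open>max 1\<close> makes extra times harmless: no factor is below 1, and a
  repeated time contributes exactly 1.\<close>

fun gap_prod :: "('b \<Rightarrow> 'a::real_normed_vector) \<Rightarrow> 'b list \<Rightarrow> real" where
  "gap_prod x (u # v # us) = max 1 (norm (x v - x u)) * gap_prod x (v # us)"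
| "gap_prod x us = 1"

lemma gap_prod_ge_1: "1 \<le> gap_prod x us"
proof (induction x us rule: gap_prod.induct)
  case (1 x u v us)
  then show ?case
    using mult_mono[of 1 "max 1 (norm (x v - x u))" 1 "gap_prod x (v # us)"] by simp
qed auto

text \<open>Only one gap changes when \<open>t\<close> is inserted. If \<open>t\<close> falls
  between \<open>u\<close> and \<open>v\<close>, the triangle inequality bounds the old gap by the
  sum of the two new ones, so the larger new gap is at least half of the old one and the smaller is
  still at least \<open>h\<close>. At either end a new factor of size at least \<open>h\<close>
  appears.\<close>

lemma gap_prod_insort:
  assumes "sorted us" "us \<noteq> []" "\<And>u. u \<in> set us \<Longrightarrow> h \<le> norm (x t - x u)"
  shows "max 1 h * gap_prod x us \<le> 2 * gap_prod x (insort t us)"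
  using assms
proof (induction x us rule: gap_prod.induct)
  case (1 x u v us)
  define G where "G = gap_prod x (v # us)"
  define c where "c = max 1 (norm (x v - x u))"
  have G: "1 \<le> G" unfolding G_def by (rule gap_prod_ge_1)
  have hu: "h \<le> norm (x t - x u)" and hv: "h \<le> norm (x t - x v)" using 1(4) by auto
  consider "t \<le> u" | "u < t" "t \<le> v" | "u < t" "v < t" by force
  then show ?case
  proof cases
    case 1
    have "max 1 h * (c * G) \<le> max 1 (norm (x u - x t)) * (c * G)"
      using hu G by (intro mult_right_mono) (auto simp: c_def norm_minus_commute)
    moreover have "0 \<le> max 1 (norm (x u - x t)) * (c * G)"
      using G by (auto simp: c_def)
    ultimately show ?thesis using 1 by (simp add: G_def c_def)
  next
    case 2
    define a where "a = norm (x t - x u)"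
    define b where "b = norm (x v - x t)"
    have tri: "norm (x v - x u) \<le> a + b"
      using norm_triangle_ineq[of "x t - x u" "x v - x t"] by (simp add: a_def b_def)
    have "h \<le> a" "h \<le> b" using hu hv by (auto simp: a_def b_def norm_minus_commute)
    have "max 1 h * c \<le> 2 * (max 1 a * max 1 b)"
    proof (cases "a \<le> b")
      case True
      have "max 1 h * c \<le> max 1 a * (2 * max 1 b)"
        using True tri \<open>h \<le> a\<close> by (intro mult_mono) (auto simp: c_def)
      then show ?thesis by simp
    next
      case False
      have "max 1 h * c \<le> max 1 b * (2 * max 1 a)"
        using False tri \<open>h \<le> b\<close> by (intro mult_mono) (auto simp: c_def)
      then show ?thesis by (simp add: mult_ac)
    qed
    then have "max 1 h * c * G \<le> 2 * (max 1 a * max 1 b) * G"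
      using G by (intro mult_right_mono) auto
    then show ?thesis using 2 by (simp add: G_def c_def a_def b_def mult_ac)
  next
    case 3
    have "max 1 h * G \<le> 2 * gap_prod x (insort t (v # us))"
      using 1 unfolding G_def by (intro "1.IH") auto
    then have "c * (max 1 h * G) \<le> c * (2 * gap_prod x (insort t (v # us)))"
      by (intro mult_left_mono) (auto simp: c_def)
    moreover have "insort t (u # v # us) = u # insort t (v # us)" "gap_prod x (u # insort t (v # us)) = c * gap_prod x (insort t (v # us))"
      using 3 by (auto simp: c_def)
    ultimately show ?thesis by (simp add: G_def c_def mult_ac del: insort_key.simps)
  qed
next
  case ("2_2" x u)
  then show ?case by (auto simp: norm_minus_commute)
qed auto

lemma gap_prod_hd_Cons: "us \<noteq> [] \<Longrightarrow> gap_prod x (hd us # us) = gap_prod x us"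
  by (cases us) auto

text \<open>Padding keeps the number of times fixed even if the hull turns out to be flat, so that
  one list length serves every path.\<close>

lemma gap_prod_replicate: "gap_prod x (replicate n (hd us) @ us) = gap_prod x us" if "us \<noteq> []"
proof (induction n)
  case (Suc n)
  have "hd (replicate n (hd us) @ us) = hd us" by (cases n) auto
  then show ?case
    using gap_prod_hd_Cons[of "replicate n (hd us) @ us" x] that Suc by simp
qed simp

lemma sorted_replicate_hd: "sorted us \<Longrightarrow> us \<noteq> [] \<Longrightarrow> sorted (replicate n (hd us) @ us)"
  by (cases us) (auto simp: sorted_append)

text \<open>\<open>R\<close> removes the directions of the points already chosen, which all lie in
  \<open>y + ker R\<close>. The induction carries the number of balls times the old gap product: a
  new direction multiplies the number of balls by at most \<open>5 * max 1 g\<close>, and inserting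
  the new time gains \<open>max 1 g\<close> up to a factor 2, whence the base 10. Each direction
  adds 1 to the covering radius, whence the radius \<open>n\<close>.\<close>

lemma hull_cover_linear_image:
  fixes x :: "'b::linorder \<Rightarrow> 'a::euclidean_space" and R :: "'a \<Rightarrow> 'a"
  assumes bdd: "bounded (x ` T)"
    and "linear R" "\<And>z. norm (R z) \<le> norm z" "dim (range R) \<le> n"
    and "us \<noteq> []" "sorted us" "set us \<subseteq> T" "\<And>u. u \<in> set us \<Longrightarrow> R (x u - y) = 0"
  shows "\<exists>vs C. length vs = length us + n \<and> sorted vs \<and> set vs \<subseteq> T \<and> finite C \<and>
           card C * gap_prod x us \<le> 10 ^ n * gap_prod x vs \<and>
           (\<forall>z\<in>convex hull (x ` T). \<exists>c\<in>C. norm (R (z - y) - c) \<le> n)"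
  using assms(2-)
proof (induction n arbitrary: R us)
  case 0
  have "dim (range R) = 0" using "0.prems"(3) by simp
  then have "range R \<subseteq> {0}" by (simp only: dim_eq_0)
  then have "R z = 0" for z by blast
  then show ?case using "0.prems"(5,6) by (intro exI[of _ us] exI[of _ "{0}"]) simp
next
  case (Suc n)
  interpret R: linear R by (fact Suc.prems)
  have T: "T \<noteq> {}" using Suc.prems by (cases us) auto
  obtain B where B: "\<And>t. t \<in> T \<Longrightarrow> norm (x t) \<le> B"
    using bdd unfolding bounded_iff by auto
  define h where "h = (SUP t\<in>T. norm (R (x t - y)))"
  have bdda: "bdd_above ((\<lambda>t. norm (R (x t - y))) ` T)"
  proof (rule bdd_aboveI2)
    fix t assume "t \<in> T"
    then show "norm (R (x t - y)) \<le> B + norm y"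
      using Suc.prems(2)[of "x t - y"] B[of t] norm_triangle_ineq4[of "x t" y] by linarith
  qed
  have hT: "norm (R (x t - y)) \<le> h" if "t \<in> T" for t
    unfolding h_def using that bdda by (rule cSUP_upper)
  have hull: "norm (R (z - y)) \<le> h" if "z \<in> convex hull (x ` T)" for z
  proof -
    have "convex hull (x ` T) \<subseteq> R -` cball (R y) h"
    proof (rule hull_minimal)
      show "x ` T \<subseteq> R -` cball (R y) h"
        using hT by (auto simp: dist_norm norm_minus_commute R.diff)
      show "convex (R -` cball (R y) h)"
        using Suc.prems(1) by (intro convex_linear_vimage) auto
    qed
    then show ?thesis using that by (auto simp: dist_norm norm_minus_commute R.diff)
  qed
  show ?case
  proof (cases "h \<le> 0")
    \<comment> \<open>The whole hull lies in \<open>y + ker R\<close>, so the single centre 0 is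
      enough and the list is merely padded.\<close>
    case True
    have "norm (R (z - y) - 0) \<le> real (Suc n)" if "z \<in> convex hull (x ` T)" for z
      using hull[OF that] True by simp
    moreover have "gap_prod x us \<le> 10 * 10 ^ n * gap_prod x us"
    proof -
      have "1 \<le> 10 * (10::real) ^ n" using one_le_power[of "10::real" n] by linarith
      then show ?thesis using gap_prod_ge_1[of x us] by (simp add: mult_le_cancel_right1)
    qed
    moreover have "set (replicate (Suc n) (hd us) @ us) \<subseteq> T"
      using Suc.prems(4,6) by (cases us) auto
    ultimately show ?thesis
      using gap_prod_replicate[OF Suc.prems(4), of x "Suc n"] sorted_replicate_hd[OF Suc.prems(5,4), of "Suc n"]
      by (intro exI[of _ "replicate (Suc n) (hd us) @ us"] exI[of _ "{0}"])
         (simp del: replicate_Suc of_nat_Suc)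
  next
    case False
    then have h: "0 < h" by simp
    \<comment> \<open>The supremum need not be attained on \<open>T\<close>, hence a time that
      realises more than half of it.\<close>
    then have "h / 2 < (SUP t\<in>T. norm (R (x t - y)))" unfolding h_def by simp
    then obtain t where t: "t \<in> T" "h / 2 < norm (R (x t - y))"
      using less_cSUP_iff[OF T bdda] by auto
    define g where "g = norm (R (x t - y))"
    have g: "0 < g" "h < 2 * g" using t h by (auto simp: g_def)
    define b where "b = (1 / g) *\<^sub>R R (x t - y)"
    have b: "norm b = 1" "b \<bullet> b = 1"
  proof -
      show "norm b = 1" using g by (simp add: b_def g_def)
      then show "b \<bullet> b = 1" by (simp add: norm_eq_1)
    qed
    \<comment> \<open>\<open>w\<close> is a preimage of \<open>b\<close> under \<open>R\<close>;
      subtracting multiples of \<open>w\<close> shows that the range of \<open>R'\<close> lies in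
      that of \<open>R\<close>. As \<open>b\<close> itself is lost, the dimension drops.\<close>
    define w where "w = (1 / g) *\<^sub>R (x t - y)"
    have bR: "R w = b" by (simp add: b_def w_def R.scale)
    define R' where "R' z = R z - (R z \<bullet> b) *\<^sub>R b" for z
    have R'b: "R' z \<bullet> b = 0" for z using b by (simp add: R'_def inner_diff_left)
    have linR': "linear R'"
      by (intro linearI) (simp_all add: R'_def R.add R.scale inner_add_left scaleR_add_left scaleR_diff_right)
    have normR': "norm (R' z) \<le> norm z" for z
    proof -
      have "(norm (R z))\<^sup>2 = (norm (R' z + (R z \<bullet> b) *\<^sub>R b))\<^sup>2" by (simp add: R'_def)
      also have "\<dots> = (norm (R' z))\<^sup>2 + (R z \<bullet> b)\<^sup>2"
        by (subst norm_add_Pythagorean) (simp_all add: orthogonal_def R'b b)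
      finally have "(norm (R' z))\<^sup>2 \<le> (norm (R z))\<^sup>2" by simp
      then have "norm (R' z) \<le> norm (R z)" by (rule power2_le_imp_le) simp
      then show ?thesis using Suc.prems(2)[of z] by linarith
    qed
    have "dim (range R') < dim (range R)"
    proof (rule dim_psubset)
      have "range R' \<subseteq> range R"
      proof safe
        fix z
        have "R' z = R (z - (R z \<bullet> b) *\<^sub>R w)"
          by (simp add: R'_def R.diff R.scale bR)
        then show "R' z \<in> range R" by simp
      qed
      moreover have "b \<in> range R" using bR by blast
      moreover have "b \<notin> range R'" using R'b b(2) by (metis imageE zero_neq_one)
      ultimately have "range R' \<subset> range R" by auto
      moreover have "span (range R') = range R'" "span (range R) = range R"
        by (simp_all add: linear_subspace_image[OF linR'] linear_subspace_image[OF Suc.prems(1)])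
      ultimately show "span (range R') \<subset> span (range R)" by (simp only:)
    qed
    then have dimR': "dim (range R') \<le> n" using Suc.prems(3) by simp
    have R'0: "R' (x u - y) = 0" if "u \<in> set (insort t us)" for u
    proof (cases "u \<in> set us")
      case True
      then show ?thesis using Suc.prems(7) by (simp add: R'_def)
    next
      case False
      then have u: "u = t" using that by (auto simp: set_insort_key)
      have "R (x t - y) = g *\<^sub>R b" using g by (simp add: b_def)
      then show ?thesis using b by (simp add: R'_def u)
    qed
    obtain vs C where vs: "length vs = length (insort t us) + n" "sorted vs" "set vs \<subseteq> T"
      and C: "finite C" "card C * gap_prod x (insort t us) \<le> 10 ^ n * gap_prod x vs"
        "\<And>z. z \<in> convex hull (x ` T) \<Longrightarrow> \<exists>c\<in>C. norm (R' (z - y) - c) \<le> n"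
    proof -
      have us: "insort t us \<noteq> []" "sorted (insort t us)" "set (insort t us) \<subseteq> T"
        using Suc.prems(4-6) t(1) by (auto simp: sorted_insort set_insort_key)
      show ?thesis
        using Suc.IH[of R' "insort t us", OF linR' _ dimR' us] normR' R'0 that by blast
    qed
    \<comment> \<open>Since \<open>h < 2 * g\<close>, there are at most
      \<open>2 * h + 1 < 4 * g + 1 \<le> 5 * max 1 g\<close> multiples of \<open>b\<close>.\<close>
    define I where "I = {-\<lfloor>h\<rfloor>..\<lfloor>h\<rfloor>}"
    define D where "D = (\<lambda>(c, k). c + real_of_int k *\<^sub>R b) ` (C \<times> I)"
    have cI: "real (card I) \<le> 5 * max 1 g"
    proof -
      have "real (card I) = 2 * real_of_int \<lfloor>h\<rfloor> + 1" unfolding I_def using h by simp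
      then show ?thesis using g of_int_floor_le[of h] by linarith
    qed
    \<comment> \<open>\<open>R\<close> is a contraction that maps every \<open>x u - y\<close> to 0,
      so \<open>x t\<close> has distance at least \<open>g\<close> from all points chosen so
      far.\<close>
    have gap: "max 1 g * gap_prod x us \<le> 2 * gap_prod x (insort t us)"
    proof (rule gap_prod_insort)
      fix u assume u: "u \<in> set us"
      have "R (x t - x u) = R (x t - y) - R (x u - y)" by (simp add: R.diff)
      then have "g = norm (R (x t - x u))" using Suc.prems(7)[OF u] by (simp add: g_def)
      then show "g \<le> norm (x t - x u)" using Suc.prems(2) by simp
    qed (fact Suc.prems)+
    have "card D \<le> card C * card I"
      unfolding D_def using C(1) card_image_le[of "C \<times> I"] by (simp add: card_cartesian_product I_def)
    then have "real (card D) * gap_prod x us \<le> (real (card C) * real (card I)) * gap_prod x us"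
      using gap_prod_ge_1[of x us] by (intro mult_right_mono) (auto simp flip: of_nat_mult)
    also have "\<dots> \<le> real (card C) * (5 * max 1 g) * gap_prod x us"
      using cI gap_prod_ge_1[of x us] by (intro mult_right_mono mult_left_mono) auto
    also have "\<dots> = 5 * real (card C) * (max 1 g * gap_prod x us)" by simp
    also have "\<dots> \<le> 5 * real (card C) * (2 * gap_prod x (insort t us))"
      using gap by (intro mult_left_mono) auto
    also have "\<dots> \<le> 10 * (10 ^ n * gap_prod x vs)" using C(2) by (simp add: mult_ac)
    finally have cD: "real (card D) * gap_prod x us \<le> 10 ^ Suc n * gap_prod x vs" by simp
    have cov: "\<exists>c\<in>D. norm (R (z - y) - c) \<le> real (Suc n)" if z: "z \<in> convex hull (x ` T)" for z
    proof -
      obtain c where c: "c \<in> C" "norm (R' (z - y) - c) \<le> n" using C(3)[OF z] by auto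
      define s where "s = R (z - y) \<bullet> b"
      have s: "\<bar>s\<bar> \<le> h"
        using Cauchy_Schwarz_ineq2[of "R (z - y)" b] b hull[OF z] by (simp add: s_def)
      \<comment> \<open>Rounding towards zero never increases the absolute value, so
        \<open>k\<close> stays in \<open>I\<close>.\<close>
      define k where "k = (if 0 \<le> s then \<lfloor>s\<rfloor> else \<lceil>s\<rceil>)"
      have "k \<in> I" "\<bar>s - k\<bar> \<le> 1"
      proof -
        have "\<lfloor>s\<rfloor> \<le> \<lfloor>h\<rfloor>" "- \<lceil>s\<rceil> \<le> \<lfloor>h\<rfloor>"
          using s by (auto simp: ceiling_def intro!: floor_mono)
        moreover have "0 \<le> k \<and> k = \<lfloor>s\<rfloor> \<or> k \<le> 0 \<and> k = \<lceil>s\<rceil>" by (auto simp: k_def)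
        moreover have "0 \<le> \<lfloor>h\<rfloor>" using h by simp
        ultimately show "k \<in> I" unfolding I_def atLeastAtMost_iff by linarith
        have "k = \<lfloor>s\<rfloor> \<or> k = \<lceil>s\<rceil>" by (simp add: k_def)
        then show "\<bar>s - k\<bar> \<le> 1" by (elim disjE; simp only:; linarith)
      qed
      then have "c + real_of_int k *\<^sub>R b \<in> D" using c(1) by (auto simp: D_def)
      moreover have "R (z - y) - (c + real_of_int k *\<^sub>R b) = (R' (z - y) - c) + (s - k) *\<^sub>R b"
        by (simp add: R'_def s_def algebra_simps)
      then have "norm (R (z - y) - (c + real_of_int k *\<^sub>R b)) \<le> norm (R' (z - y) - c) + norm ((s - k) *\<^sub>R b)"
        by (metis norm_triangle_ineq)
      then have "norm (R (z - y) - (c + real_of_int k *\<^sub>R b)) \<le> real (Suc n)"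
        using c(2) \<open>\<bar>s - k\<bar> \<le> 1\<close> b by simp
      ultimately show ?thesis by blast
    qed
    have "finite D" using C(1) by (auto simp: D_def I_def)
    then show ?thesis using vs cD cov
      by (intro exI[of _ vs] exI[of _ D]) (auto simp: length_insort)
  qed
qed

lemma hull_cover:
  fixes x :: "'b::linorder \<Rightarrow> 'a::euclidean_space"
  assumes bdd: "bounded (x ` T)" and "T \<noteq> {}"
  shows "\<exists>vs C. length vs = Suc DIM('a) \<and> sorted vs \<and> set vs \<subseteq> T \<and> finite C \<and>
           real (card C) \<le> 10 ^ DIM('a) * gap_prod x vs \<and>
           closure (convex hull (x ` T)) \<subseteq> (\<Union>c\<in>C. cball c DIM('a))"
proof -
  obtain t where t: "t \<in> T" using \<open>T \<noteq> {}\<close> by auto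
  have "dim (range (\<lambda>z::'a. z)) \<le> DIM('a)" by simp
  then obtain vs C where vs: "length vs = Suc DIM('a)" "sorted vs" "set vs \<subseteq> T" "finite C"
    "card C * gap_prod x [t] \<le> 10 ^ DIM('a) * gap_prod x vs"
    "\<And>z. z \<in> convex hull (x ` T) \<Longrightarrow> \<exists>c\<in>C. norm (z - x t - c) \<le> DIM('a)"
    using hull_cover_linear_image[OF bdd, of "\<lambda>z. z" "DIM('a)" "[t]" "x t"] t
    by (auto simp: linear_ident)
  let ?D = "(\<lambda>c. x t + c) ` C"
  have "convex hull (x ` T) \<subseteq> (\<Union>c\<in>?D. cball c DIM('a))"
  proof
    fix z assume "z \<in> convex hull (x ` T)"
    then obtain c where "c \<in> C" "norm (z - x t - c) \<le> DIM('a)" using vs(6) by blast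
    then show "z \<in> (\<Union>c\<in>?D. cball c DIM('a))"
      by (auto simp: dist_norm norm_minus_commute diff_diff_eq intro!: bexI[of _ c])
  qed
  moreover have "closed (\<Union>c\<in>?D. cball c DIM('a))" using vs(4) by auto
  ultimately have "closure (convex hull (x ` T)) \<subseteq> (\<Union>c\<in>?D. cball c DIM('a))"
    by (rule closure_minimal)
  moreover have "real (card ?D) \<le> 10 ^ DIM('a) * gap_prod x vs"
    using vs(4,5) card_image_le[of C "\<lambda>c. x t + c"] by simp
  ultimately show ?thesis using vs by (intro exI[of _ vs] exI[of _ ?D]) auto
qed

lemma measure_parallel_hull_le:
  fixes x :: "'b::linorder \<Rightarrow> 'a::euclidean_space"
  assumes bdd: "bounded (x ` T)" and "T \<noteq> {}" and r: "0 \<le> r"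
  shows "\<exists>vs. length vs = Suc DIM('a) \<and> sorted vs \<and> set vs \<subseteq> T \<and>
           measure lebesgue (closure (convex hull (x ` T)) + (\<lambda>x. r *\<^sub>R x) ` cball 0 1)
             \<le> 10 ^ DIM('a) * measure lebesgue (cball (0::'a) (real DIM('a) + r)) * gap_prod x vs"
proof -
  obtain vs C where vs: "length vs = Suc DIM('a)" "sorted vs" "set vs \<subseteq> T" "finite C"
    "real (card C) \<le> 10 ^ DIM('a) * gap_prod x vs"
    "closure (convex hull (x ` T)) \<subseteq> (\<Union>c\<in>C. cball c DIM('a))"
    using hull_cover[OF bdd \<open>T \<noteq> {}\<close>] by blast
  let ?K = "closure (convex hull (x ` T)) + (\<lambda>x. r *\<^sub>R x) ` cball 0 1"
  let ?m = "measure lebesgue (cball (0::'a) (real DIM('a) + r))"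
  have "compact ?K"
    unfolding set_plus_image by (intro compact_continuous_image compact_Times)
      (auto simp: split_def intro!: continuous_intros compact_continuous_image bounded_convex_hull bdd)
  then have sets: "?K \<in> sets lebesgue" by (simp add: compact_imp_closed)
  have sub: "?K \<subseteq> (\<Union>c\<in>C. cball c (real DIM('a) + r))"
  proof
    fix z assume "z \<in> ?K"
    then obtain u v where uv: "z = u + r *\<^sub>R v" "u \<in> closure (convex hull (x ` T))" "norm v \<le> 1"
      by (auto elim!: set_plus_elim)
    then obtain c where "c \<in> C" "dist c u \<le> DIM('a)" using vs(6) by auto
    moreover have "dist u (u + r *\<^sub>R v) \<le> r" using uv(3) r mult_left_mono[of "norm v" 1 r]
      by (simp add: dist_norm)
    ultimately show "z \<in> (\<Union>c\<in>C. cball c (real DIM('a) + r))"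
      using uv(1) dist_triangle[of c z u] by (auto intro!: bexI[of _ c])
  qed
  have "measure lebesgue ?K \<le> measure lebesgue (\<Union>c\<in>C. cball c (real DIM('a) + r))"
    by (rule measure_mono_fmeasurable[OF sub sets]) (auto intro: vs)
  also have "\<dots> \<le> (\<Sum>c\<in>C. measure lebesgue (cball c (real DIM('a) + r)))"
    using vs(4) by (intro measure_UNION_le) auto
  also have "\<dots> = (\<Sum>c\<in>C. ?m)"
  proof (intro sum.cong refl)
    fix c :: 'a
    have "cball c (real DIM('a) + r) = (+) c ` cball 0 (real DIM('a) + r)"
      using cball_translation[of c 0] by simp
    then show "measure lebesgue (cball c (real DIM('a) + r)) = ?m" by (metis measure_translation)
  qed
  also have "\<dots> = real (card C) * ?m" by simp
  also have "\<dots> \<le> (10 ^ DIM('a) * gap_prod x vs) * ?m"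
    using vs(5) by (intro mult_right_mono) auto
  finally show ?thesis using vs by (intro exI[of _ vs]) (auto simp: mult_ac)
qed

section \<open>Successive swings of a random walk\<close>

text \<open>Swings see only increments, so a path may be replaced by the partial sums of its
  increments from any starting point.\<close>

lemma chain_cong:
  assumes "\<And>u v. u \<in> T \<Longrightarrow> v \<in> T \<Longrightarrow> u \<le> v \<Longrightarrow> norm (x v - x u) = norm (y v - y u)"
  shows "chain x T as \<longleftrightarrow> chain y T as"
  using assms
proof (induction as arbitrary: T)
  case (Cons a as)
  have "chain x (T \<inter> {v..}) as \<longleftrightarrow> chain y (T \<inter> {v..}) as" for v
    by (rule Cons.IH) (simp add: Cons.prems)
  then show ?case using Cons.prems by simp metis
qed simp

lemma chain_mono: "chain x T as \<Longrightarrow> T \<subseteq> T' \<Longrightarrow> chain x T' as"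
proof (induction as arbitrary: T T')
  case (Cons a as)
  then obtain u v where "u \<in> T" "v \<in> T" "u \<le> v" "a \<le> norm (x v - x u)" "chain x (T \<inter> {v..}) as"
    by auto
  moreover have "chain x (T' \<inter> {v..}) as"
    using Cons.IH[OF \<open>chain x (T \<inter> {v..}) as\<close>] Cons.prems(2) by blast
  ultimately show ?case using Cons.prems(2) by auto
qed simp

lemma chain_image:
  fixes f :: "'b::linorder \<Rightarrow> 'c::linorder"
  assumes "chain x (f ` T) as" and f: "strict_mono f"
  shows "chain (\<lambda>k. x (f k)) T as"
  using assms(1)
proof (induction as arbitrary: T)
  case (Cons a as)
  then obtain u v where uv: "u \<in> T" "v \<in> T" "f u \<le> f v" "a \<le> norm (x (f v) - x (f u))"
    "chain x (f ` T \<inter> {f v..}) as"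
    by auto
  have "f ` T \<inter> {f v..} = f ` (T \<inter> {v..})"
    using strict_mono_less_eq[OF f] by auto
  then have "chain (\<lambda>k. x (f k)) (T \<inter> {v..}) as" using Cons.IH uv(5) by simp
  then show ?case using uv strict_mono_less_eq[OF f] by auto
qed simp

text \<open>A chain uses finitely many times, and these lie in a common \<open>T m\<close>.\<close>

lemma chain_UN_incseq:
  assumes "incseq T" "chain x (\<Union>m. T m) as"
  shows "\<exists>m. chain x (T m) as"
  using assms
proof (induction as arbitrary: T)
  case (Cons a as)
  then obtain u v where uv: "u \<in> (\<Union>m. T m)" "v \<in> (\<Union>m. T m)" "u \<le> v" "a \<le> norm (x v - x u)"
    "chain x ((\<Union>m. T m) \<inter> {v..}) as"
    by auto
  have "incseq (\<lambda>m. T m \<inter> {v..})" using Cons.prems(1) by (auto simp: incseq_def)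
  moreover have "(\<Union>m. T m) \<inter> {v..} = (\<Union>m. T m \<inter> {v..})" by auto
  ultimately obtain m where m: "chain x (T m \<inter> {v..}) as" using Cons.IH uv(5) by metis
  obtain i j where ij: "u \<in> T i" "v \<in> T j" using uv by auto
  define k where "k = max m (max i j)"
  have sub: "T m \<subseteq> T k" "T i \<subseteq> T k" "T j \<subseteq> T k"
    using Cons.prems(1) unfolding incseq_def k_def by simp_all
  have "chain x (T k \<inter> {v..}) as" using m by (rule chain_mono) (use sub in auto)
  moreover have "u \<in> T k" "v \<in> T k" using ij sub by auto
  ultimately show ?case
    unfolding chain.simps using uv(3,4) by blast
qed simp

lemma pred_countable_Bex:
  assumes "countable T" "\<And>i. i \<in> T \<Longrightarrow> Measurable.pred N (P i)"
  shows "Measurable.pred N (\<lambda>x. \<exists>i\<in>T. P i x)"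
proof -
  have "{x \<in> space N. \<exists>i\<in>T. P i x} = (\<Union>i\<in>T. {x \<in> space N. P i x})" by auto
  also have "\<dots> \<in> sets N" using assms by (intro sets.countable_UN'') (auto simp: pred_def)
  finally show ?thesis by (simp add: pred_def)
qed

lemma pred_countable_Ball:
  assumes "countable T" "\<And>i. i \<in> T \<Longrightarrow> Measurable.pred N (P i)"
  shows "Measurable.pred N (\<lambda>x. \<forall>i\<in>T. P i x)"
proof -
  have "Measurable.pred N (\<lambda>x. \<not> (\<exists>i\<in>T. \<not> P i x))"
    using assms by (intro pred_intros_logic pred_countable_Bex)
  then show ?thesis by simp
qed

lemma measurable_chain:
  fixes x :: "'b::linorder \<Rightarrow> 'c \<Rightarrow> 'a::euclidean_space"
  assumes "countable T" "\<And>t. t \<in> T \<Longrightarrow> x t \<in> borel_measurable N"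
  shows "Measurable.pred N (\<lambda>\<omega>. chain (\<lambda>t. x t \<omega>) T as)"
  using assms
proof (induction as arbitrary: T)
  case (Cons a as)
  have [measurable]: "Measurable.pred N (\<lambda>\<omega>. chain (\<lambda>t. x t \<omega>) (T \<inter> {v..}) as)" for v
    using Cons.prems by (intro Cons.IH) auto
  have "Measurable.pred N (\<lambda>\<omega>. u \<le> v \<and> a \<le> norm (x v \<omega> - x u \<omega>) \<and> chain (\<lambda>t. x t \<omega>) (T \<inter> {v..}) as)"
    if "u \<in> T" "v \<in> T" for u v
  proof -
    have [measurable]: "x u \<in> borel_measurable N" "x v \<in> borel_measurable N"
      using that Cons.prems by auto
    show ?thesis by measurable
  qed
  then show ?case
    unfolding chain.simps using Cons.prems(1) by (intro pred_countable_Bex)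
qed simp

text \<open>Each gap is rounded down to a power of 2 and its exponent capped at \<open>N\<close>, so
  that only finitely many lists of exponents occur. If the total stays below \<open>N\<close>, no
  cap was active and the rounding loses at most a factor 2 per gap. Exponent 0 stands for the
  threshold 0 rather than 1, because a factor 1 of the gap product says nothing about the size of
  the gap.\<close>

lemma chain_dyadic_levels:
  assumes "sorted vs" "set vs \<subseteq> T" "vs \<noteq> []"
  shows "\<exists>ms. length ms = length vs - 1 \<and> set ms \<subseteq> {..N} \<and>
           (N \<le> sum_list ms \<or> gap_prod x vs \<le> 2 ^ (sum_list ms + length ms)) \<and>
           chain x T (map (\<lambda>m. if m = 0 then 0 else 2 ^ m) ms)"
  using assms
proof (induction x vs arbitrary: T rule: gap_prod.induct)
  case (1 x u v us)
  let ?lev = "\<lambda>m. if m = 0 then 0 else (2::real) ^ m"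
  obtain ms where ms: "length ms = length us" "set ms \<subseteq> {..N}"
    "N \<le> sum_list ms \<or> gap_prod x (v # us) \<le> 2 ^ (sum_list ms + length ms)"
    "chain x (T \<inter> {v..}) (map ?lev ms)"
  proof -
    have "sorted (v # us)" "set (v # us) \<subseteq> T \<inter> {v..}" using "1.prems" by auto
    from "1.IH"[OF this] show ?thesis using that by auto
  qed
  define g where "g = max 1 (norm (x v - x u))"
  define n where "n = (LEAST n. g < 2 ^ n)"
  obtain n' where "g < 2 ^ n'" using real_arch_pow[of 2 g] by auto
  then have n: "g < 2 ^ n" unfolding n_def by (rule LeastI)
  then have "n \<noteq> 0" by (intro notI) (simp add: g_def)
  then obtain m0 where m0: "n = Suc m0" using not0_implies_Suc by blast
  then have le: "2 ^ m0 \<le> g" using not_less_Least[of m0 "\<lambda>n. g < 2 ^ n"] by (simp add: n_def)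
  define m where "m = min N m0"
  have lev: "?lev m \<le> norm (x v - x u)"
  proof (cases "m = 0")
    case False
    then have "1 < (2::real) ^ m" by (intro one_less_power) auto
    moreover have "(2::real) ^ m \<le> 2 ^ m0" by (intro power_increasing) (auto simp: m_def)
    ultimately have "1 < g" "2 ^ m \<le> g" using le by linarith+
    then have "2 ^ m \<le> norm (x v - x u)" by (simp add: g_def max_def split: if_splits)
    then show ?thesis using False by simp
  qed simp
  have "N \<le> m + sum_list ms \<or> g * gap_prod x (v # us) \<le> 2 ^ (m + sum_list ms + Suc (length ms))"
  proof (cases "N \<le> m + sum_list ms")
    case False
    then have "m = m0" "gap_prod x (v # us) \<le> 2 ^ (sum_list ms + length ms)"
      using ms(3) by (auto simp: m_def)
    then have "g * gap_prod x (v # us) \<le> 2 ^ Suc m * 2 ^ (sum_list ms + length ms)"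
      using n m0 gap_prod_ge_1[of x "v # us"] by (intro mult_mono) auto
    then show ?thesis by (simp add: power_add)
  qed simp
  moreover have "chain x T (map ?lev (m # ms))"
    unfolding list.map chain.simps using "1.prems" lev ms(4)
    by (intro bexI[of _ u] bexI[of _ v] conjI) auto
  ultimately show ?case
    using ms(1,2) by (intro exI[of _ "m # ms"]) (auto simp: g_def m_def add_ac)
qed auto

lemma chain_of_gap_prod:
  assumes "sorted vs" "set vs \<subseteq> T" "length vs = Suc d" "2 ^ (N + d) < gap_prod x vs"
  shows "\<exists>ms. length ms = d \<and> set ms \<subseteq> {..N} \<and> N \<le> sum_list ms \<and>
           chain x T (map (\<lambda>m. if m = 0 then 0 else 2 ^ m) ms)"
proof -
  obtain ms where ms: "length ms = d" "set ms \<subseteq> {..N}"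
    "N \<le> sum_list ms \<or> gap_prod x vs \<le> 2 ^ (sum_list ms + d)"
    "chain x T (map (\<lambda>m. if m = 0 then 0 else 2 ^ m) ms)"
    using chain_dyadic_levels[OF assms(1,2), of N x] assms(3) by fastforce
  have "N \<le> sum_list ms"
  proof (rule ccontr)
    assume "\<not> N \<le> sum_list ms"
    then have "gap_prod x vs \<le> 2 ^ (sum_list ms + d)" "(2::real) ^ (sum_list ms + d) \<le> 2 ^ (N + d)"
      using ms(3) by (auto intro: power_increasing)
    then show False using assms(4) by linarith
  qed
  then show ?thesis using ms by blast
qed

text \<open>The first index \<open>m\<close> at which the walk is at distance \<open>a\<close> from
  \<open>x u\<close> overshoots by less than one step, so \<open>x m\<close> is within
  \<open>2 * a\<close> of \<open>x u\<close>. Of a swing of size \<open>3 * a\<close> at least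
  \<open>a\<close> is left after \<open>m\<close>.\<close>

lemma chain_split_large:
  fixes x :: "nat \<Rightarrow> 'a::real_normed_vector"
  assumes "chain x {..n} [3 * a]" "0 < a" "\<And>k. k < n \<Longrightarrow> norm (x (Suc k) - x k) < a"
  shows "chain x {..n} [a, a]"
proof -
  obtain u v where uv: "u \<le> v" "v \<le> n" "3 * a \<le> norm (x v - x u)" using assms(1) by auto
  define m where "m = (LEAST m. u \<le> m \<and> a \<le> norm (x m - x u))"
  have ex: "u \<le> v \<and> a \<le> norm (x v - x u)" using uv \<open>0 < a\<close> by simp
  have m: "u \<le> m" "a \<le> norm (x m - x u)"
    using LeastI[where P="\<lambda>m. u \<le> m \<and> a \<le> norm (x m - x u)", OF ex] by (auto simp: m_def)
  have "m \<le> v" unfolding m_def by (rule Least_le) (rule ex)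
  have "m \<noteq> u" using m \<open>0 < a\<close> by auto
  then obtain k where k: "m = Suc k" "u \<le> k" using m(1) by (cases m) auto
  have "norm (x k - x u) < a"
    using not_less_Least[of k "\<lambda>m. u \<le> m \<and> a \<le> norm (x m - x u)"] k by (auto simp: m_def)
  moreover have "norm (x m - x k) < a" using assms(3)[of k] k \<open>m \<le> v\<close> uv by simp
  moreover have "norm (x v - x u) \<le> norm (x v - x m) + norm (x m - x k) + norm (x k - x u)"
    using norm_triangle_ineq[of "x v - x m" "x m - x k"]
      norm_triangle_ineq[of "x v - x k" "x k - x u"] by simp
  ultimately have "a \<le> norm (x v - x m)" using uv(3) by linarith
  moreover have "m \<le> n" "u \<le> n" using \<open>m \<le> v\<close> uv by auto
  ultimately show ?thesis using m \<open>m \<le> v\<close> uv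
    by simp (intro bexI[of _ u] bexI[of _ m] conjI bexI[of _ v], auto)
qed

context prob_space
begin

text \<open>First passage decomposition: \<open>F l\<close> says that \<open>l\<close> is the first
  index at which a swing of size \<open>a\<close> is completed. It is decided by the increments
  before \<open>l\<close>, while what remains of the chain is decided by those from \<open>l\<close>
  on. The events \<open>F l\<close> are disjoint and each contains a swing of size \<open>a\<close>,
  so their probabilities add up to at most \<open>p a\<close>. The induction runs over all starting
  indices \<open>k\<close>, with a bound that does not depend on \<open>k\<close>.\<close>

lemma prob_chain_le_prod:
  fixes Y :: "nat \<Rightarrow> 'a \<Rightarrow> 'b::euclidean_space"
  assumes ind: "indep_vars (\<lambda>_. borel) Y {..<n}"
  defines "S \<equiv> \<lambda>k \<omega>. \<Sum>i<k. Y i \<omega>"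
  shows "prob {\<omega> \<in> space M. chain (\<lambda>k. S k \<omega>) {..n} as}
          \<le> (\<Prod>a\<leftarrow>as. prob {\<omega> \<in> space M. chain (\<lambda>k. S k \<omega>) {..n} [a]})"
proof -
  have Y [measurable]: "random_variable borel (Y i)" if "i < n" for i
    using ind that by (auto simp: indep_vars_def)
  have S [measurable]: "random_variable borel (S k)" if "k \<le> n" for k
    unfolding S_def using that Y by (intro borel_measurable_sum) auto
  have S_diff: "S v \<omega> - S u \<omega> = (\<Sum>i\<in>{u..<v}. Y i \<omega>)" if "u \<le> v" for u v \<omega>
    unfolding S_def using sum_diff_nat_ivl[of 0 u v "\<lambda>i. Y i \<omega>"] that by (simp add: atLeast0LessThan)
  define p where "p a = prob {\<omega> \<in> space M. chain (\<lambda>k. S k \<omega>) {..n} [a]}" for a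
  have chain_sets: "{\<omega> \<in> space M. chain (\<lambda>k. S k \<omega>) T bs} \<in> events" if "T \<subseteq> {..n}" for T bs
  proof -
    have "Measurable.pred M (\<lambda>\<omega>. chain (\<lambda>k. S k \<omega>) T bs)"
      using that by (intro measurable_chain) (auto intro: countable_subset S)
    then show ?thesis by measurable
  qed
  have "prob {\<omega> \<in> space M. chain (\<lambda>k. S k \<omega>) {k..n} as} \<le> (\<Prod>a\<leftarrow>as. p a)" if "k \<le> n" for k
    using that
  proof (induction as arbitrary: k)
    case (Cons a as)
    \<comment> \<open>As a predicate on sequences of increments, first passage is a function of the
      coordinates in \<open>{k..<l}\<close> alone, which is the form that independence of disjoint
      blocks requires.\<close>
    define fp where "fp l y \<longleftrightarrow> (\<exists>j\<in>{k..l}. a \<le> norm (\<Sum>i\<in>{j..<l}. y i)) \<and>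
      (\<forall>l'\<in>{k..<l}. \<forall>j\<in>{k..l'}. norm (\<Sum>i\<in>{j..<l'}. y i) < a)" for l and y :: "nat \<Rightarrow> 'b"
    define F where "F l = {\<omega> \<in> space M. fp l (\<lambda>i. Y i \<omega>)}" for l
    define C where "C l = {\<omega> \<in> space M. chain (\<lambda>k. S k \<omega>) {l..n} as}" for l
    have C_sets: "C l \<in> events" for l unfolding C_def by (rule chain_sets) auto
    have fp_meas: "Measurable.pred (PiM A (\<lambda>_. borel)) (fp l)" if "{k..<l} \<subseteq> A" for l A
    proof -
      have *: "Measurable.pred (PiM A (\<lambda>_. borel)) (\<lambda>y :: nat \<Rightarrow> 'b. a \<le> norm (\<Sum>i\<in>{j..<l'}. y i))"
        "Measurable.pred (PiM A (\<lambda>_. borel)) (\<lambda>y :: nat \<Rightarrow> 'b. norm (\<Sum>i\<in>{j..<l'}. y i) < a)"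
        if "k \<le> j" "l' \<le> l" for j l'
      proof -
        have [measurable]: "(\<lambda>y. \<Sum>i\<in>{j..<l'}. y i) \<in> borel_measurable (PiM A (\<lambda>_. borel :: 'b measure))"
          using that \<open>{k..<l} \<subseteq> A\<close> by (intro borel_measurable_sum measurable_component_singleton) auto
        show "Measurable.pred (PiM A (\<lambda>_. borel)) (\<lambda>y :: nat \<Rightarrow> 'b. a \<le> norm (\<Sum>i\<in>{j..<l'}. y i))"
          by measurable
        show "Measurable.pred (PiM A (\<lambda>_. borel)) (\<lambda>y :: nat \<Rightarrow> 'b. norm (\<Sum>i\<in>{j..<l'}. y i) < a)"
          by measurable
      qed
      show ?thesis unfolding fp_def
        by (intro pred_intros_logic pred_intros_finite finite_atLeastAtMost finite_atLeastLessThan *) auto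
    qed
    have F_eq: "F l = (\<lambda>\<omega>. restrict (\<lambda>i. Y i \<omega>) {k..<l}) -` {y \<in> space (PiM {k..<l} (\<lambda>_. borel)). fp l y} \<inter> space M"
      for l
    proof -
      have *: "(\<Sum>i\<in>{j..<l'}. restrict (\<lambda>i. Y i \<omega>) {k..<l} i) = (\<Sum>i\<in>{j..<l'}. Y i \<omega>)"
        if "k \<le> j" "l' \<le> l" for j l' \<omega>
        using that by (intro sum.cong) auto
      have "fp l (restrict (\<lambda>i. Y i \<omega>) {k..<l}) \<longleftrightarrow> fp l (\<lambda>i. Y i \<omega>)" for \<omega>
        unfolding fp_def by (intro conj_cong bex_cong ball_cong refl) (simp_all add: * del: restrict_apply)
      then show ?thesis unfolding F_def by (auto simp: space_PiM)
    qed
    define c where "c l y \<longleftrightarrow> chain (\<lambda>m. \<Sum>i\<in>{l..<m}. y i) {l..n} as" for l and y :: "nat \<Rightarrow> 'b"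
    have C_eq: "C l = (\<lambda>\<omega>. restrict (\<lambda>i. Y i \<omega>) {l..<n}) -` {y \<in> space (PiM {l..<n} (\<lambda>_. borel)). c l y} \<inter> space M"
      for l
    proof -
      have "chain (\<lambda>k. S k \<omega>) {l..n} as \<longleftrightarrow> c l (restrict (\<lambda>i. Y i \<omega>) {l..<n})" for \<omega>
        unfolding c_def
      proof (rule chain_cong)
        fix u v assume uv: "u \<in> {l..n}" "v \<in> {l..n}" "u \<le> v"
        let ?y = "restrict (\<lambda>i. Y i \<omega>) {l..<n}"
        have "(\<Sum>i\<in>{l..<v}. ?y i) - (\<Sum>i\<in>{l..<u}. ?y i) = (\<Sum>i\<in>{u..<v}. ?y i)"
          using uv by (intro sum_diff_nat_ivl) auto
        also have "\<dots> = (\<Sum>i\<in>{u..<v}. Y i \<omega>)" using uv by (intro sum.cong) auto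
        finally show "norm (S v \<omega> - S u \<omega>) = norm ((\<Sum>i\<in>{l..<v}. ?y i) - (\<Sum>i\<in>{l..<u}. ?y i))"
          using S_diff[OF uv(3)] by simp
      qed
      then show ?thesis unfolding C_def by (auto simp: space_PiM)
    qed
    have indep: "prob (F l \<inter> C l) = prob (F l) * prob (C l)" if "l \<in> {k..n}" for l
    proof -
      have "indep_var (PiM {k..<l} (\<lambda>_. borel)) (\<lambda>\<omega>. restrict (\<lambda>i. Y i \<omega>) {k..<l})
              (PiM {l..<n} (\<lambda>_. borel)) (\<lambda>\<omega>. restrict (\<lambda>i. Y i \<omega>) {l..<n})"
        using that by (intro indep_var_restrict[OF ind]) auto
      moreover have "{y \<in> space (PiM {k..<l} (\<lambda>_. borel)). fp l y} \<in> sets (PiM {k..<l} (\<lambda>_. borel))"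
        using fp_meas[of l "{k..<l}"] by measurable
      moreover have "{y \<in> space (PiM {l..<n} (\<lambda>_. borel)). c l y} \<in> sets (PiM {l..<n} (\<lambda>_. borel :: 'b measure))"
      proof -
        have "Measurable.pred (PiM {l..<n} (\<lambda>_. borel :: 'b measure)) (c l)"
          unfolding c_def
          by (intro measurable_chain borel_measurable_sum measurable_component_singleton) auto
        then show ?thesis by measurable
      qed
      ultimately have "prob ((\<lambda>\<omega>. (restrict (\<lambda>i. Y i \<omega>) {k..<l}, restrict (\<lambda>i. Y i \<omega>) {l..<n})) -`
          ({y \<in> space (PiM {k..<l} (\<lambda>_. borel)). fp l y} \<times> {y \<in> space (PiM {l..<n} (\<lambda>_. borel)). c l y})
          \<inter> space M) = prob (F l) * prob (C l)" (is "prob ?E = _")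
        unfolding F_eq C_eq by (rule indep_varD)
      moreover have "?E = F l \<inter> C l" unfolding F_eq C_eq by auto
      ultimately show ?thesis by simp
    qed
    have F_sets: "F l \<in> events" if "l \<in> {k..n}" for l
    proof -
      have "(\<lambda>\<omega>. restrict (\<lambda>i. Y i \<omega>) {k..<l}) \<in> measurable M (PiM {k..<l} (\<lambda>_. borel))"
        using that Y by (intro measurable_restrict) auto
      moreover have "{y \<in> space (PiM {k..<l} (\<lambda>_. borel)). fp l y} \<in> sets (PiM {k..<l} (\<lambda>_. borel))"
        using fp_meas[of l "{k..<l}"] by measurable
      ultimately show ?thesis unfolding F_eq by (rule measurable_sets)
    qed
    have disj: "disjoint_family_on F {k..n}"
    proof -
      have False if "l < l'" "l \<in> {k..n}" "\<omega> \<in> F l" "\<omega> \<in> F l'" for l l' \<omega>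
        using that unfolding F_def fp_def by force
      then show ?thesis unfolding disjoint_family_on_def by (metis disjoint_iff linorder_neqE_nat)
    qed
    have sub: "{\<omega> \<in> space M. chain (\<lambda>k. S k \<omega>) {k..n} (a # as)} \<subseteq> (\<Union>l\<in>{k..n}. F l \<inter> C l)"
    proof safe
      fix \<omega> assume \<omega>: "\<omega> \<in> space M" "chain (\<lambda>k. S k \<omega>) {k..n} (a # as)"
      then obtain u v where uv: "k \<le> u" "u \<le> v" "v \<le> n" "a \<le> norm (S v \<omega> - S u \<omega>)"
        "chain (\<lambda>k. S k \<omega>) ({k..n} \<inter> {v..}) as" by auto
      define Q where "Q l \<longleftrightarrow> k \<le> l \<and> (\<exists>j\<in>{k..l}. a \<le> norm (\<Sum>i\<in>{j..<l}. Y i \<omega>))" for l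
      have Qv: "Q v" unfolding Q_def using uv S_diff[OF uv(2)] by auto
      define l where "l = (LEAST l. Q l)"
      have l: "Q l" "l \<le> v" unfolding l_def using Qv by (auto intro: LeastI Least_le)
      have "\<not> Q l'" if "l' < l" for l' using that unfolding l_def by (rule not_less_Least)
      then have "norm (\<Sum>i\<in>{j..<l'}. Y i \<omega>) < a" if "l' \<in> {k..<l}" "j \<in> {k..l'}" for l' j
        using that unfolding Q_def by (meson atLeastLessThan_iff not_le)
      then have "fp l (\<lambda>i. Y i \<omega>)" using l(1) unfolding fp_def Q_def by blast
      \<comment> \<open>The given chain may end its first swing at \<open>v\<close>, later than
        necessary; stopping at the earliest \<open>l\<close> only leaves more room for the remaining
        swings.\<close>
      moreover have "chain (\<lambda>k. S k \<omega>) {l..n} as"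
        using uv(5) by (rule chain_mono) (use l in auto)
      moreover have "k \<le> l" using l(1) by (simp add: Q_def)
      ultimately show "\<omega> \<in> (\<Union>l\<in>{k..n}. F l \<inter> C l)"
        using \<omega>(1) l(2) uv(3) unfolding F_def C_def by (intro UN_I[of l]) auto
    qed
    have pa: "(\<Sum>l\<in>{k..n}. prob (F l)) \<le> p a"
    proof -
      have "(\<Sum>l\<in>{k..n}. prob (F l)) = prob (\<Union>l\<in>{k..n}. F l)"
        using F_sets disj by (intro finite_measure_finite_Union[symmetric]) auto
      also have "\<dots> \<le> p a"
        unfolding p_def
      proof (rule finite_measure_mono)
        show "(\<Union>l\<in>{k..n}. F l) \<subseteq> {\<omega> \<in> space M. chain (\<lambda>k. S k \<omega>) {..n} [a]}"
        proof safe
          fix l \<omega> assume l: "l \<in> {k..n}" "\<omega> \<in> F l"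
          then obtain j where "j \<in> {k..l}" "a \<le> norm (\<Sum>i\<in>{j..<l}. Y i \<omega>)"
            unfolding F_def fp_def by auto
          then have "a \<le> norm (S l \<omega> - S j \<omega>)" "j \<in> {..n}" "l \<in> {..n}" "j \<le> l"
            using l S_diff[of j l \<omega>] by auto
          then show "chain (\<lambda>k. S k \<omega>) {..n} [a]" unfolding chain.simps by blast
        qed (simp add: F_def)
      qed (rule chain_sets, simp)
      finally show ?thesis .
    qed
    have "prob {\<omega> \<in> space M. chain (\<lambda>k. S k \<omega>) {k..n} (a # as)} \<le> prob (\<Union>l\<in>{k..n}. F l \<inter> C l)"
      using F_sets C_sets by (intro finite_measure_mono[OF sub]) auto
    also have "\<dots> \<le> (\<Sum>l\<in>{k..n}. prob (F l \<inter> C l))"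
      using F_sets C_sets by (intro finite_measure_subadditive_finite) auto
    also have "\<dots> \<le> (\<Sum>l\<in>{k..n}. prob (F l) * (\<Prod>a\<leftarrow>as. p a))"
      using Cons.IH unfolding C_def[symmetric] by (intro sum_mono) (auto simp: indep intro!: mult_left_mono)
    also have "\<dots> = (\<Sum>l\<in>{k..n}. prob (F l)) * (\<Prod>a\<leftarrow>as. p a)" by (simp add: sum_distrib_right)
    also have "\<dots> \<le> p a * (\<Prod>a\<leftarrow>as. p a)"
      using pa by (intro mult_right_mono prod_list_nonneg) (auto simp: p_def)
    finally show ?case by simp
  qed simp
  from this[of 0] show ?thesis by (simp add: p_def atLeast0AtMost)
qed

end

text \<open>Once \<open>q\<close> is below half of \<open>3 powr (- \<beta>)\<close>, the quadratic
  term is dominated by a linear one that uses up half of the decay allowed when \<open>a\<close> is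
  tripled. The other half pays for the term with \<open>C\<close>.\<close>

lemma tail_bound_of_quadratic_recursion:
  fixes q :: "real \<Rightarrow> real"
  assumes lim: "(q \<longlongrightarrow> 0) at_top" and q: "\<And>a. 0 \<le> q a" "\<And>a. q a \<le> 1"
    and rec: "\<And>a. 1 \<le> a \<Longrightarrow> q (3 * a) \<le> (q a)\<^sup>2 + C * a powr (- \<beta>)" and "0 < \<beta>"
  shows "\<exists>D\<ge>1. \<forall>a\<ge>1. q a \<le> D * a powr (- \<beta>)"
proof -
  define \<epsilon> where "\<epsilon> = 3 powr (- \<beta>) / 2"
  have "\<epsilon> > 0" by (simp add: \<epsilon>_def)
  have "eventually (\<lambda>a. q a < \<epsilon>) at_top" using lim \<open>\<epsilon> > 0\<close> by (rule order_tendstoD(2))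
  then obtain A0 where "\<And>a. A0 \<le> a \<Longrightarrow> q a < \<epsilon>" by (auto simp: eventually_at_top_linorder)
  then obtain A where A: "1 \<le> A" "\<And>a. A \<le> a \<Longrightarrow> q a \<le> \<epsilon>"
    by (metis less_imp_le max.boundedE max.cobounded1)
  \<comment> \<open>The first entry makes the claimed bound at least 1 on \<open>[1, 3 * A]\<close>,
    where only \<open>q a \<le> 1\<close> is used; the second lets half of the decay absorb
    \<open>C\<close>.\<close>
  define D where "D = max ((3 * A) powr \<beta>) (2 * 3 powr \<beta> * C)"
  have D: "(3 * A) powr \<beta> \<le> D" "2 * 3 powr \<beta> * C \<le> D" by (auto simp: D_def)
  have D1: "1 \<le> D" using D(1) ge_one_powr_ge_zero[of "3 * A" \<beta>] A(1) \<open>0 < \<beta>\<close> by simp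
  have "q a \<le> D * a powr (- \<beta>)" if "1 \<le> a" "a < 3 ^ k * (3 * A)" for k a
    using that
  proof (induction k arbitrary: a)
    case 0
    then have "a powr \<beta> \<le> (3 * A) powr \<beta>" using \<open>0 < \<beta>\<close> by (intro powr_mono2) auto
    then have "a powr \<beta> \<le> D" using D(1) by linarith
    then have "1 \<le> D * a powr (- \<beta>)" using 0 by (simp add: powr_minus field_simps)
    then show ?case using q(2)[of a] by linarith
  next
    case (Suc k)
    show ?case
    proof (cases "a < 3 * A")
      case True
      moreover have "1 * (3 * A) \<le> 3 ^ k * (3 * A)"
        using A(1) by (intro mult_right_mono one_le_power) auto
      ultimately have "a < 3 ^ k * (3 * A)" by linarith
      then show ?thesis using Suc by simp
    next
      case False
      define b where "b = a / 3"
      have b: "A \<le> b" "1 \<le> b" "a = 3 * b" "b < 3 ^ k * (3 * A)"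
        using False A(1) Suc.prems by (auto simp: b_def)
      have "q a \<le> (q b)\<^sup>2 + C * b powr (- \<beta>)" using rec[of b] b by simp
      also have "(q b)\<^sup>2 \<le> \<epsilon> * q b"
        using A(2)[OF b(1)] q(1)[of b] by (simp add: power2_eq_square mult_right_mono)
      also have "\<epsilon> * q b \<le> \<epsilon> * (D * b powr (- \<beta>))"
        using Suc.IH[of b] b \<open>\<epsilon> > 0\<close> by (intro mult_left_mono) auto
      also have "\<epsilon> * (D * b powr (- \<beta>)) + C * b powr (- \<beta>) = (\<epsilon> * D + C) * b powr (- \<beta>)"
        by (simp add: algebra_simps)
      also have "\<dots> \<le> (3 powr (- \<beta>) * D) * b powr (- \<beta>)"
      proof (intro mult_right_mono)
        have "C \<le> 3 powr (- \<beta>) * D / 2" using D(2) by (simp add: powr_minus field_simps)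
        then show "\<epsilon> * D + C \<le> 3 powr (- \<beta>) * D" by (simp add: \<epsilon>_def)
      qed simp
      also have "\<dots> = D * a powr (- \<beta>)" using b by (simp add: powr_mult)
      finally show ?thesis by simp
    qed
  qed
  moreover have "\<exists>k. a < 3 ^ k * (3 * A)" for a
  proof -
    obtain k where "a < 3 ^ k" using real_arch_pow[of 3 a] by auto
    moreover have "3 ^ k * 1 \<le> (3::real) ^ k * (3 * A)" using A(1) by (intro mult_left_mono) auto
    ultimately show ?thesis by (intro exI[of _ k]) linarith
  qed
  ultimately show ?thesis using D1 by blast
qed

section \<open>Tails of a Levy process at small times\<close>

text \<open>Multiplication by \<open>1 - cos \<theta>\<close> splits a frequency \<open>k\<close>
  into \<open>k\<close>, \<open>k + 1\<close> and \<open>k - 1\<close>. The two sums are the value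
  and, up to sign, the second derivative at 0 of a function that vanishes there to order
  \<open>2 * m\<close>. In the induction the new second moment is minus the old sum of coefficients,
  so it vanishes from \<open>m = 2\<close> on.\<close>

lemma one_minus_cos_power_cosine_list:
  assumes "1 \<le> m"
  shows "\<exists>cs. (\<forall>\<theta>::real. (1 - cos \<theta>) ^ m = (\<Sum>(c, k)\<leftarrow>cs. c * cos (k * \<theta>))) \<and>
    (\<Sum>(c, k)\<leftarrow>cs. c) = 0 \<and> (2 \<le> m \<longrightarrow> (\<Sum>(c, k)\<leftarrow>cs. c * k\<^sup>2) = 0)"
  using assms
proof (induction m rule: nat_induct_at_least)
  case base
  show ?case by (intro exI[of _ "[(1, 0), (-1, 1)]"]) simp
next
  case (Suc m)
  then obtain cs where cs: "\<And>\<theta>::real. (1 - cos \<theta>) ^ m = (\<Sum>(c, k)\<leftarrow>cs. c * cos (k * \<theta>))"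
    "(\<Sum>(c, k)\<leftarrow>cs. c) = 0" by blast
  define up where "up = map (\<lambda>(c, k). (- c / 2, k + 1 :: real)) cs"
  define dn where "dn = map (\<lambda>(c, k). (- c / 2, k - 1 :: real)) cs"
  have cos': "(\<Sum>(c, k)\<leftarrow>up. c * cos (k * \<theta>)) + (\<Sum>(c, k)\<leftarrow>dn. c * cos (k * \<theta>))
      = - cos \<theta> * (\<Sum>(c, k)\<leftarrow>cs. c * cos (k * \<theta>))" for \<theta>
    unfolding up_def dn_def
    by (induction cs) (auto simp: cos_add cos_diff algebra_simps)
  have one': "(\<Sum>(c, k)\<leftarrow>up. c) + (\<Sum>(c, k)\<leftarrow>dn. c) = - (\<Sum>(c, k)\<leftarrow>cs. c)"
    unfolding up_def dn_def by (induction cs) (auto simp: algebra_simps)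
  have sq': "(\<Sum>(c, k)\<leftarrow>up. c * k\<^sup>2) + (\<Sum>(c, k)\<leftarrow>dn. c * k\<^sup>2)
      = - (\<Sum>(c, k)\<leftarrow>cs. c * k\<^sup>2) - (\<Sum>(c, k)\<leftarrow>cs. c)"
    unfolding up_def dn_def by (induction cs) (auto simp: algebra_simps power2_eq_square)
  have "(1 - cos \<theta>) ^ Suc m = (\<Sum>(c, k)\<leftarrow>cs @ up @ dn. c * cos (k * \<theta>))" for \<theta>
    using cos'[of \<theta>] cs(1)[of \<theta>] by (simp add: algebra_simps)
  moreover have "(\<Sum>(c, k)\<leftarrow>cs @ up @ dn. c) = 0" using one' cs(2) by simp
  moreover have "(\<Sum>(c, k)\<leftarrow>cs @ up @ dn. c * k\<^sup>2) = 0" using sq' cs(2) by simp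
  ultimately show ?case by blast
qed

text \<open>The vanishing second moment of the frequencies removes the Gaussian part of a Levy exponent.\<close>

lemma one_minus_cos_power_expansion:
  assumes "2 \<le> m"
  obtains N :: nat and c k :: "nat \<Rightarrow> real"
  where "\<And>\<theta>. (1 - cos \<theta>) ^ m = (\<Sum>i<N. c i * cos (k i * \<theta>))"
    and "(\<Sum>i<N. c i) = 0" and "(\<Sum>i<N. c i * (k i)\<^sup>2) = 0"
proof -
  obtain cs where cs: "\<And>\<theta>::real. (1 - cos \<theta>) ^ m = (\<Sum>(c, k)\<leftarrow>cs. c * cos (k * \<theta>))"
    "(\<Sum>(c, k)\<leftarrow>cs. c) = 0" "(\<Sum>(c, k)\<leftarrow>cs. c * k\<^sup>2) = 0"
    using one_minus_cos_power_cosine_list[of m] assms by auto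
  have conv: "(\<Sum>(c, k)\<leftarrow>cs. f c k) = (\<Sum>i<length cs. f (fst (cs ! i)) (snd (cs ! i)))" for f :: "real \<Rightarrow> real \<Rightarrow> real"
    by (subst sum_list_sum_nth) (simp add: case_prod_unfold atLeast0LessThan)
  show ?thesis
    by (rule that[where N = "length cs" and c = "\<lambda>i. fst (cs ! i)" and k = "\<lambda>i. snd (cs ! i)"])
      (use cs in \<open>simp_all only: conv\<close>)
qed

section \<open>Bounds for the Levy exponent\<close>

lemma
  fixes \<nu> :: "'a::euclidean_space measure"
  assumes sets: "sets \<nu> = sets borel"
    and fin: "(\<integral>\<^sup>+x. ennreal (min 1 ((norm x)\<^sup>2)) \<partial>\<nu>) < \<infinity>"
  defines "f \<equiv> \<lambda>u x. iexp (u \<bullet> x) - 1 - \<i> * of_real (indicator (cball 0 1) x * (u \<bullet> x))"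
  shows integrable_levy_integrand: "integrable \<nu> (f u)"
    and norm_levy_integral_le:
      "norm (CLINT x|\<nu>. f u x) \<le> (2 + (norm u)\<^sup>2) * (\<integral>x. min 1 ((norm x)\<^sup>2) \<partial>\<nu>)"
proof -
  note [measurable_cong] = sets
  have int: "integrable \<nu> (\<lambda>x. min 1 ((norm x)\<^sup>2))"
    using fin by (intro integrableI_nonneg) auto
  have bound: "norm (f u x) \<le> (2 + (norm u)\<^sup>2) * min 1 ((norm x)\<^sup>2)" for x
  proof (cases "norm x \<le> 1")
    case True
    have "norm (f u x) = norm (iexp (u \<bullet> x) - (\<Sum>k\<le>1. (\<i> * (u \<bullet> x)) ^ k / fact k))"
      using True by (simp add: f_def diff_diff_eq)
    also have "\<dots> \<le> \<bar>u \<bullet> x\<bar> ^ Suc 1 / fact (Suc 1)" by (rule iexp_approx1)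
    also have "\<dots> \<le> \<bar>u \<bullet> x\<bar>\<^sup>2" by (simp add: numeral_2_eq_2)
    also have "\<dots> \<le> (norm u * norm x)\<^sup>2" by (intro power_mono Cauchy_Schwarz_ineq2) auto
    also have "\<dots> \<le> (2 + (norm u)\<^sup>2) * (norm x)\<^sup>2" by (simp add: power_mult_distrib mult_right_mono)
    also have "(norm x)\<^sup>2 = min 1 ((norm x)\<^sup>2)" using True by (simp add: power_le_one)
    finally show ?thesis .
  next
    case False
    have "norm (f u x) = norm (iexp (u \<bullet> x) - 1)" using False by (simp add: f_def)
    also have "\<dots> \<le> norm (iexp (u \<bullet> x)) + norm (1::complex)" by (rule norm_triangle_ineq4)
    also have "\<dots> \<le> 2 + (norm u)\<^sup>2" by simp
    also have "\<dots> = (2 + (norm u)\<^sup>2) * min 1 ((norm x)\<^sup>2)"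
      using False one_le_power[of "norm x" 2] by (simp add: min_absorb1)
    finally show ?thesis .
  qed
  have int': "integrable \<nu> (\<lambda>x. (2 + (norm u)\<^sup>2) * min 1 ((norm x)\<^sup>2))" using int by simp
  have [measurable]: "(\<lambda>x. u \<bullet> x) \<in> borel_measurable \<nu>" "cball 0 1 \<in> sets \<nu>"
    using sets by (simp_all add: measurable_cong_sets[OF sets refl])
  have "f u \<in> borel_measurable \<nu>" unfolding f_def by measurable
  then show "integrable \<nu> (f u)"
    by (rule Bochner_Integration.integrable_bound[OF int'])
      (intro AE_I2 order_trans[OF bound], simp)
  have "norm (CLINT x|\<nu>. f u x) \<le> (\<integral>x. (2 + (norm u)\<^sup>2) * min 1 ((norm x)\<^sup>2) \<partial>\<nu>)"
    by (rule Bochner_Integration.integral_norm_bound_integral[OF \<open>integrable \<nu> (f u)\<close> int' bound])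
  then show "norm (CLINT x|\<nu>. f u x) \<le> (2 + (norm u)\<^sup>2) * (\<integral>x. min 1 ((norm x)\<^sup>2) \<partial>\<nu>)" by simp
qed

text \<open>Boundedness on balls makes the quadratic error in \<open>t\<close> uniform over all
  frequencies that occur below.\<close>

lemma levy_exponent_bounded:
  fixes \<nu> :: "'a::euclidean_space measure"
  assumes "sets \<nu> = sets borel" "(\<integral>\<^sup>+x. ennreal (min 1 ((norm x)\<^sup>2)) \<partial>\<nu>) < \<infinity>" "linear A"
  shows "\<exists>K\<ge>0. \<forall>u. norm u \<le> R \<longrightarrow> norm (levy_exponent \<gamma> A \<nu> u) \<le> K"
proof -
  define I where "I = (\<integral>x. min 1 ((norm x)\<^sup>2) \<partial>\<nu>)"
  have I: "0 \<le> I" by (simp add: I_def)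
  obtain B where B: "0 \<le> B" "\<And>u. norm (A u) \<le> B * norm u"
    using linear_bounded_pos[OF assms(3)] by (metis less_imp_le)
  define K where "K = norm \<gamma> * \<bar>R\<bar> + B * R\<^sup>2 + (2 + R\<^sup>2) * I"
  have "norm (levy_exponent \<gamma> A \<nu> u) \<le> K" if u: "norm u \<le> R" for u
  proof -
    have R: "0 \<le> R" using u norm_ge_zero order_trans by blast
    have u2: "(norm u)\<^sup>2 \<le> R\<^sup>2" using u by (intro power_mono) auto
    let ?L = "CLINT x|\<nu>. iexp (u \<bullet> x) - 1 - \<i> * of_real (indicator (cball 0 1) x * (u \<bullet> x))"
    have 1: "norm (\<i> * complex_of_real (\<gamma> \<bullet> u)) \<le> norm \<gamma> * \<bar>R\<bar>"
    proof -
      have "norm (\<i> * complex_of_real (\<gamma> \<bullet> u)) = \<bar>\<gamma> \<bullet> u\<bar>" by (simp add: norm_mult)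
      also have "\<dots> \<le> norm \<gamma> * norm u" by (rule Cauchy_Schwarz_ineq2)
      also have "\<dots> \<le> norm \<gamma> * \<bar>R\<bar>" using u by (intro mult_left_mono) auto
      finally show ?thesis .
    qed
    have 2: "norm (complex_of_real (u \<bullet> A u) / 2) \<le> B * R\<^sup>2"
    proof -
      have "norm (complex_of_real (u \<bullet> A u) / 2) \<le> \<bar>u \<bullet> A u\<bar>" by (simp add: norm_divide)
      also have "\<dots> \<le> norm u * norm (A u)" by (rule Cauchy_Schwarz_ineq2)
      also have "\<dots> \<le> norm u * (B * norm u)" by (intro mult_left_mono B) auto
      also have "\<dots> = B * (norm u)\<^sup>2" by (simp add: power2_eq_square)
      also have "\<dots> \<le> B * R\<^sup>2" using u2 B(1) by (rule mult_left_mono)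
      finally show ?thesis .
    qed
    have 3: "norm ?L \<le> (2 + R\<^sup>2) * I"
    proof -
      have "norm ?L \<le> (2 + (norm u)\<^sup>2) * I" unfolding I_def by (rule norm_levy_integral_le[OF assms(1,2)])
      also have "\<dots> \<le> (2 + R\<^sup>2) * I" using u2 I by (intro mult_right_mono) auto
      finally show ?thesis .
    qed
    have "norm (levy_exponent \<gamma> A \<nu> u) \<le> norm (\<i> * complex_of_real (\<gamma> \<bullet> u)) + norm (complex_of_real (u \<bullet> A u) / 2) + norm ?L"
      unfolding levy_exponent_def
      by (rule order_trans[OF norm_triangle_ineq add_right_mono[OF norm_triangle_ineq4]])
    then show ?thesis using 1 2 3 unfolding K_def by linarith
  qed
  moreover have "0 \<le> K" unfolding K_def using B(1) I by (intro add_nonneg_nonneg mult_nonneg_nonneg) auto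
  ultimately show ?thesis by blast
qed

text \<open>Taking real parts removes the drift and the compensator, both of which are purely
  imaginary.\<close>

lemma
  fixes \<nu> :: "'a::euclidean_space measure"
  assumes "sets \<nu> = sets borel" "(\<integral>\<^sup>+x. ennreal (min 1 ((norm x)\<^sup>2)) \<partial>\<nu>) < \<infinity>"
  shows integrable_cos_minus_1: "integrable \<nu> (\<lambda>x. cos (u \<bullet> x) - 1)"
    and Re_levy_exponent:
      "Re (levy_exponent \<gamma> A \<nu> u) = - (u \<bullet> A u) / 2 + (\<integral>x. cos (u \<bullet> x) - 1 \<partial>\<nu>)"
proof -
  note int = integrable_levy_integrand[OF assms, of u]
  have Re: "Re (iexp (u \<bullet> x) - 1 - \<i> * of_real (indicator (cball 0 1) x * (u \<bullet> x))) = cos (u \<bullet> x) - 1" for x :: 'a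
    by (simp add: Re_exp)
  from integrable_Re[OF int] show "integrable \<nu> (\<lambda>x. cos (u \<bullet> x) - 1)" by (simp only: Re)
  show "Re (levy_exponent \<gamma> A \<nu> u) = - (u \<bullet> A u) / 2 + (\<integral>x. cos (u \<bullet> x) - 1 \<partial>\<nu>)"
    unfolding levy_exponent_def plus_complex.sel integral_Re[OF int, symmetric] Re by simp
qed

lemma norm_exp_minus_linear_le:
  fixes z :: complex
  shows "norm (exp z - 1 - z) \<le> exp (norm z) * (norm z)\<^sup>2"
proof -
  have "norm (exp z - (\<Sum>k\<le>1. z ^ k / fact k)) \<le> exp \<bar>Re z\<bar> * norm z ^ Suc 1 / fact 1"
    by (rule Taylor_exp)
  also have "\<dots> \<le> exp (norm z) * (norm z)\<^sup>2"
    using abs_Re_le_cmod[of z] by (simp add: power2_eq_square mult_right_mono)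
  finally show ?thesis by (simp add: diff_diff_eq)
qed

lemma one_minus_cos_le: "1 - cos \<theta> \<le> \<theta>\<^sup>2" for \<theta> :: real
proof -
  have "1 - cos \<theta> = 2 * (sin (\<theta> / 2))\<^sup>2"
    using cos_double_sin[of "\<theta> / 2"] by simp
  also have "(sin (\<theta> / 2))\<^sup>2 \<le> (\<theta> / 2)\<^sup>2"
    using abs_sin_x_le_abs_x[of "\<theta> / 2"] by (metis abs_le_square_iff)
  finally have "1 - cos \<theta> \<le> \<theta>\<^sup>2 / 2" by (simp add: power_divide)
  then show ?thesis using zero_le_power2[of \<theta>] by linarith
qed

text \<open>\<open>1 - cos \<theta>\<close> is bounded both by \<open>\<theta>^2\<close> and by 2,
  and as \<open>\<beta> \<le> 2 * m\<close>, its power is at most \<open>2 ^ m\<close> times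
  \<open>\<bar>\<theta>\<bar> powr \<beta>\<close>. Near the origin \<open>r powr \<beta>\<close>
  need not be integrable against a Levy measure when \<beta> < 2, so for \<open>r \<le> 1\<close>
  the factor \<open>r^2\<close> is kept and the decay in \<open>a\<close> is taken from
  \<open>a^(-2 m)\<close>.\<close>

lemma one_minus_cos_power_le:
  assumes "\<bar>\<theta>\<bar> \<le> r / a" "0 \<le> r" "1 \<le> a" "0 < \<beta>" "\<beta> \<le> 2 * real m" "1 \<le> m"
  shows "(1 - cos \<theta>) ^ m \<le> 2 ^ m * a powr (- \<beta>) * (if r \<le> 1 then r\<^sup>2 else r powr \<beta>)"
proof -
  have pos: "0 \<le> 1 - cos \<theta>" by simp
  have small: "(1 - cos \<theta>) ^ m \<le> (r / a) ^ (2 * m)"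
  proof -
    have "(1 - cos \<theta>) ^ m \<le> (\<theta>\<^sup>2) ^ m" using one_minus_cos_le pos by (intro power_mono)
    also have "\<dots> = \<bar>\<theta>\<bar> ^ (2 * m)" by (simp add: power_mult)
    also have "\<dots> \<le> (r / a) ^ (2 * m)" using assms(1) by (intro power_mono) auto
    finally show ?thesis .
  qed
  have two: "1 \<le> (2::real) ^ m" by simp
  show ?thesis
  proof (cases "r \<le> 1")
    case True
    have "(r / a) ^ (2 * m) = r ^ (2 * m) * a powr (- (2 * real m))"
      using assms(3) powr_realpow[of a "2 * m"] by (simp add: power_divide powr_minus_divide)
    also have "\<dots> \<le> r\<^sup>2 * a powr (- \<beta>)"
      using True assms by (intro mult_mono power_decreasing powr_mono) auto
    also have "\<dots> \<le> 2 ^ m * (r\<^sup>2 * a powr (- \<beta>))"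
      using mult_right_mono[OF two, of "r\<^sup>2 * a powr (- \<beta>)"] by simp
    finally show ?thesis using small True by (simp add: mult_ac)
  next
    case False
    have eq: "(r / a) powr \<beta> = a powr (- \<beta>) * r powr \<beta>"
      using assms(2,3) by (simp add: powr_divide powr_minus_divide)
    have "(1 - cos \<theta>) ^ m \<le> 2 ^ m * (r / a) powr \<beta>"
    proof (cases "r / a \<le> 1")
      case True
      have "(r / a) ^ (2 * m) = (r / a) powr (2 * real m)"
        using False assms(3) powr_realpow[of "r / a" "2 * m"] by simp
      also have "\<dots> \<le> (r / a) powr \<beta>"
        using True assms False by (intro powr_mono') auto
      also have "\<dots> \<le> 2 ^ m * (r / a) powr \<beta>"
        using mult_right_mono[OF two, of "(r / a) powr \<beta>"] by simp
      finally show ?thesis using small by simp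
    next
      case False
      have "(1 - cos \<theta>) ^ m \<le> 2 ^ m"
        using pos cos_ge_minus_one[of \<theta>] by (intro power_mono) linarith+
      also have "\<dots> \<le> 2 ^ m * (r / a) powr \<beta>"
        using False assms(4) ge_one_powr_ge_zero[of "r / a" \<beta>] by simp
      finally show ?thesis .
    qed
    then show ?thesis using False by (simp add: eq mult_ac)
  qed
qed

text \<open>Bernoulli's inequality around \<open>1 / 2\<close> stands in for Jensen's inequality.\<close>

lemma average_one_minus_cos_power_ge:
  fixes y :: real
  assumes y: "2 \<le> \<bar>y\<bar>"
  shows "ennreal ((1 / 2) ^ m) \<le> (\<integral>\<^sup>+v. ennreal ((1 - cos (v * y)) ^ m) * indicator {0..1} v \<partial>lborel)"
proof -
  define g where "g v = (1 / 2) ^ m * (1 + real m * (1 - 2 * cos (v * y)))" for v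
  define G where "G v = (1 / 2) ^ m * (v + real m * (v - 2 * sin (v * y) / y))" for v
  have y0: "y \<noteq> 0" using y by auto
  have gh: "g v \<le> (1 - cos (v * y)) ^ m" for v
  proof -
    have "1 + real m * (1 - 2 * cos (v * y)) \<le> (1 + (1 - 2 * cos (v * y))) ^ m"
      using cos_le_one[of "v * y"] by (intro Bernoulli_inequality) linarith
    also have "1 + (1 - 2 * cos (v * y)) = 2 * (1 - cos (v * y))" by simp
    finally have "(1 / 2) ^ m * (1 + real m * (1 - 2 * cos (v * y))) \<le> (1 / 2) ^ m * (2 * (1 - cos (v * y))) ^ m"
      by (intro mult_left_mono) auto
    moreover have "(1 / 2) ^ m * (2 * t) ^ m = t ^ m" for t :: real
      by (subst power_mult_distrib[symmetric]) simp
    ultimately show ?thesis by (simp only: g_def)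
  qed
  have int: "integrable lborel (\<lambda>v. indicator {0..1} v *\<^sub>R h v)" if "continuous_on {0..1} h" for h :: "real \<Rightarrow> real"
    using borel_integrable_compact[OF compact_Icc that] by simp
  have "(\<integral>v. g v * indicator {0..1} v \<partial>lborel) = G 1 - G 0"
  proof (rule integral_FTC_Icc_real)
    fix v :: real
    show "DERIV G v :> g v" unfolding G_def g_def using y0
      by (auto intro!: derivative_eq_intros simp: field_simps)
    show "isCont g v" unfolding g_def by (intro continuous_intros)
  qed simp
  \<comment> \<open>The mean of \<open>1 - 2 * cos (v * y)\<close> over the unit interval is
    \<open>1 - 2 * sin y / y\<close>, which is nonnegative because
    \<open>2 \<le> \<bar>y\<bar>\<close>.\<close>
  moreover have "(1 / 2) ^ m \<le> G 1 - G 0"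
  proof -
    have "2 * sin y / y \<le> \<bar>2 * sin y / y\<bar>" by (rule abs_ge_self)
    also have "\<dots> \<le> 1"
    proof -
      have "2 * \<bar>sin y\<bar> \<le> \<bar>y\<bar>" using y abs_sin_le_one[of y] by linarith
      then show ?thesis using y0 by (simp add: abs_mult)
    qed
    finally have "1 \<le> 1 + real m * (1 - 2 * sin y / y)" by simp
    then have "(1 / 2) ^ m * 1 \<le> (1 / 2) ^ m * (1 + real m * (1 - 2 * sin y / y))"
      by (intro mult_left_mono) auto
    then show ?thesis by (simp add: G_def)
  qed
  moreover have "(\<integral>v. g v * indicator {0..1} v \<partial>lborel) \<le> (\<integral>v. (1 - cos (v * y)) ^ m * indicator {0..1} v \<partial>lborel)"
  proof (rule integral_mono)
    show "integrable lborel (\<lambda>v. g v * indicator {0..1} v)"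
      using int[of g] unfolding g_def by (simp add: mult.commute continuous_intros)
    show "integrable lborel (\<lambda>v. (1 - cos (v * y)) ^ m * indicator {0..1} v)"
      using int[of "\<lambda>v. (1 - cos (v * y)) ^ m"] by (simp add: mult.commute continuous_intros)
  qed (use gh in \<open>auto simp: indicator_def\<close>)
  ultimately have "ennreal ((1 / 2) ^ m) \<le> ennreal (\<integral>v. (1 - cos (v * y)) ^ m * indicator {0..1} v \<partial>lborel)"
    by (intro ennreal_leI) linarith
  also have "\<dots> = (\<integral>\<^sup>+v. ennreal ((1 - cos (v * y)) ^ m * indicator {0..1} v) \<partial>lborel)"
    using int[of "\<lambda>v. (1 - cos (v * y)) ^ m"]
    by (intro nn_integral_eq_integral[symmetric]) (auto simp: mult.commute continuous_intros)
  also have "\<dots> = (\<integral>\<^sup>+v. ennreal ((1 - cos (v * y)) ^ m) * indicator {0..1} v \<partial>lborel)"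
    by (intro nn_integral_cong) (auto simp: indicator_def)
  finally show ?thesis .
qed

section \<open>Small time tails from the characteristic function\<close>

context levy_process
begin

text \<open>The expectation is a combination of terms \<open>Re (exp (t * \<psi> i))\<close>, each
  equal to \<open>1 + t * Re (\<psi> i)\<close> up to \<open>O(t^2)\<close>. The constants cancel
  because the coefficients sum to 0, the Gaussian terms because the second moment of the frequencies
  vanishes, and the integrals of \<open>cos - 1\<close> recombine to the integral of the original
  power.\<close>

lemma expectation_one_minus_cos_power_le:
  assumes \<nu>: "sets \<nu> = sets borel" "(\<integral>\<^sup>+x. ennreal (min 1 ((norm x)\<^sup>2)) \<partial>\<nu>) < \<infinity>"
    and A: "linear A"
    and char: "\<And>t u. 0 \<le> t \<Longrightarrow>
      (CLINT \<omega>|M. iexp (u \<bullet> X t \<omega>)) = exp (of_real t * levy_exponent \<gamma> A \<nu> u)"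
    and m: "2 \<le> m" and b: "norm b \<le> 1"
  shows "\<exists>K\<ge>0. \<forall>t\<in>{0..1}. \<forall>v\<in>{0..1}.
    expectation (\<lambda>\<omega>. (1 - cos (v * (b \<bullet> X t \<omega>))) ^ m)
      \<le> t * (\<integral>x. (1 - cos (v * (b \<bullet> x))) ^ m \<partial>\<nu>) + K * t\<^sup>2"
proof -
  obtain N :: nat and c k :: "nat \<Rightarrow> real"
    where expand: "\<And>\<theta>. (1 - cos \<theta>) ^ m = (\<Sum>i<N. c i * cos (k i * \<theta>))"
      and c: "(\<Sum>i<N. c i) = 0" and ck: "(\<Sum>i<N. c i * (k i)\<^sup>2) = 0"
    by (rule one_minus_cos_power_expansion[OF m]) blast
  \<comment> \<open>\<open>R\<close> bounds the norms of all frequency vectors \<open>w i\<close>,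
    because \<open>v\<close> and \<open>norm b\<close> are at most 1.\<close>
  define R where "R = (\<Sum>i<N. \<bar>k i\<bar>)"
  obtain K0 where K0: "0 \<le> K0" "\<And>u. norm u \<le> R \<Longrightarrow> norm (levy_exponent \<gamma> A \<nu> u) \<le> K0"
    using levy_exponent_bounded[OF \<nu> A] by blast
  define K where "K = (\<Sum>i<N. \<bar>c i\<bar>) * (exp K0 * K0\<^sup>2)"
  have "expectation (\<lambda>\<omega>. (1 - cos (v * (b \<bullet> X t \<omega>))) ^ m)
      \<le> t * (\<integral>x. (1 - cos (v * (b \<bullet> x))) ^ m \<partial>\<nu>) + K * t\<^sup>2"
    if t: "0 \<le> t" "t \<le> 1" and v: "0 \<le> v" "v \<le> 1" for t v
  proof -
    have [measurable]: "random_variable borel (X t)" using t(1) by (rule random_variable_X)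
    define w where "w i = (k i * v) *\<^sub>R b" for i
    define \<psi> where "\<psi> i = levy_exponent \<gamma> A \<nu> (w i)" for i
    have w_inner: "k i * (v * (b \<bullet> x)) = w i \<bullet> x" for i x by (simp add: w_def)
    have \<psi>: "norm (\<psi> i) \<le> K0" if "i < N" for i
      unfolding \<psi>_def
    proof (rule K0(2))
      have "norm (w i) = \<bar>k i\<bar> * (v * norm b)" using v by (simp add: w_def abs_mult)
      also have "\<dots> \<le> \<bar>k i\<bar> * 1" using v b by (intro mult_left_mono mult_le_one) auto
      also have "\<dots> \<le> R"
        unfolding R_def mult_1_right using that by (intro member_le_sum) auto
      finally show "norm (w i) \<le> R" .
    qed
    have cos_int: "integrable M (\<lambda>\<omega>. cos (w i \<bullet> X t \<omega>))" for i
      by (rule integrable_const_bound[where B = 1]) auto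
    have iexp_int: "integrable M (\<lambda>\<omega>. iexp (w i \<bullet> X t \<omega>))" for i
      by (rule integrable_const_bound[where B = 1]) auto
    have cos_char: "expectation (\<lambda>\<omega>. cos (w i \<bullet> X t \<omega>)) = Re (exp (of_real t * \<psi> i))" for i
      using integral_Re[OF iexp_int, of i] char[OF t(1), of "w i"] by (simp add: Re_exp \<psi>_def)
    have err: "c i * Re (exp (of_real t * \<psi> i)) \<le> c i + t * (c i * Re (\<psi> i)) + \<bar>c i\<bar> * (exp K0 * K0\<^sup>2) * t\<^sup>2"
      if i: "i < N" for i
    proof -
      let ?z = "of_real t * \<psi> i"
      have z: "norm ?z \<le> t * K0" using t \<psi>[OF i] by (simp add: norm_mult mult_left_mono)
      moreover have "t * K0 \<le> K0" using t K0(1) by (simp add: mult_left_le_one_le)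
      ultimately have "exp (norm ?z) * (norm ?z)\<^sup>2 \<le> exp K0 * (t * K0)\<^sup>2"
        by (intro mult_mono power_mono) auto
      then have "norm (exp ?z - 1 - ?z) \<le> exp K0 * (t * K0)\<^sup>2"
        using norm_exp_minus_linear_le[of ?z] by linarith
      then have "\<bar>Re (exp ?z - 1 - ?z)\<bar> \<le> exp K0 * (t * K0)\<^sup>2"
        using abs_Re_le_cmod order_trans by blast
      then have "\<bar>c i\<bar> * \<bar>Re (exp ?z - 1 - ?z)\<bar> \<le> \<bar>c i\<bar> * (exp K0 * (t * K0)\<^sup>2)"
        by (intro mult_left_mono) auto
      moreover have "c i * Re (exp ?z - 1 - ?z) \<le> \<bar>c i\<bar> * \<bar>Re (exp ?z - 1 - ?z)\<bar>"
        by (metis abs_ge_self abs_mult)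
      ultimately have "c i * (Re (exp ?z) - 1 - t * Re (\<psi> i)) \<le> \<bar>c i\<bar> * (exp K0 * (t * K0)\<^sup>2)"
        by simp
      then show ?thesis by (simp add: algebra_simps power_mult_distrib)
    qed
    have int: "integrable \<nu> (\<lambda>x. cos (w i \<bullet> x) - 1)" for i by (rule integrable_cos_minus_1[OF \<nu>])
    have "(\<Sum>i<N. c i * (- (w i \<bullet> A (w i)) / 2)) = 0"
    proof -
      have "c i * (- (w i \<bullet> A (w i)) / 2) = (- (v\<^sup>2 * (b \<bullet> A b)) / 2) * (c i * (k i)\<^sup>2)" for i
        unfolding w_def by (simp add: linear_cmul[OF A] power2_eq_square)
      then show ?thesis by (simp only: ck mult_zero_right flip: sum_distrib_left)
    qed
    moreover have "(\<Sum>i<N. c i * (\<integral>x. cos (w i \<bullet> x) - 1 \<partial>\<nu>)) = (\<integral>x. (1 - cos (v * (b \<bullet> x))) ^ m \<partial>\<nu>)"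
    proof -
      have "(\<Sum>i<N. c i * (\<integral>x. cos (w i \<bullet> x) - 1 \<partial>\<nu>)) = (\<integral>x. (\<Sum>i<N. c i * (cos (w i \<bullet> x) - 1)) \<partial>\<nu>)"
        using int by (subst Bochner_Integration.integral_sum) auto
      also have "(\<lambda>x. \<Sum>i<N. c i * (cos (w i \<bullet> x) - 1)) = (\<lambda>x. (1 - cos (v * (b \<bullet> x))) ^ m)"
        using c by (simp add: expand w_inner right_diff_distrib sum_subtractf)
      finally show ?thesis .
    qed
    ultimately have main: "(\<Sum>i<N. c i * Re (\<psi> i)) = (\<integral>x. (1 - cos (v * (b \<bullet> x))) ^ m \<partial>\<nu>)"
      unfolding \<psi>_def Re_levy_exponent[OF \<nu>] distrib_left sum.distrib by simp
    have "expectation (\<lambda>\<omega>. (1 - cos (v * (b \<bullet> X t \<omega>))) ^ m)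
        = (\<Sum>i<N. c i * Re (exp (of_real t * \<psi> i)))"
      unfolding expand w_inner using cos_int by (subst Bochner_Integration.integral_sum) (auto simp: cos_char)
    also have "\<dots> \<le> (\<Sum>i<N. c i + t * (c i * Re (\<psi> i)) + \<bar>c i\<bar> * (exp K0 * K0\<^sup>2) * t\<^sup>2)"
      using err by (intro sum_mono) auto
    also have "\<dots> = (\<Sum>i<N. c i) + t * (\<Sum>i<N. c i * Re (\<psi> i)) + K * t\<^sup>2"
      by (simp add: K_def sum.distrib sum_distrib_left sum_distrib_right mult_ac)
    finally show ?thesis using c main by simp
  qed
  moreover have "0 \<le> K" by (simp add: K_def sum_nonneg)
  ultimately show ?thesis by auto
qed

text \<open>A Markov inequality with an averaged test function: where
  \<open>2 * a \<le> \<bar>b \<bullet> X t \<omega>\<bar>\<close>, the mean over \<open>v\<close> in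
  \<open>{0..1}\<close> of the \<open>m\<close>-th power of
  \<open>1 - cos (v * (b \<bullet> X t \<omega> / a))\<close> is at least
  \<open>(1 / 2) ^ m\<close>. A single \<open>v\<close> would not do, since the cosine returns to 1
  at large arguments.\<close>

lemma prob_abs_inner_ge_le:
  assumes \<nu>: "sets \<nu> = sets borel" "(\<integral>\<^sup>+x. ennreal (min 1 ((norm x)\<^sup>2)) \<partial>\<nu>) < \<infinity>"
    and A: "linear A"
    and char: "\<And>t u. 0 \<le> t \<Longrightarrow>
      (CLINT \<omega>|M. iexp (u \<bullet> X t \<omega>)) = exp (of_real t * levy_exponent \<gamma> A \<nu> u)"
    and \<beta>: "0 < \<beta>" "(\<integral>\<^sup>+x\<in>{x. norm x > 1}. ennreal (norm x powr \<beta>) \<partial>\<nu>) < \<infinity>"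
    and b: "norm b \<le> 1"
  shows "\<exists>C\<ge>0. \<exists>K\<ge>0. \<forall>t\<in>{0..1}. \<forall>a\<ge>1.
    prob {\<omega> \<in> space M. 2 * a \<le> \<bar>b \<bullet> X t \<omega>\<bar>} \<le> C * t * a powr (- \<beta>) + K * t\<^sup>2"
proof -
  note [measurable_cong] = \<nu>(1)
  \<comment> \<open>Large enough for \<open>\<beta> \<le> 2 * m\<close>, and at least 2 for the
    cancellation of the Gaussian part.\<close>
  define m where "m = nat \<lceil>\<beta>\<rceil> + 2"
  have m: "2 \<le> m" "1 \<le> m" "\<beta> \<le> 2 * real m"
    unfolding m_def using \<beta>(1) by (auto intro: order_trans[OF real_nat_ceiling_ge])
  obtain K where K: "0 \<le> K" "\<And>t v. t \<in> {0..1} \<Longrightarrow> v \<in> {0..1} \<Longrightarrow>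
    expectation (\<lambda>\<omega>. (1 - cos (v * (b \<bullet> X t \<omega>))) ^ m)
      \<le> t * (\<integral>x. (1 - cos (v * (b \<bullet> x))) ^ m \<partial>\<nu>) + K * t\<^sup>2"
    using expectation_one_minus_cos_power_le[OF \<nu> A char m(1) b] by blast
  \<comment> \<open>The majorant of the test function up to powers of \<open>a\<close>: the Levy
    condition makes it integrable on the unit ball, the moment of order \<beta> outside.\<close>
  define G where "G x = (if norm x \<le> 1 then (norm x)\<^sup>2 else norm x powr \<beta>)" for x :: 'a
  have G0: "0 \<le> G x" for x by (simp add: G_def)
  have G_int: "integrable \<nu> G"
  proof (rule integrableI_nonneg)
    show "G \<in> borel_measurable \<nu>" unfolding G_def by measurable
    have "(\<integral>\<^sup>+x. ennreal (G x) \<partial>\<nu>) \<le> (\<integral>\<^sup>+x. ennreal (min 1 ((norm x)\<^sup>2)) +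
        ennreal (norm x powr \<beta>) * indicator {x. norm x > 1} x \<partial>\<nu>)"
      by (intro nn_integral_mono) (auto simp: G_def indicator_def power_le_one min_absorb2)
    also have "\<dots> = (\<integral>\<^sup>+x. ennreal (min 1 ((norm x)\<^sup>2)) \<partial>\<nu>) +
        (\<integral>\<^sup>+x\<in>{x. norm x > 1}. ennreal (norm x powr \<beta>) \<partial>\<nu>)"
      by (intro nn_integral_add) measurable
    also have "\<dots> < \<infinity>" using \<nu>(2) \<beta>(2) by simp
    finally show "(\<integral>\<^sup>+x. ennreal (G x) \<partial>\<nu>) < \<infinity>" .
  qed (use G0 in auto)
  define I where "I = (\<integral>x. G x \<partial>\<nu>)"
  have "0 \<le> I" unfolding I_def using G0 by simp
  have "prob {\<omega> \<in> space M. 2 * a \<le> \<bar>b \<bullet> X t \<omega>\<bar>} \<le> (4 ^ m * I) * t * a powr (- \<beta>) + (2 ^ m * K) * t\<^sup>2"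
    if t: "t \<in> {0..1}" and a: "1 \<le> a" for t a
  proof -
    have [measurable]: "random_variable borel (X t)" using t by (intro random_variable_X) auto
    define B where "B = t * (2 ^ m * a powr (- \<beta>) * I) + K * t\<^sup>2"
    have "0 \<le> B" using t K(1) \<open>0 \<le> I\<close> by (simp add: B_def)
    define h where "h \<omega> v = (1 - cos (v * (b \<bullet> X t \<omega> / a))) ^ m" for \<omega> v
    have h0: "0 \<le> h \<omega> v" for \<omega> v by (simp add: h_def)
    have h_meas [measurable]: "(\<lambda>(\<omega>, v). h \<omega> v) \<in> borel_measurable (M \<Otimes>\<^sub>M lborel)"
      unfolding h_def by measurable
    have exp_h: "(\<integral>\<^sup>+\<omega>. ennreal (h \<omega> v) \<partial>M) \<le> ennreal B" if v: "v \<in> {0..1}" for v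
    proof -
      have h_int: "integrable M (\<lambda>\<omega>. h \<omega> v)"
      proof (rule integrable_const_bound[where B = "2 ^ m"])
        have "1 - cos \<theta> \<le> 2" "0 \<le> 1 - cos \<theta>" for \<theta> :: real
          using cos_ge_minus_one[of \<theta>] cos_le_one[of \<theta>] by linarith+
        then have "h \<omega> v \<le> 2 ^ m" for \<omega> unfolding h_def by (intro power_mono)
        then have "norm (h \<omega> v) \<le> 2 ^ m" for \<omega> using h0 by simp
        then show "AE \<omega> in M. norm (h \<omega> v) \<le> 2 ^ m" by simp
      qed (simp add: h_def)
      have "(1 - cos (v / a * (b \<bullet> x))) ^ m \<le> 2 ^ m * a powr (- \<beta>) * G x" for x
        unfolding G_def
      proof (rule one_minus_cos_power_le)
        have "\<bar>v / a * (b \<bullet> x)\<bar> = v * \<bar>b \<bullet> x\<bar> / a" using v a by (simp add: abs_mult)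
        also have "\<dots> \<le> 1 * (1 * norm x) / a"
        proof (intro divide_right_mono mult_mono)
          have "\<bar>b \<bullet> x\<bar> \<le> norm b * norm x" by (rule Cauchy_Schwarz_ineq2)
          also have "\<dots> \<le> 1 * norm x" using b by (intro mult_right_mono) auto
          finally show "\<bar>b \<bullet> x\<bar> \<le> 1 * norm x" .
        qed (use v a in auto)
        finally show "\<bar>v / a * (b \<bullet> x)\<bar> \<le> norm x / a" by simp
      qed (use a \<beta> m in auto)
      then have "(\<integral>x. (1 - cos (v / a * (b \<bullet> x))) ^ m \<partial>\<nu>) \<le> (\<integral>x. 2 ^ m * a powr (- \<beta>) * G x \<partial>\<nu>)"
        using G_int G0 by (intro integral_mono') auto
      also have "\<dots> = 2 ^ m * a powr (- \<beta>) * I" by (simp add: I_def)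
      finally have "t * (\<integral>x. (1 - cos (v / a * (b \<bullet> x))) ^ m \<partial>\<nu>) + K * t\<^sup>2 \<le> B"
        unfolding B_def using t by (intro add_right_mono mult_left_mono) auto
      \<comment> \<open>As \<open>1 \<le> a\<close>, the frequency stays in the range where the
        error \<open>K * t^2\<close> is uniform.\<close>
      moreover have "v / a \<in> {0..1}" using v a by auto
      ultimately have "expectation (\<lambda>\<omega>. h \<omega> v) \<le> B"
        using K(2)[OF t, of "v / a"] unfolding h_def by simp
      then show ?thesis using h_int h0 by (subst nn_integral_eq_integral) (auto intro: ennreal_leI)
    qed
    let ?E = "{\<omega> \<in> space M. 2 * a \<le> \<bar>b \<bullet> X t \<omega>\<bar>}"
    have "ennreal ((1 / 2) ^ m) * emeasure M ?E = (\<integral>\<^sup>+\<omega>. ennreal ((1 / 2) ^ m) * indicator ?E \<omega> \<partial>M)"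
      by (intro nn_integral_cmult_indicator[symmetric]) measurable
    also have "\<dots> \<le> (\<integral>\<^sup>+\<omega>. (\<integral>\<^sup>+v. ennreal (h \<omega> v) * indicator {0..1} v \<partial>lborel) \<partial>M)"
    proof (rule nn_integral_mono)
      fix \<omega>
      show "ennreal ((1 / 2) ^ m) * indicator ?E \<omega> \<le> (\<integral>\<^sup>+v. ennreal (h \<omega> v) * indicator {0..1} v \<partial>lborel)"
      proof (cases "\<omega> \<in> ?E")
        case True
        then have "2 \<le> \<bar>b \<bullet> X t \<omega> / a\<bar>" using a by (simp add: field_simps)
        from average_one_minus_cos_power_ge[OF this, of m] show ?thesis
          unfolding h_def using True by simp
      qed simp
    qed
    also have "\<dots> = (\<integral>\<^sup>+v. (\<integral>\<^sup>+\<omega>. ennreal (h \<omega> v) * indicator {0..1} v \<partial>M) \<partial>lborel)"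
    proof -
      interpret pair_sigma_finite M lborel
        by unfold_locales
      show ?thesis by (rule Fubini'[symmetric]) measurable
    qed
    also have "\<dots> \<le> (\<integral>\<^sup>+v. ennreal B * indicator {0..1} (v::real) \<partial>lborel)"
      using exp_h by (intro nn_integral_mono) (auto simp: indicator_def)
    also have "\<dots> = ennreal B" by (simp add: nn_integral_cmult_indicator)
    finally have "ennreal ((1 / 2) ^ m * prob ?E) \<le> ennreal B"
      by (simp add: emeasure_eq_measure ennreal_mult)
    then have "(1 / 2) ^ m * prob ?E \<le> B" using \<open>0 \<le> B\<close> by simp
    then have "prob ?E \<le> 2 ^ m * B" by (simp add: power_divide field_simps)
    \<comment> \<open>One factor \<open>2 ^ m\<close> comes from the lower bound for the mean, the
      other from the upper bound for the test function.\<close>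
    also have "\<dots> = (4 ^ m * I) * t * a powr (- \<beta>) + (2 ^ m * K) * t\<^sup>2"
    proof -
      have "(4::real) ^ m = 2 ^ m * 2 ^ m" by (simp flip: power_mult_distrib)
      then show ?thesis unfolding B_def by (simp add: algebra_simps)
    qed
    finally show ?thesis .
  qed
  moreover have "0 \<le> 4 ^ m * I" "0 \<le> 2 ^ m * K" using \<open>0 \<le> I\<close> K(1) by auto
  ultimately show ?thesis by blast
qed

lemma prob_norm_ge_le:
  assumes \<nu>: "sets \<nu> = sets borel" "(\<integral>\<^sup>+x. ennreal (min 1 ((norm x)\<^sup>2)) \<partial>\<nu>) < \<infinity>"
    and A: "linear A"
    and char: "\<And>t u. 0 \<le> t \<Longrightarrow>
      (CLINT \<omega>|M. iexp (u \<bullet> X t \<omega>)) = exp (of_real t * levy_exponent \<gamma> A \<nu> u)"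
    and \<beta>: "0 < \<beta>" "(\<integral>\<^sup>+x\<in>{x. norm x > 1}. ennreal (norm x powr \<beta>) \<partial>\<nu>) < \<infinity>"
  shows "\<exists>C K. 0 \<le> C \<and> 0 \<le> K \<and> (\<forall>t\<in>{0..1}. \<forall>a\<ge>1.
    prob {\<omega> \<in> space M. 2 * real DIM('a) * a \<le> norm (X t \<omega>)} \<le> C * t * a powr (- \<beta>) + K * t\<^sup>2)"
proof -
  have "\<forall>b\<in>Basis. \<exists>C\<ge>0. \<exists>K\<ge>0. \<forall>t\<in>{0..1}. \<forall>a\<ge>1.
    prob {\<omega> \<in> space M. 2 * a \<le> \<bar>b \<bullet> X t \<omega>\<bar>} \<le> C * t * a powr (- \<beta>) + K * t\<^sup>2"
    using prob_abs_inner_ge_le[OF \<nu> A char \<beta>] by simp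
  from bchoice[OF this] obtain C where C: "\<forall>b\<in>Basis. 0 \<le> C b \<and> (\<exists>K\<ge>0. \<forall>t\<in>{0..1}. \<forall>a\<ge>1.
    prob {\<omega> \<in> space M. 2 * a \<le> \<bar>b \<bullet> X t \<omega>\<bar>} \<le> C b * t * a powr (- \<beta>) + K * t\<^sup>2)" ..
  then have "\<forall>b\<in>Basis. \<exists>K. 0 \<le> K \<and> (\<forall>t\<in>{0..1}. \<forall>a\<ge>1.
    prob {\<omega> \<in> space M. 2 * a \<le> \<bar>b \<bullet> X t \<omega>\<bar>} \<le> C b * t * a powr (- \<beta>) + K * t\<^sup>2)" by simp
  from bchoice[OF this] obtain K where K: "\<forall>b\<in>Basis. 0 \<le> K b \<and> (\<forall>t\<in>{0..1}. \<forall>a\<ge>1.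
    prob {\<omega> \<in> space M. 2 * a \<le> \<bar>b \<bullet> X t \<omega>\<bar>} \<le> C b * t * a powr (- \<beta>) + K b * t\<^sup>2)" ..
  have CK: "\<And>b. b \<in> Basis \<Longrightarrow> 0 \<le> C b" "\<And>b. b \<in> Basis \<Longrightarrow> 0 \<le> K b"
    "\<And>b t a. b \<in> Basis \<Longrightarrow> t \<in> {0..1} \<Longrightarrow> 1 \<le> a \<Longrightarrow>
      prob {\<omega> \<in> space M. 2 * a \<le> \<bar>b \<bullet> X t \<omega>\<bar>} \<le> C b * t * a powr (- \<beta>) + K b * t\<^sup>2"
    using C K by blast+
  have "prob {\<omega> \<in> space M. 2 * real DIM('a) * a \<le> norm (X t \<omega>)}
      \<le> (\<Sum>b\<in>Basis. C b) * t * a powr (- \<beta>) + (\<Sum>b\<in>Basis. K b) * t\<^sup>2"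
    if t: "t \<in> {0..1}" and a: "1 \<le> a" for t a
  proof -
    have [measurable]: "random_variable borel (X t)" using t by (intro random_variable_X) auto
    have "{\<omega> \<in> space M. 2 * real DIM('a) * a \<le> norm (X t \<omega>)}
        \<subseteq> (\<Union>b\<in>Basis. {\<omega> \<in> space M. 2 * a \<le> \<bar>b \<bullet> X t \<omega>\<bar>})"
    proof (intro subsetI, rule ccontr)
      fix \<omega> assume \<omega>: "\<omega> \<in> {\<omega> \<in> space M. 2 * real DIM('a) * a \<le> norm (X t \<omega>)}"
        "\<omega> \<notin> (\<Union>b\<in>Basis. {\<omega> \<in> space M. 2 * a \<le> \<bar>b \<bullet> X t \<omega>\<bar>})"
      have "norm (X t \<omega>) \<le> (\<Sum>b\<in>Basis. \<bar>X t \<omega> \<bullet> b\<bar>)" by (rule norm_le_l1)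
      also have "\<dots> < (\<Sum>b\<in>(Basis::'a set). 2 * a)"
        using \<omega> by (intro sum_strict_mono) (auto simp: inner_commute not_le)
      finally show False using \<omega> by (simp add: mult_ac)
    qed
    then have "prob {\<omega> \<in> space M. 2 * real DIM('a) * a \<le> norm (X t \<omega>)}
        \<le> prob (\<Union>b\<in>Basis. {\<omega> \<in> space M. 2 * a \<le> \<bar>b \<bullet> X t \<omega>\<bar>})"
      by (rule finite_measure_mono) (intro sets.finite_UN, simp, measurable)
    also have "\<dots> \<le> (\<Sum>b\<in>Basis. prob {\<omega> \<in> space M. 2 * a \<le> \<bar>b \<bullet> X t \<omega>\<bar>})"
      by (rule finite_measure_subadditive_finite) (auto, measurable)
    also have "\<dots> \<le> (\<Sum>b\<in>Basis. C b * t * a powr (- \<beta>) + K b * t\<^sup>2)"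
      using CK(3)[OF _ t a] by (intro sum_mono) auto
    also have "\<dots> = (\<Sum>b\<in>Basis. C b) * t * a powr (- \<beta>) + (\<Sum>b\<in>Basis. K b) * t\<^sup>2"
      by (simp add: sum.distrib sum_distrib_right)
    finally show ?thesis .
  qed
  moreover have "0 \<le> (\<Sum>b\<in>Basis. C b)" "0 \<le> (\<Sum>b\<in>Basis. K b)"
    using CK(1,2) by (simp_all add: sum_nonneg)
  ultimately show ?thesis by blast
qed

end

section \<open>Parallel volumes and intrinsic volumes\<close>

text \<open>Lagrange interpolation at the nodes 0 to \<open>n\<close>: the weight
  \<open>w j k\<close> is the \<open>j\<close>-th coefficient of the \<open>k\<close>-th basis
  polynomial and hence the same for all polynomials.\<close>

lemma polynomial_coefficients_from_values:
  "\<exists>w. \<forall>a :: nat \<Rightarrow> real. \<forall>j\<le>n. a j = (\<Sum>k\<le>n. w j k * (\<Sum>i\<le>n. a i * real k ^ i))"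
proof -
  define l :: "nat \<Rightarrow> real poly" where
    "l k = (\<Prod>i\<in>{..n} - {k}. smult (1 / (real k - real i)) [:- real i, 1:])" for k
  have l: "poly (l k) (real i) = (if i = k then 1 else 0)" if "i \<le> n" "k \<le> n" for i k
  proof (cases "i = k")
    case True
    have "poly (smult (1 / (real k - real x)) [:- real x, 1:]) (real k) = 1" if "x \<noteq> k" for x
      using that by (simp add: diff_divide_distrib[symmetric])
    then have "poly (l k) (real k) = 1" unfolding l_def poly_prod by (intro prod.neutral) blast
    then show ?thesis using True by simp
  next
    case False
    then have "(\<Prod>x\<in>{..n} - {k}. (real i - real x) / (real k - real x)) = 0"
      using that by (intro prod_zero) (auto intro!: bexI[of _ i])
    then show ?thesis using False by (simp add: l_def poly_prod)
  qed
  have deg: "degree (l k) \<le> n" if "k \<le> n" for k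
  proof -
    have "degree (l k) \<le> (\<Sum>i\<in>{..n} - {k}. degree (smult (1 / (real k - real i)) [:- real i, 1:]))"
      unfolding l_def by (rule order_trans[OF degree_prod_sum_le]) (simp_all add: o_def)
    also have "\<dots> \<le> (\<Sum>i\<in>{..n} - {k}. 1)"
      by (intro sum_mono) (auto intro: order_trans[OF degree_smult_le])
    also have "\<dots> = n" using that by simp
    finally show ?thesis .
  qed
  have "a j = (\<Sum>k\<le>n. coeff (l k) j * (\<Sum>i\<le>n. a i * real k ^ i))" if "j \<le> n" for a :: "nat \<Rightarrow> real" and j
  proof -
    define q where "q = (\<Sum>i\<le>n. monom (a i) i)"
    define q' where "q' = (\<Sum>k\<le>n. smult (poly q (real k)) (l k))"
    have "q = q'"
    proof (rule poly_eqI_degree[where A = "real ` {..n}"])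
      fix x assume "x \<in> real ` {..n}"
      then show "poly q x = poly q' x"
      proof
        fix i assume "x = real i" "i \<in> {..n}"
        then have i: "i \<le> n" "x = real i" by auto
        have "poly q' x = (\<Sum>k\<le>n. if k = i then poly q (real k) else 0)"
          unfolding q'_def i(2) poly_sum using l i(1) by (intro sum.cong) auto
        then show "poly q x = poly q' x" using i by simp
      qed
    next
      have "degree q \<le> n" unfolding q_def
        by (intro degree_sum_le) (auto intro: order_trans[OF degree_monom_le])
      moreover have "degree q' \<le> n" unfolding q'_def
        by (intro degree_sum_le) (auto intro: order_trans[OF degree_smult_le] deg)
      moreover have "card (real ` {..n}) = Suc n" by (simp add: card_image inj_on_def)
      ultimately show "degree q < card (real ` {..n})" "degree q' < card (real ` {..n})" by auto
    qed
    moreover have "coeff q j = a j" using that by (simp add: q_def coeff_sum)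
    moreover have "coeff q' j = (\<Sum>k\<le>n. coeff (l k) j * (\<Sum>i\<le>n. a i * real k ^ i))"
      by (simp add: q'_def coeff_sum q_def poly_sum poly_monom mult.commute)
    ultimately show ?thesis by simp
  qed
  then show ?thesis by (intro exI[of _ "\<lambda>j k. coeff (l k) j"]) auto
qed

definition parallel_volume :: "'a::euclidean_space set \<Rightarrow> real \<Rightarrow> real" where
  "parallel_volume K t = measure lebesgue (K + (\<lambda>x. t *\<^sub>R x) ` cball 0 1)"

text \<open>Without a Steiner polynomial for \<open>K\<close>, the description ranges over the empty predicate, so its
  value \<open>c\<close> does not depend on \<open>K\<close>. Hence the existence of the Steiner polynomial is never needed.\<close>

lemma intrinsic_volume_representation:
  "\<exists>L c. \<forall>K :: 'a::euclidean_space set. \<forall>j\<le>DIM('a). intrinsic_volume j K =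
     (if \<forall>t\<ge>0. parallel_volume K t = (\<Sum>i\<le>DIM('a). t ^ (DIM('a) - i) *
            unit_ball_vol (real (DIM('a) - i)) * (\<Sum>k\<le>DIM('a). L i k * parallel_volume K (real k)))
      then \<Sum>k\<le>DIM('a). L j k * parallel_volume K (real k) else c j)"
proof -
  let ?d = "DIM('a)"
  obtain w where w: "\<And>(a :: nat \<Rightarrow> real) j. j \<le> ?d \<Longrightarrow>
      a j = (\<Sum>k\<le>?d. w j k * (\<Sum>i\<le>?d. a i * real k ^ i))"
    using polynomial_coefficients_from_values[of ?d] by blast
  \<comment> \<open>In the Steiner formula \<open>V j\<close> belongs to the power
    \<open>t ^ (d - j)\<close> and carries the volume of a ball of dimension \<open>d - j\<close>,
    hence the reversed index and the division.\<close>
  define L where "L j k = w (?d - j) k / unit_ball_vol (real (?d - j))" for j k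
  define c where "c = (THE V :: nat \<Rightarrow> real. False)"
  define P where "P K V \<longleftrightarrow> (\<forall>t\<ge>0. parallel_volume K t =
      (\<Sum>i\<le>?d. t ^ (?d - i) * unit_ball_vol (real (?d - i)) * V i)) \<and> (\<forall>i>?d. V i = 0)"
    for K :: "'a set" and V :: "nat \<Rightarrow> real"
  define W where "W K j = (if j \<le> ?d then \<Sum>k\<le>?d. L j k * parallel_volume K (real k) else 0)"
    for K :: "'a set" and j
  have iv: "intrinsic_volume j K = (THE V. P K V) j" for j and K :: "'a set"
    unfolding intrinsic_volume_def P_def parallel_volume_def ..
  have uniq: "V = W K" if "P K V" for K V
  proof
    fix j
    show "V j = W K j"
    proof (cases "j \<le> ?d")
      case True
      define a where "a i = unit_ball_vol (real i) * V (?d - i)" for i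
      have pv: "parallel_volume K (real k) = (\<Sum>i\<le>?d. a i * real k ^ i)" for k
      proof -
        have "parallel_volume K (real k) =
            (\<Sum>i\<le>?d. real k ^ (?d - i) * unit_ball_vol (real (?d - i)) * V i)"
          using that unfolding P_def by simp
        also have "\<dots> = (\<Sum>i\<le>?d. a i * real k ^ i)"
          by (rule sum.reindex_bij_witness[of _ "\<lambda>i. ?d - i" "\<lambda>i. ?d - i"]) (auto simp: a_def)
        finally show ?thesis .
      qed
      have "a (?d - j) = (\<Sum>k\<le>?d. w (?d - j) k * parallel_volume K (real k))"
        unfolding pv by (rule w) simp
      moreover have "a (?d - j) = unit_ball_vol (real (?d - j)) * V j" using True by (simp add: a_def)
      moreover have "unit_ball_vol (real (?d - j)) \<noteq> 0"
        by (rule less_imp_neq[OF unit_ball_vol_pos, symmetric]) (rule of_nat_0_le_iff)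
      ultimately have "V j = (\<Sum>k\<le>?d. w (?d - j) k * parallel_volume K (real k)) / unit_ball_vol (real (?d - j))"
        by (simp add: field_simps)
      then show ?thesis using True by (simp add: W_def L_def sum_divide_distrib)
    next
      case False
      then show ?thesis using that by (simp add: P_def W_def)
    qed
  qed
  have "intrinsic_volume j K =
     (if \<forall>t\<ge>0. parallel_volume K t = (\<Sum>i\<le>?d. t ^ (?d - i) *
            unit_ball_vol (real (?d - i)) * (\<Sum>k\<le>?d. L i k * parallel_volume K (real k)))
      then \<Sum>k\<le>?d. L j k * parallel_volume K (real k) else c j)" (is "_ = (if ?S then _ else _)")
    if j: "j \<le> ?d" for j and K :: "'a set"
  proof -
    have PW: "P K (W K) \<longleftrightarrow> ?S" by (auto simp: P_def W_def)
    show ?thesis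
    proof (cases ?S)
      case True
      then have "P K (W K)" using PW by simp
      then have "(THE V. P K V) = W K"
        by (rule the_equality[where P = "P K", OF _ uniq])
      then have "intrinsic_volume j K = (\<Sum>k\<le>?d. L j k * parallel_volume K (real k))"
        using j by (simp only: iv W_def if_True)
      then show ?thesis unfolding if_P[OF True] .
    next
      case False
      have "P K V = False" for V
      proof -
        have "\<not> P K (W K)" using False PW by simp
        then show ?thesis using uniq[of K V] by blast
      qed
      then have "intrinsic_volume j K = c j" by (simp only: iv c_def)
      then show ?thesis unfolding if_not_P[OF False] .
    qed
  qed
  then show ?thesis by blast
qed

section \<open>Monotonicity and measurability of parallel volumes\<close>

lemma compact_parallel_body:
  fixes K :: "'a::euclidean_space set"
  assumes "compact K"
  shows "compact (K + (\<lambda>x. t *\<^sub>R x) ` cball 0 1)"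
  unfolding set_plus_image using assms
  by (intro compact_continuous_image compact_Times)
    (auto simp: split_def intro!: continuous_intros compact_continuous_image)

lemma parallel_volume_nonneg: "0 \<le> parallel_volume K t"
  by (simp add: parallel_volume_def)

lemma parallel_volume_mono:
  fixes K :: "'a::euclidean_space set"
  assumes "compact K" "compact K'" "K \<subseteq> K'" "0 \<le> t" "t \<le> t'"
  shows "parallel_volume K t \<le> parallel_volume K' t'"
  unfolding parallel_volume_def
proof (rule measure_mono_fmeasurable)
  show "K + (\<lambda>x. t *\<^sub>R x) ` cball 0 1 \<subseteq> K' + (\<lambda>x. t' *\<^sub>R x) ` cball 0 1"
  proof
    fix z assume "z \<in> K + (\<lambda>x. t *\<^sub>R x) ` cball 0 1"
    then obtain y v where z: "z = y + t *\<^sub>R v" "y \<in> K" "norm v \<le> 1"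
      by (auto elim!: set_plus_elim)
    have "\<exists>v'. t *\<^sub>R v = t' *\<^sub>R v' \<and> norm v' \<le> 1"
    proof (cases "t' = 0")
      case True
      then show ?thesis using assms z by (intro exI[of _ v]) auto
    next
      case False
      have "norm ((t / t') *\<^sub>R v) = (t / t') * norm v" using assms False by simp
      also have "\<dots> \<le> 1" using assms False z(3) by (intro mult_le_one) auto
      finally show ?thesis using False by (intro exI[of _ "(t / t') *\<^sub>R v"]) auto
    qed
    then obtain v' where "t *\<^sub>R v = t' *\<^sub>R v'" "norm v' \<le> 1" by blast
    then show "z \<in> K' + (\<lambda>x. t' *\<^sub>R x) ` cball 0 1"
      using z assms(3) by (auto intro!: set_plus_intro)
  qed
  show "K + (\<lambda>x. t *\<^sub>R x) ` cball 0 1 \<in> sets lebesgue"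
    using compact_parallel_body[OF assms(1)] by (simp add: compact_imp_closed)
  show "K' + (\<lambda>x. t' *\<^sub>R x) ` cball 0 1 \<in> lmeasurable"
    using compact_parallel_body[OF assms(2)] by (rule lmeasurable_compact)
qed

text \<open>The Steiner identity is a condition on uncountably many radii; this reduces it to
  countably many and so makes it measurable. A strict inequality at \<open>t\<close> persists for
  \<open>q\<close> on both sides of \<open>t\<close>, and a rational point on the appropriate side
  then contradicts monotonicity. Left neighbours are used only for \<open>t > 0\<close>, as 0 is
  itself rational.\<close>

lemma mono_eq_continuous_iff_Rats:
  fixes g q :: "real \<Rightarrow> real"
  assumes mono: "\<And>s t. 0 \<le> s \<Longrightarrow> s \<le> t \<Longrightarrow> g s \<le> g t" and q: "continuous_on UNIV q"
  shows "(\<forall>t\<ge>0. g t = q t) \<longleftrightarrow> (\<forall>r\<in>\<rat>. 0 \<le> r \<longrightarrow> g r = q r)"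
proof (intro iffI allI impI)
  fix t :: real assume R: "\<forall>r\<in>\<rat>. 0 \<le> r \<longrightarrow> g r = q r" and "0 \<le> t"
  show "g t = q t"
  proof (cases "t = 0")
    case False
    have lim: "(q \<longlongrightarrow> q t) (at t within S)" for S
      using q continuous_on_eq_continuous_at[of UNIV q] continuous_within_subset[of t UNIV q S]
      by (auto simp: continuous_within)
    have "g t \<le> q t"
    proof (rule ccontr)
      assume "\<not> g t \<le> q t"
      then have "eventually (\<lambda>r. q r < g t) (at_right t)" using lim by (intro order_tendstoD(2)) auto
      then obtain b where b: "t < b" "\<And>r. t < r \<Longrightarrow> r < b \<Longrightarrow> q r < g t"
        unfolding eventually_at_right_field by blast
      obtain r where r: "r \<in> \<rat>" "t < r" "r < b" using Rats_dense_in_real[OF b(1)] by blast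
      then have "g r = q r" "g t \<le> g r" using R \<open>0 \<le> t\<close> mono[of t r] by auto
      then show False using b(2)[of r] r by simp
    qed
    moreover have "q t \<le> g t"
    proof (rule ccontr)
      assume "\<not> q t \<le> g t"
      then have "eventually (\<lambda>r. g t < q r) (at_left t)" using lim by (intro order_tendstoD(1)) auto
      then obtain b where b: "b < t" "\<And>r. b < r \<Longrightarrow> r < t \<Longrightarrow> g t < q r"
        unfolding eventually_at_left_field by blast
      have "max b 0 < t" using b(1) False \<open>0 \<le> t\<close> by simp
      then obtain r where r: "r \<in> \<rat>" "max b 0 < r" "r < t" using Rats_dense_in_real by blast
      then have "g r = q r" "g r \<le> g t" using R mono[of r t] by auto
      then show False using b(2)[of r] r by simp
    qed
    ultimately show ?thesis by simp
  qed (use R in auto)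
qed auto

text \<open>This is the description of a compact convex set by its support function, and for the
  hull that function is a supremum over \<open>S\<close> alone. The slack \<open>1 / Suc k\<close>
  stands in for a supremum that need not be attained. A dense set \<open>U\<close> of normals
  suffices because strict separation survives a small change of the normal. With countable
  \<open>S\<close> and \<open>U\<close> only countable operations are left.\<close>

lemma mem_parallel_hull_iff:
  fixes S :: "'a::euclidean_space set"
  assumes S: "bounded S" "S \<noteq> {}" and "0 \<le> r"
    and U: "\<And>V :: 'a set. open V \<Longrightarrow> V \<noteq> {} \<Longrightarrow> \<exists>u\<in>U. u \<in> V"
  shows "z \<in> closure (convex hull S) + (\<lambda>x. r *\<^sub>R x) ` cball 0 1 \<longleftrightarrow>
    (\<forall>u\<in>U. \<forall>k::nat. \<exists>y\<in>S. u \<bullet> z \<le> u \<bullet> y + r * norm u + 1 / Suc k)"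
    (is "z \<in> ?L \<longleftrightarrow> ?R")
proof
  assume "z \<in> ?L"
  then obtain c v where z: "z = c + r *\<^sub>R v" "c \<in> closure (convex hull S)" "norm v \<le> 1"
    by (auto elim!: set_plus_elim)
  show ?R
  proof (intro ballI allI, rule ccontr)
    fix u and k :: nat
    assume neg: "\<not> (\<exists>y\<in>S. u \<bullet> z \<le> u \<bullet> y + r * norm u + 1 / Suc k)"
    define B where "B = u \<bullet> z - r * norm u - 1 / Suc k"
    have "convex hull S \<subseteq> {y. u \<bullet> y \<le> B}"
    proof (intro hull_minimal convex_halfspace_le)
      show "S \<subseteq> {y. u \<bullet> y \<le> B}" using neg by (force simp: B_def not_le)
    qed
    then have "closure (convex hull S) \<subseteq> {y. u \<bullet> y \<le> B}"
      by (intro closure_minimal closed_halfspace_le)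
    then have "u \<bullet> c \<le> B" using z(2) by auto
    moreover have "r * (u \<bullet> v) \<le> r * norm u"
    proof (rule mult_left_mono)
      have "u \<bullet> v \<le> norm u * norm v" by (rule norm_cauchy_schwarz)
      also have "\<dots> \<le> norm u * 1" using z(3) by (intro mult_left_mono) auto
      finally show "u \<bullet> v \<le> norm u" by simp
    qed fact
    moreover have "u \<bullet> z = u \<bullet> c + r * (u \<bullet> v)" by (simp add: z(1) inner_add_right)
    moreover have "0 < 1 / real (Suc k)" by simp
    ultimately show False unfolding B_def by linarith
  qed
next
  assume R: ?R
  show "z \<in> ?L"
  proof (rule ccontr)
    assume "z \<notin> ?L"
    have "compact (closure (convex hull S))" using S(1) by (simp add: bounded_convex_hull)
    then have comp: "compact ?L" by (rule compact_parallel_body)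
    have "convex ?L"
      by (intro convex_set_plus convex_closure convex_convex_hull convex_scaling convex_cball)
    then obtain a b where ab: "a \<bullet> z < b" "\<And>x. x \<in> ?L \<Longrightarrow> b < a \<bullet> x"
      using separating_hyperplane_closed_point[OF _ compact_imp_closed[OF comp] \<open>z \<notin> ?L\<close>] by metis
    obtain Q where Q: "0 < Q" "\<And>x. x \<in> ?L \<Longrightarrow> norm x \<le> Q"
      using compact_imp_bounded[OF comp] bounded_pos by metis
    define \<eta> where "\<eta> = b - a \<bullet> z"
    have \<eta>: "0 < \<eta>" using ab(1) by (simp add: \<eta>_def)
    define W where "W = norm z + Q"
    \<comment> \<open>\<open>W\<close> bounds \<open>norm (x - z)\<close>, so replacing
      \<open>- a\<close> by \<open>u\<close> changes the inner product with \<open>x - z\<close> by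
      at most \<open>\<eta> / 2\<close>, half of the separation gap.\<close>
    define \<delta> where "\<delta> = \<eta> / (2 * W)"
    have nz: "0 < W" unfolding W_def using Q(1) by (simp add: add_nonneg_pos)
    then have "0 < \<delta>" using \<eta> by (simp add: \<delta>_def)
    then obtain u where u: "u \<in> U" "u \<in> ball (- a) \<delta>" using U[of "ball (- a) \<delta>"] by auto
    then have na: "norm (u + a) \<le> \<delta>" by (simp add: dist_norm norm_minus_commute add.commute)
    have key: "u \<bullet> x \<le> u \<bullet> z - \<eta> / 2" if "x \<in> ?L" for x
    proof -
      have "(u + a) \<bullet> (x - z) \<le> norm (u + a) * norm (x - z)" by (rule norm_cauchy_schwarz)
      also have "\<dots> \<le> \<delta> * W"
        using na Q(2)[OF that] norm_triangle_ineq4[of x z] \<open>0 < \<delta>\<close>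
        by (intro mult_mono) (auto simp: W_def)
      also have "\<dots> = \<eta> / 2" using nz by (simp add: \<delta>_def)
      finally have "(u + a) \<bullet> (x - z) \<le> \<eta> / 2" .
      moreover have "(u + a) \<bullet> (x - z) = u \<bullet> x - u \<bullet> z + a \<bullet> x - a \<bullet> z"
        by (simp add: inner_diff_right inner_add_left)
      ultimately have "u \<bullet> x - u \<bullet> z + a \<bullet> x - a \<bullet> z \<le> (b - a \<bullet> z) / 2"
        by (simp only: \<eta>_def)
      then show ?thesis using ab(2)[OF that] unfolding \<eta>_def by (simp add: field_simps)
    qed
    obtain k :: nat where k: "1 / real (Suc k) < \<eta> / 2"
      using reals_Archimedean[of "\<eta> / 2"] \<eta> by (auto simp: inverse_eq_divide)
    obtain y where y: "y \<in> S" "u \<bullet> z \<le> u \<bullet> y + r * norm u + 1 / Suc k" using R u(1) by blast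
    have "y \<in> closure (convex hull S)" using y(1) by (meson closure_subset hull_inc subsetD)
    \<comment> \<open>This point maximises the inner product with \<open>u\<close> over the ball of
      radius \<open>r\<close> around \<open>y\<close>.\<close>
    then have "y + r *\<^sub>R sgn u \<in> ?L" by (intro set_plus_intro imageI) (auto simp: norm_sgn)
    from key[OF this] have "u \<bullet> y + r * norm u \<le> u \<bullet> z - \<eta> / 2"
      by (simp add: inner_add_right sgn_div_norm dot_square_norm power2_eq_square field_simps split: if_splits)
    then show False using y(2) k by linarith
  qed
qed

text \<open>The parallel body is a section of a jointly measurable set of pairs of an outcome and a
  point, so its volume is measurable by the Fubini theorem.\<close>

lemma measurable_parallel_volume_hull:
  fixes x :: "'t \<Rightarrow> 'w \<Rightarrow> 'a::euclidean_space"
  assumes T: "countable T" "T \<noteq> {}" and x: "\<And>t. t \<in> T \<Longrightarrow> x t \<in> borel_measurable N"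
    and bdd: "\<And>\<omega>. \<omega> \<in> space N \<Longrightarrow> bounded ((\<lambda>t. x t \<omega>) ` T)" and r: "0 \<le> r"
  shows "(\<lambda>\<omega>. parallel_volume (closure (convex hull ((\<lambda>t. x t \<omega>) ` T))) r) \<in> borel_measurable N"
proof -
  define L where "L \<omega> = closure (convex hull ((\<lambda>t. x t \<omega>) ` T)) + (\<lambda>x. r *\<^sub>R x) ` cball 0 1" for \<omega>
  obtain U :: "'a set" where U: "countable U" "\<And>V. open V \<Longrightarrow> V \<noteq> {} \<Longrightarrow> \<exists>u\<in>U. u \<in> V"
    using countable_dense_setE by metis
  have "Measurable.pred (N \<Otimes>\<^sub>M lborel)
      (\<lambda>p. \<forall>u\<in>U. \<forall>k::nat. \<exists>t\<in>T. u \<bullet> snd p \<le> u \<bullet> x t (fst p) + r * norm u + 1 / Suc k)"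
  proof (intro pred_countable_Ball U(1) pred_intros_countable(1) pred_countable_Bex T(1))
    fix u k t assume "t \<in> T"
    then have "(\<lambda>p. x t (fst p)) \<in> borel_measurable (N \<Otimes>\<^sub>M (lborel :: 'a measure))"
      by (intro measurable_compose[OF measurable_fst] x)
    then have m1: "(\<lambda>p. u \<bullet> x t (fst p)) \<in> borel_measurable (N \<Otimes>\<^sub>M (lborel :: 'a measure))"
      by (intro borel_measurable_inner) auto
    have m2: "(\<lambda>p. u \<bullet> snd p) \<in> borel_measurable (N \<Otimes>\<^sub>M (lborel :: 'a measure))"
      by (intro borel_measurable_inner) auto
    show "Measurable.pred (N \<Otimes>\<^sub>M lborel) (\<lambda>p. u \<bullet> snd p \<le> u \<bullet> x t (fst p) + r * norm u + 1 / Suc k)"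
      unfolding pred_def
      by (rule borel_measurable_le[OF m2 borel_measurable_add[OF
            borel_measurable_add[OF m1 borel_measurable_const] borel_measurable_const]])
  qed
  moreover have "snd p \<in> L (fst p) \<longleftrightarrow>
      (\<forall>u\<in>U. \<forall>k::nat. \<exists>t\<in>T. u \<bullet> snd p \<le> u \<bullet> x t (fst p) + r * norm u + 1 / Suc k)"
    if "p \<in> space (N \<Otimes>\<^sub>M (lborel :: 'a measure))" for p
  proof -
    have "fst p \<in> space N" using that by (auto simp: space_pair_measure)
    from mem_parallel_hull_iff[OF bdd[OF this] _ r U(2), of "snd p"] show ?thesis
      unfolding L_def using T(2) by auto
  qed
  ultimately have "Measurable.pred (N \<Otimes>\<^sub>M lborel) (\<lambda>p. snd p \<in> L (fst p))"
    by (subst measurable_cong)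
  then have "{p \<in> space (N \<Otimes>\<^sub>M lborel). snd p \<in> L (fst p)} \<in> sets (N \<Otimes>\<^sub>M lborel)"
    by (simp only: pred_def)
  then have "(\<lambda>\<omega>. emeasure lborel (L \<omega>)) \<in> borel_measurable N"
    by (intro lborel.measurable_emeasure) auto
  then have "(\<lambda>\<omega>. measure lborel (L \<omega>)) \<in> borel_measurable N"
    unfolding measure_def by measurable
  moreover have "measure lborel (L \<omega>) = parallel_volume (closure (convex hull ((\<lambda>t. x t \<omega>) ` T))) r"
    if "\<omega> \<in> space N" for \<omega>
  proof -
    have "compact (L \<omega>)" unfolding L_def
      using bdd[OF that] by (intro compact_parallel_body) (simp add: bounded_convex_hull)
    then have "L \<omega> \<in> sets borel" by (simp add: compact_imp_closed)
    then show ?thesis unfolding parallel_volume_def L_def[symmetric] by simp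
  qed
  ultimately show ?thesis by (simp cong: measurable_cong)
qed

section \<open>Cadlag paths and dyadic times\<close>

lemma cadlag_bounded:
  fixes f :: "real \<Rightarrow> 'a::euclidean_space"
  assumes right: "\<And>t. 0 \<le> t \<Longrightarrow> (f \<longlongrightarrow> f t) (at_right t)"
    and left: "\<And>t. 0 < t \<Longrightarrow> \<exists>l. (f \<longlongrightarrow> l) (at_left t)"
  shows "bounded (f ` {0..s})"
proof -
  have "\<exists>V. open V \<and> t \<in> V \<and> bounded (f ` ({0..} \<inter> V))" if t: "t \<in> {0..s}" for t
  proof -
    have "(f \<longlongrightarrow> f t) (at_right t)" using right t by auto
    from order_tendstoD(2)[OF tendsto_norm[OF this], of "norm (f t) + 1"]
    obtain b where b: "t < b" "\<And>u. t < u \<Longrightarrow> u < b \<Longrightarrow> norm (f u) < norm (f t) + 1"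
      by (auto simp: eventually_at_right_field)
    \<comment> \<open>At 0 no left limit is available; the restriction to \<open>u \<ge> 0\<close>
      makes the claim vacuous there.\<close>
    have "\<exists>c B. c < t \<and> (\<forall>u\<ge>0. c < u \<longrightarrow> u < t \<longrightarrow> norm (f u) < B)"
    proof (cases "t = 0")
      case True
      then show ?thesis by (intro exI[of _ "-1"]) auto
    next
      case False
      then obtain l where "(f \<longlongrightarrow> l) (at_left t)" using left[of t] t by auto
      from order_tendstoD(2)[OF tendsto_norm[OF this], of "norm l + 1"]
      show ?thesis by (auto simp: eventually_at_left_field)
    qed
    then obtain c B where c: "c < t" "\<And>u. 0 \<le> u \<Longrightarrow> c < u \<Longrightarrow> u < t \<Longrightarrow> norm (f u) < B" by blast
    have "norm (f u) \<le> max B (norm (f t) + 1)" if "u \<in> {0..} \<inter> {c<..<b}" for u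
      using that b(2)[of u] c(2)[of u] by (cases u t rule: linorder_cases) auto
    then have "bounded (f ` ({0..} \<inter> {c<..<b}))" unfolding bounded_iff by blast
    moreover have "t \<in> {c<..<b}" using b c by auto
    ultimately show ?thesis by (intro exI[of _ "{c<..<b}"]) auto
  qed
  then obtain V where V: "\<And>t. t \<in> {0..s} \<Longrightarrow> open (V t) \<and> t \<in> V t \<and> bounded (f ` ({0..} \<inter> V t))"
    by metis
  obtain D where D: "D \<subseteq> {0..s}" "finite D" "{0..s} \<subseteq> (\<Union>t\<in>D. V t)"
    using compactE_image[OF compact_Icc, of "{0..s}" V 0 s] V by blast
  have "{0..s} \<subseteq> (\<Union>t\<in>D. {0..} \<inter> V t)" using D(3) by auto
  then have "f ` {0..s} \<subseteq> (\<Union>t\<in>D. f ` ({0..} \<inter> V t))" unfolding image_UN[symmetric] by (rule image_mono)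
  moreover have "bounded (\<Union>t\<in>D. f ` ({0..} \<inter> V t))" using D V by (intro bounded_UN) auto
  ultimately show ?thesis by (rule bounded_subset[rotated])
qed

text \<open>The endpoint \<open>s\<close> belongs to every grid: paths are recovered only by limits
  from the right, and \<open>s\<close> has no later times in \<open>{0..s}\<close>.\<close>

definition dyadic_grid :: "real \<Rightarrow> nat \<Rightarrow> real set" where
  "dyadic_grid s m = (\<lambda>k. s * real k / 2 ^ m) ` {..2 ^ m}"

lemma dyadic_grid_subset: "0 \<le> s \<Longrightarrow> dyadic_grid s m \<subseteq> {0..s}"
proof
  fix t assume s: "0 \<le> s" and "t \<in> dyadic_grid s m"
  then obtain k :: nat where k: "k \<le> 2 ^ m" "t = s * (real k / 2 ^ m)" by (auto simp: dyadic_grid_def)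
  have "real k \<le> 2 ^ m" using k(1) by (metis of_nat_le_iff of_nat_numeral of_nat_power)
  then have "real k / 2 ^ m \<le> 1" by simp
  then have "s * (real k / 2 ^ m) \<le> s" using mult_left_le[OF _ s] by blast
  moreover have "0 \<le> s * (real k / 2 ^ m)" using s by simp
  ultimately show "t \<in> {0..s}" unfolding k(2) atLeastAtMost_iff by blast
qed

lemma incseq_dyadic_grid: "incseq (dyadic_grid s)"
proof (rule incseq_SucI)
  fix m
  show "dyadic_grid s m \<subseteq> dyadic_grid s (Suc m)"
    unfolding dyadic_grid_def
  proof safe
    fix k :: nat assume "k \<le> 2 ^ m"
    then show "s * real k / 2 ^ m \<in> (\<lambda>k. s * real k / 2 ^ Suc m) ` {..2 ^ Suc m}"
      by (intro image_eqI[of _ _ "2 * k"]) auto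
  qed
qed

lemma dyadic_grid_dense_right:
  assumes "0 \<le> t" "t < s" "t < b"
  shows "\<exists>q\<in>(\<Union>m. dyadic_grid s m). t < q \<and> q < b"
proof -
  have s: "0 < s" using assms by simp
  define e where "e = min (b - t) (s - t)"
  have "0 < e" using assms by (simp add: e_def)
  obtain m where m: "(1 / 2 :: real) ^ m < e / s"
    using real_arch_pow_inv[of "e / s" "1 / 2"] \<open>0 < e\<close> s by auto
  then have me: "s / 2 ^ m < e" using s by (simp add: power_one_over field_simps)
  \<comment> \<open>The first grid point strictly beyond \<open>t\<close>.\<close>
  define k where "k = Suc (nat \<lfloor>t * 2 ^ m / s\<rfloor>)"
  have "0 \<le> t * 2 ^ m / s" using assms s by simp
  then have "real k = 1 + real_of_int \<lfloor>t * 2 ^ m / s\<rfloor>" by (simp add: k_def)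
  then have k: "t * 2 ^ m / s < real k" "real k \<le> t * 2 ^ m / s + 1" by linarith+
  have 1: "t < s * real k / 2 ^ m" using k(1) s by (simp add: field_simps)
  have "s * real k / 2 ^ m \<le> t + s / 2 ^ m" using k(2) s by (simp add: field_simps)
  then have 2: "s * real k / 2 ^ m < t + e" using me by linarith
  then have "s * real k / 2 ^ m < s" by (simp add: e_def)
  then have "real k < 2 ^ m" using s by (simp add: field_simps)
  then have "k \<le> 2 ^ m" by (metis less_imp_le of_nat_less_iff of_nat_numeral of_nat_power)
  then have "s * real k / 2 ^ m \<in> dyadic_grid s m" by (auto simp: dyadic_grid_def)
  then show ?thesis using 1 2 by (intro bexI[of _ "s * real k / 2 ^ m"]) (auto simp: e_def)
qed

lemma closure_hull_dyadic_grid: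
  fixes f :: "real \<Rightarrow> 'a::euclidean_space"
  assumes right: "\<And>t. 0 \<le> t \<Longrightarrow> (f \<longlongrightarrow> f t) (at_right t)" and "0 \<le> s"
  shows "closure (convex hull (f ` {0..s})) = closure (convex hull (f ` (\<Union>m. dyadic_grid s m)))"
    (is "_ = closure (convex hull (f ` ?T))")
proof
  have sub: "?T \<subseteq> {0..s}" using dyadic_grid_subset[OF \<open>0 \<le> s\<close>] by blast
  then show "closure (convex hull (f ` ?T)) \<subseteq> closure (convex hull (f ` {0..s}))"
    by (intro closure_mono hull_mono image_mono)
  have "f t \<in> closure (f ` ?T)" if t: "t \<in> {0..s}" for t
  proof (cases "t = s")
    case True
    have "s \<in> dyadic_grid s 0" by (auto simp: dyadic_grid_def)
    then have "f t \<in> f ` ?T" using True by (intro imageI UN_I[of 0]) auto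
    then show ?thesis by (rule subsetD[OF closure_subset])
  next
    case False
    then have ts: "0 \<le> t" "t < s" using t by auto
    show ?thesis unfolding closure_approachable
    proof (intro allI impI)
      fix e :: real assume "0 < e"
      have "eventually (\<lambda>u. dist (f u) (f t) < e) (at_right t)"
        using tendstoD[OF right[OF ts(1)] \<open>0 < e\<close>] .
      then obtain b where b: "t < b" "\<And>u. t < u \<Longrightarrow> u < b \<Longrightarrow> dist (f u) (f t) < e"
        unfolding eventually_at_right_field by blast
      obtain q where "q \<in> ?T" "t < q" "q < b" using dyadic_grid_dense_right[OF ts b(1)] by blast
      then show "\<exists>y\<in>f ` ?T. dist y (f t) < e" using b(2)[of q] by (intro bexI[of _ "f q"] imageI)
    qed
  qed
  then have "f ` {0..s} \<subseteq> closure (f ` ?T)" by (rule image_subsetI)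
  also have "\<dots> \<subseteq> closure (convex hull (f ` ?T))" by (intro closure_mono hull_subset)
  finally have "convex hull (f ` {0..s}) \<subseteq> closure (convex hull (f ` ?T))"
    by (intro hull_minimal convex_closure convex_convex_hull)
  then show "closure (convex hull (f ` {0..s})) \<subseteq> closure (convex hull (f ` ?T))"
    by (intro closure_minimal closed_closure)
qed

section \<open>Tails of the swings and moments\<close>

text \<open>The values of \<open>Y\<close> are split into layers between \<open>C * 2 ^ N\<close>
  and \<open>C * 2 ^ (N + 1)\<close>. The geometric factor \<open>2 powr ((p - \<beta>) * N)\<close>
  beats the polynomial \<open>(N + 1) ^ d\<close>, which will count lists of exponents.\<close>

lemma integrable_powr_of_dyadic_tail:
  fixes Y :: "'a \<Rightarrow> real" and p \<beta> B C :: real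
  assumes "prob_space M" and Y [measurable]: "Y \<in> borel_measurable M" and Y0: "\<And>\<omega>. 0 \<le> Y \<omega>"
    and p: "0 \<le> p" "p < \<beta>" and "0 < C" "0 \<le> B"
    and tail: "\<And>N :: nat. measure M {\<omega> \<in> space M. C * 2 ^ N < Y \<omega>} \<le> real (N + 1) ^ d * B * 2 powr (- \<beta> * N)"
  shows "integrable M (\<lambda>\<omega>. Y \<omega> powr p)"
proof (rule integrableI_nonneg)
  interpret prob_space M by fact
  define S where "S N = {\<omega> \<in> space M. C * 2 ^ N < Y \<omega>}" for N :: nat
  have [measurable]: "S N \<in> events" for N unfolding S_def by measurable
  define b where "b N = 2 powr (p * real (N + 1)) * (real (N + 1) ^ d * B * 2 powr (- \<beta> * N))" for N :: nat
  \<comment> \<open>Chosen so that \<open>d * x\<close> is at most half of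
    \<open>(\<beta> - p) * ln 2\<close>: the growth of \<open>(N + 1) ^ d\<close> then consumes only
    half of the exponential decay. The summand in \<open>d + 1\<close> avoids a division by 0 for
    \<open>d = 0\<close>.\<close>
  define x where "x = (\<beta> - p) * ln 2 / (2 * real (d + 1))"
  have x: "0 < x" using p by (simp add: x_def)
  have summ: "summable b"
  proof (rule summable_comparison_test')
    define \<rho> where "\<rho> = exp (- (\<beta> - p) * ln 2 / 2)"
    define K where "K = 2 powr p * B * (1 / min 1 x) ^ d"
    have "(p - \<beta>) * ln 2 < 0" using p by (intro mult_neg_pos) auto
    then have "\<bar>\<rho>\<bar> < 1" by (simp add: \<rho>_def)
    then show "summable (\<lambda>N. K * \<rho> ^ N)" by (intro summable_mult summable_geometric) auto
    fix N :: nat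
    have "real (N + 1) * min 1 x \<le> exp (x * N)"
    proof -
      have "real N * min 1 x \<le> real N * x" by (intro mult_left_mono) auto
      then have "real (N + 1) * min 1 x \<le> 1 + x * N" by (simp add: algebra_simps)
      also have "\<dots> \<le> exp (x * N)" by (rule exp_ge_add_one_self)
      finally show ?thesis .
    qed
    then have "real (N + 1) \<le> (1 / min 1 x) * exp (x * N)" using x by (simp add: field_simps)
    then have "real (N + 1) ^ d \<le> ((1 / min 1 x) * exp (x * N)) ^ d" by (intro power_mono) auto
    also have "\<dots> = (1 / min 1 x) ^ d * exp (real d * (x * N))" by (simp only: power_mult_distrib exp_of_nat_mult)
    also have "\<dots> \<le> (1 / min 1 x) ^ d * exp ((\<beta> - p) * ln 2 / 2 * N)"
    proof (intro mult_left_mono)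
      have "real d * x \<le> real (d + 1) * x" using x by (intro mult_right_mono) auto
      also have "\<dots> = (\<beta> - p) * ln 2 / 2" by (simp add: x_def field_simps)
      finally have "real d * x * N \<le> (\<beta> - p) * ln 2 / 2 * N" by (intro mult_right_mono) auto
      then show "exp (real d * (x * N)) \<le> exp ((\<beta> - p) * ln 2 / 2 * N)" by (simp add: mult_ac)
    qed (use x in auto)
    finally have "real (N + 1) ^ d \<le> (1 / min 1 x) ^ d * exp ((\<beta> - p) * ln 2 / 2 * N)" .
    then have "real (N + 1) ^ d * (2 powr p * B * exp (- (\<beta> - p) * ln 2 * N))
        \<le> (1 / min 1 x) ^ d * exp ((\<beta> - p) * ln 2 / 2 * N) * (2 powr p * B * exp (- (\<beta> - p) * ln 2 * N))"
      using \<open>0 \<le> B\<close> by (intro mult_right_mono) auto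
    also have "\<dots> = K * (exp ((\<beta> - p) * ln 2 / 2 * N) * exp (- (\<beta> - p) * ln 2 * N))"
      by (simp add: K_def mult_ac)
    also have "exp ((\<beta> - p) * ln 2 / 2 * N) * exp (- (\<beta> - p) * ln 2 * N) = \<rho> ^ N"
      unfolding \<rho>_def exp_of_nat_mult[symmetric] exp_add[symmetric] by (simp add: field_simps)
    finally have "real (N + 1) ^ d * (2 powr p * B * exp (- (\<beta> - p) * ln 2 * N)) \<le> K * \<rho> ^ N" .
    moreover have "2 powr (p * real (N + 1)) * 2 powr (- \<beta> * N) = 2 powr p * exp (- (\<beta> - p) * ln 2 * N)"
      unfolding powr_def by (simp add: exp_add[symmetric] algebra_simps)
    then have "b N = real (N + 1) ^ d * (2 powr p * B * exp (- (\<beta> - p) * ln 2 * N))"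
      unfolding b_def by (simp add: mult_ac)
    moreover have "0 \<le> b N" unfolding b_def using \<open>0 \<le> B\<close> by simp
    ultimately show "norm (b N) \<le> K * \<rho> ^ N" by simp
  qed
  have b0: "0 \<le> b N" for N unfolding b_def using \<open>0 \<le> B\<close> by simp
  have pt: "ennreal (Y \<omega> powr p) \<le> ennreal (C powr p) *
      (1 + (\<Sum>N. ennreal (2 powr (p * real (N + 1))) * indicator (S N) \<omega>))" if \<omega>: "\<omega> \<in> space M" for \<omega>
  proof (cases "Y \<omega> \<le> C")
    case True
    then have "ennreal (Y \<omega> powr p) \<le> ennreal (C powr p) * 1"
      using p Y0 by (simp add: powr_mono2 ennreal_leI)
    also have "\<dots> \<le> ennreal (C powr p) * (1 + (\<Sum>N. ennreal (2 powr (p * real (N + 1))) * indicator (S N) \<omega>))"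
      by (intro mult_left_mono) auto
    finally show ?thesis .
  next
    case False
    define n where "n = (LEAST n. Y \<omega> \<le> C * 2 ^ n)"
    obtain n0 where "Y \<omega> / C < 2 ^ n0" using real_arch_pow[of 2 "Y \<omega> / C"] by auto
    then have "Y \<omega> \<le> C * 2 ^ n0" using \<open>0 < C\<close> by (simp add: field_simps)
    then have n: "Y \<omega> \<le> C * 2 ^ n" unfolding n_def by (rule LeastI)
    then have "n \<noteq> 0" using False by (intro notI) simp
    then obtain N where N: "n = Suc N" using not0_implies_Suc by blast
    have "\<not> Y \<omega> \<le> C * 2 ^ N" using not_less_Least[of N "\<lambda>n. Y \<omega> \<le> C * 2 ^ n"] N by (simp add: n_def)
    then have inS: "\<omega> \<in> S N" using \<omega> by (simp add: S_def)
    have "Y \<omega> powr p \<le> (C * 2 ^ n) powr p" using n Y0 p by (intro powr_mono2) auto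
    also have "\<dots> = C powr p * 2 powr (p * real (N + 1))"
    proof -
      have "(2 ^ n :: real) powr p = (2 powr real n) powr p" by (simp add: powr_realpow)
      then show ?thesis by (simp add: powr_mult powr_powr N algebra_simps)
    qed
    finally have "ennreal (Y \<omega> powr p) \<le> ennreal (C powr p) * (ennreal (2 powr (p * real (N + 1))) * indicator (S N) \<omega>)"
      using inS by (simp add: ennreal_mult[symmetric] ennreal_leI)
    also have "\<dots> \<le> ennreal (C powr p) * (\<Sum>N. ennreal (2 powr (p * real (N + 1))) * indicator (S N) \<omega>)"
    proof (rule mult_left_mono)
      show "ennreal (2 powr (p * real (N + 1))) * indicator (S N) \<omega>
          \<le> (\<Sum>N. ennreal (2 powr (p * real (N + 1))) * indicator (S N) \<omega>)"
      proof -
        define g :: "nat \<Rightarrow> ennreal" where "g = (\<lambda>N. ennreal (2 powr (p * real (N + 1))) * indicator (S N) \<omega>)"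
        have "sum g {N} \<le> suminf g" by (rule sum_le_suminf) auto
        then have "g N \<le> suminf g" by simp
        then show ?thesis by (simp only: g_def)
      qed
    qed simp
    also have "\<dots> \<le> ennreal (C powr p) * (1 + (\<Sum>N. ennreal (2 powr (p * real (N + 1))) * indicator (S N) \<omega>))"
      by (intro mult_left_mono) auto
    finally show ?thesis .
  qed
  have "(\<integral>\<^sup>+\<omega>. ennreal (Y \<omega> powr p) \<partial>M) \<le> (\<integral>\<^sup>+\<omega>. ennreal (C powr p) *
      (1 + (\<Sum>N. ennreal (2 powr (p * real (N + 1))) * indicator (S N) \<omega>)) \<partial>M)"
    using pt by (rule nn_integral_mono)
  also have "\<dots> = ennreal (C powr p) * (1 + (\<integral>\<^sup>+\<omega>. (\<Sum>N. ennreal (2 powr (p * real (N + 1))) * indicator (S N) \<omega>) \<partial>M))"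
    by (simp add: nn_integral_cmult nn_integral_add emeasure_space_1)
  also have "(\<integral>\<^sup>+\<omega>. (\<Sum>N. ennreal (2 powr (p * real (N + 1))) * indicator (S N) \<omega>) \<partial>M)
      = (\<Sum>N. ennreal (2 powr (p * real (N + 1))) * emeasure M (S N))"
    by (simp add: nn_integral_suminf nn_integral_cmult_indicator)
  also have "\<dots> \<le> (\<Sum>N. ennreal (b N))"
  proof (rule suminf_le)
    fix N
    have "ennreal (2 powr (p * real (N + 1))) * emeasure M (S N) = ennreal (2 powr (p * real (N + 1)) * prob (S N))"
      by (simp add: emeasure_eq_measure ennreal_mult)
    also have "\<dots> \<le> ennreal (b N)"
      unfolding b_def S_def by (intro ennreal_leI mult_left_mono tail) auto
    finally show "ennreal (2 powr (p * real (N + 1))) * emeasure M (S N) \<le> ennreal (b N)" .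
  qed auto
  also have "\<dots> = ennreal (suminf b)" using suminf_ennreal2[OF b0 summ] .
  finally show "(\<integral>\<^sup>+\<omega>. ennreal (Y \<omega> powr p) \<partial>M) < \<infinity>"
    by (auto simp: ennreal_mult_less_top add_left_mono mult_left_mono le_less_trans top.not_eq_extremum
        intro: le_less_trans)
qed auto

section \<open>Swings along the paths of a Levy process\<close>

context levy_process
begin

text \<open>Countably many times make the event measurable, and it is the increasing limit of the
  events over finite grids.\<close>

definition swing_event :: "real \<Rightarrow> real list \<Rightarrow> 'w set" where
  "swing_event s as = {\<omega> \<in> space M. chain (\<lambda>t. X t \<omega>) (\<Union>m. dyadic_grid s m) as}"

text \<open>Grid points are addressed by their index, so that the path on the grid becomes a random
  walk.\<close>

definition grid_event :: "real \<Rightarrow> nat \<Rightarrow> real list \<Rightarrow> 'w set" where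
  "grid_event s m as = {\<omega> \<in> space M. chain (\<lambda>k. X (s * real k / 2 ^ m) \<omega>) {..2 ^ m} as}"

lemma chain_event_sets:
  assumes "countable T" "\<And>t. t \<in> T \<Longrightarrow> 0 \<le> f t"
  shows "{\<omega> \<in> space M. chain (\<lambda>t. X (f t) \<omega>) T as} \<in> events"
proof -
  have "Measurable.pred M (\<lambda>\<omega>. chain (\<lambda>t. X (f t) \<omega>) T as)"
    using assms by (intro measurable_chain random_variable_X)
  then show ?thesis by (simp only: pred_def)
qed

lemma countable_dyadic_grid: "countable (\<Union>m. dyadic_grid s m)"
  by (auto simp: dyadic_grid_def)

lemma swing_event_sets: "0 \<le> s \<Longrightarrow> swing_event s as \<in> events"
  unfolding swing_event_def
proof (rule chain_event_sets[OF countable_dyadic_grid])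
  fix t assume "0 \<le> s" "t \<in> (\<Union>m. dyadic_grid s m)"
  then obtain m where "t \<in> dyadic_grid s m" by blast
  then show "0 \<le> t" using dyadic_grid_subset[OF \<open>0 \<le> s\<close>, of m] by auto
qed

lemma grid_event_sets: "0 \<le> s \<Longrightarrow> grid_event s m as \<in> events"
  unfolding grid_event_def by (intro chain_event_sets) auto

lemma LIMSEQ_prob_swing_event:
  assumes "0 \<le> s"
  shows "(\<lambda>m. prob {\<omega> \<in> space M. chain (\<lambda>t. X t \<omega>) (dyadic_grid s m) as}) \<longlonglongrightarrow> prob (swing_event s as)"
proof -
  let ?E = "\<lambda>m. {\<omega> \<in> space M. chain (\<lambda>t. X t \<omega>) (dyadic_grid s m) as}"
  have "?E m \<in> events" for m
    using dyadic_grid_subset[OF assms, of m] by (intro chain_event_sets) (auto simp: dyadic_grid_def)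
  moreover have "incseq ?E"
  proof (rule incseq_SucI, safe)
    fix m \<omega> assume "chain (\<lambda>t. X t \<omega>) (dyadic_grid s m) as"
    then show "chain (\<lambda>t. X t \<omega>) (dyadic_grid s (Suc m)) as"
      by (rule chain_mono) (rule incseq_SucD[OF incseq_dyadic_grid])
  qed
  moreover have "(\<Union>m. ?E m) = swing_event s as"
    unfolding swing_event_def
    by (auto intro: chain_mono dest: chain_UN_incseq[OF incseq_dyadic_grid])
  ultimately show ?thesis using finite_Lim_measure_incseq[of ?E] by auto
qed

lemma prob_dyadic_grid_le_grid_event:
  assumes "0 < s"
  shows "prob {\<omega> \<in> space M. chain (\<lambda>t. X t \<omega>) (dyadic_grid s m) as} \<le> prob (grid_event s m as)"
proof (rule finite_measure_mono)
  have "strict_mono (\<lambda>k. s * real k / 2 ^ m)"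
    using assms by (intro strict_monoI) (simp add: divide_strict_right_mono)
  then show "{\<omega> \<in> space M. chain (\<lambda>t. X t \<omega>) (dyadic_grid s m) as} \<subseteq> grid_event s m as"
    unfolding grid_event_def dyadic_grid_def by (auto intro: chain_image)
qed (use assms in \<open>simp add: grid_event_sets\<close>)

text \<open>Each factor of a product over the grid is replaced by a bound that no longer depends on
  \<open>m\<close>, which allows the passage to the limit.\<close>

lemma prob_grid_event_single_le:
  assumes "0 < s"
  shows "prob (grid_event s m [a]) \<le> prob (swing_event s [a])"
proof (rule finite_measure_mono)
  show "grid_event s m [a] \<subseteq> swing_event s [a]"
  proof
    fix \<omega> assume \<omega>: "\<omega> \<in> grid_event s m [a]"
    then obtain u v where uv: "u \<le> 2 ^ m" "v \<le> 2 ^ m" "u \<le> v"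
      "a \<le> norm (X (s * real v / 2 ^ m) \<omega> - X (s * real u / 2 ^ m) \<omega>)"
      unfolding grid_event_def by auto
    have "s * real u / 2 ^ m \<in> dyadic_grid s m" "s * real v / 2 ^ m \<in> dyadic_grid s m"
      using uv unfolding dyadic_grid_def by auto
    moreover have "s * real u / 2 ^ m \<le> s * real v / 2 ^ m"
      using uv(3) assms by (simp add: divide_right_mono)
    ultimately show "\<omega> \<in> swing_event s [a]"
      using \<omega> uv(4) unfolding swing_event_def grid_event_def chain.simps by blast
  qed
qed (use assms in \<open>simp add: swing_event_sets\<close>)

text \<open>The partial sums of the increments are \<open>X (\<tau> k) - X (\<tau> 0)\<close>.
  Swings ignore the shift by the starting value, which is 0 only almost surely.\<close>

lemma prob_grid_event_le_prod:
  assumes "0 < s"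
  shows "prob (grid_event s m as) \<le> (\<Prod>a\<leftarrow>as. prob (grid_event s m [a]))"
proof -
  define \<tau> where "\<tau> k = s * real k / 2 ^ m" for k :: nat
  define Y where "Y i \<omega> = X (\<tau> (Suc i)) \<omega> - X (\<tau> i) \<omega>" for i \<omega>
  have ind: "indep_vars (\<lambda>_. borel) Y {..<2 ^ m}"
    unfolding Y_def using assms
    by (intro indep_increments) (auto simp: \<tau>_def intro!: divide_strict_right_mono)
  have "(\<Sum>i<k. Y i \<omega>) = X (\<tau> k) \<omega> - X (\<tau> 0) \<omega>" for k \<omega>
    unfolding Y_def by (rule sum_lessThan_telescope)
  then have "grid_event s m bs = {\<omega> \<in> space M. chain (\<lambda>k. \<Sum>i<k. Y i \<omega>) {..2 ^ m} bs}" for bs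
    unfolding grid_event_def by (intro Collect_cong conj_cong refl chain_cong) (simp add: \<tau>_def)
  then show ?thesis using prob_chain_le_prod[OF ind] by simp
qed

lemma prob_swing_event_le_prod:
  assumes "0 < s"
  shows "prob (swing_event s as) \<le> (\<Prod>a\<leftarrow>as. prob (swing_event s [a]))"
proof (rule LIMSEQ_le_const2)
  show "(\<lambda>m. prob {\<omega> \<in> space M. chain (\<lambda>t. X t \<omega>) (dyadic_grid s m) as}) \<longlonglongrightarrow> prob (swing_event s as)"
    using assms by (intro LIMSEQ_prob_swing_event) auto
  have "prob {\<omega> \<in> space M. chain (\<lambda>t. X t \<omega>) (dyadic_grid s m) as} \<le> (\<Prod>a\<leftarrow>as. prob (swing_event s [a]))" for m
  proof -
    have "(\<Prod>a\<leftarrow>as. prob (grid_event s m [a])) \<le> (\<Prod>a\<leftarrow>as. prob (swing_event s [a]))"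
      using prob_grid_event_single_le[OF assms]
      by (induction as) (auto intro!: mult_mono prod_list_nonneg)
    then show ?thesis
      using prob_dyadic_grid_le_grid_event[OF assms, of m as] prob_grid_event_le_prod[OF assms, of m as]
      by linarith
  qed
  then show "\<exists>N. \<forall>m\<ge>N. prob {\<omega> \<in> space M. chain (\<lambda>t. X t \<omega>) (dyadic_grid s m) as}
      \<le> (\<Prod>a\<leftarrow>as. prob (swing_event s [a]))" by blast
qed

lemma prob_increment_ge:
  assumes "0 \<le> t" "0 \<le> h"
  shows "prob {\<omega> \<in> space M. a \<le> norm (X (t + h) \<omega> - X t \<omega>)} = prob {\<omega> \<in> space M. a \<le> norm (X h \<omega>)}"
proof -
  have [measurable]: "random_variable borel (X t)" "random_variable borel (X h)"
    "random_variable borel (X (t + h))" "random_variable borel (X 0)"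
    using assms by (auto intro!: random_variable_X)
  have A: "{x :: 'a. a \<le> norm x} \<in> sets borel" by measurable
  have "prob {\<omega> \<in> space M. a \<le> norm (X (t + h) \<omega> - X t \<omega>)}
      = measure (distr M borel (\<lambda>\<omega>. X (t + h) \<omega> - X t \<omega>)) {x. a \<le> norm x}"
    by (subst measure_distr[OF _ A]) (auto intro!: arg_cong[where f = prob])
  also have "\<dots> = measure (distr M borel (\<lambda>\<omega>. X h \<omega> - X 0 \<omega>)) {x. a \<le> norm x}"
    using stationary_increments[OF assms] by simp
  also have "\<dots> = prob {\<omega> \<in> space M. a \<le> norm (X h \<omega> - X 0 \<omega>)}"
    by (subst measure_distr[OF _ A]) (auto intro!: arg_cong[where f = prob])
  also have "\<dots> = prob {\<omega> \<in> space M. a \<le> norm (X h \<omega>)}"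
    using start_zero by (intro measure_eq_AE) auto
  finally show ?thesis .
qed

lemma prob_grid_event_triple_le:
  assumes "0 < s" "0 < a"
  shows "prob (grid_event s m [3 * a])
    \<le> (prob (swing_event s [a]))\<^sup>2 + 2 ^ m * prob {\<omega> \<in> space M. a \<le> norm (X (s / 2 ^ m) \<omega>)}"
proof -
  define E where "E k = {\<omega> \<in> space M. a \<le> norm (X (s * real (Suc k) / 2 ^ m) \<omega> - X (s * real k / 2 ^ m) \<omega>)}"
    for k
  have E_sets: "E k \<in> events" for k
  proof -
    have [measurable]: "random_variable borel (X (s * real k / 2 ^ m))"
      "random_variable borel (X (s * real (Suc k) / 2 ^ m))"
      using assms by (auto intro!: random_variable_X)
    show ?thesis unfolding E_def by measurable
  qed
  have E_prob: "prob (E k) = prob {\<omega> \<in> space M. a \<le> norm (X (s / 2 ^ m) \<omega>)}" for k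
  proof -
    have "s * real (Suc k) / 2 ^ m = s * real k / 2 ^ m + s / 2 ^ m" by (simp add: field_simps)
    then show ?thesis unfolding E_def
      using prob_increment_ge[of "s * real k / 2 ^ m" "s / 2 ^ m" a] assms by simp
  qed
  have "grid_event s m [3 * a] \<subseteq> grid_event s m [a, a] \<union> (\<Union>k<2 ^ m. E k)"
  proof
    fix \<omega> assume \<omega>: "\<omega> \<in> grid_event s m [3 * a]"
    show "\<omega> \<in> grid_event s m [a, a] \<union> (\<Union>k<2 ^ m. E k)"
    proof (cases "\<omega> \<in> (\<Union>k<2 ^ m. E k)")
      case False
      have "chain (\<lambda>k. X (s * real k / 2 ^ m) \<omega>) {..2 ^ m} [a, a]"
      proof (rule chain_split_large[OF _ \<open>0 < a\<close>])
        show "chain (\<lambda>k. X (s * real k / 2 ^ m) \<omega>) {..2 ^ m} [3 * a]"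
          using \<omega> by (simp only: grid_event_def mem_Collect_eq)
        show "norm (X (s * real (Suc k) / 2 ^ m) \<omega> - X (s * real k / 2 ^ m) \<omega>) < a" if "k < 2 ^ m" for k
          using False \<omega> that unfolding E_def grid_event_def by (auto simp: not_le)
      qed
      then show ?thesis using \<omega> by (simp only: grid_event_def mem_Collect_eq Un_iff simp_thms)
    qed simp
  qed
  then have "prob (grid_event s m [3 * a]) \<le> prob (grid_event s m [a, a] \<union> (\<Union>k<2 ^ m. E k))"
    using assms by (intro finite_measure_mono) (auto intro!: sets.Un sets.finite_UN grid_event_sets E_sets)
  also have "\<dots> \<le> prob (grid_event s m [a, a]) + prob (\<Union>k<2 ^ m. E k)"
    using assms by (intro measure_Un_le grid_event_sets sets.finite_UN E_sets) auto
  also have "prob (grid_event s m [a, a]) \<le> (prob (swing_event s [a]))\<^sup>2"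
  proof -
    have "prob (grid_event s m [a, a]) \<le> prob (grid_event s m [a]) * prob (grid_event s m [a])"
      using prob_grid_event_le_prod[OF assms(1), of m "[a, a]"] by simp
    also have "\<dots> \<le> prob (swing_event s [a]) * prob (swing_event s [a])"
      using prob_grid_event_single_le[OF assms(1)] by (intro mult_mono) auto
    finally show ?thesis by (simp add: power2_eq_square)
  qed
  also have "prob (\<Union>k<2 ^ m. E k) \<le> (\<Sum>k<2 ^ m. prob (E k))"
    using E_sets by (intro finite_measure_subadditive_finite) auto
  also have "(\<Sum>k<2 ^ m. prob (E k)) = 2 ^ m * prob {\<omega> \<in> space M. a \<le> norm (X (s / 2 ^ m) \<omega>)}"
    by (simp add: E_prob)
  finally show ?thesis by simp
qed

lemma bounded_path: "\<omega> \<in> space M \<Longrightarrow> bounded ((\<lambda>t. X t \<omega>) ` {0..s})"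
  by (intro cadlag_bounded right_continuous_paths left_limits_paths)

text \<open>Each path is bounded, so the decreasing events have empty intersection. This gives no
  rate; it only starts the recursion.\<close>

lemma tendsto_prob_swing_event:
  assumes "0 \<le> s" "0 < c"
  shows "((\<lambda>a. prob (swing_event s [c * a])) \<longlongrightarrow> 0) at_top"
proof -
  have mono: "swing_event s [b] \<subseteq> swing_event s [a]" if "a \<le> b" for a b
    unfolding swing_event_def chain.simps using that order_trans by blast
  have "(\<lambda>n. prob (swing_event s [real n])) \<longlonglongrightarrow> prob (\<Inter>n. swing_event s [real n])"
    using swing_event_sets[OF assms(1)] mono
    by (intro finite_Lim_measure_decseq) (auto simp: decseq_def)
  moreover have "(\<Inter>n. swing_event s [real n]) = {}"
  proof -
    have False if \<omega>: "\<omega> \<in> (\<Inter>n. swing_event s [real n])" for \<omega>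
    proof -
      have "\<omega> \<in> space M" using \<omega> by (auto simp: swing_event_def)
      from bounded_path[OF this, of s] obtain B where "\<forall>x\<in>(\<lambda>t. X t \<omega>) ` {0..s}. norm x \<le> B"
        unfolding bounded_iff by blast
      then have B: "\<And>t. t \<in> {0..s} \<Longrightarrow> norm (X t \<omega>) \<le> B" by blast
      obtain n where n: "2 * B < real n" using reals_Archimedean2 by blast
      obtain u v where uv: "u \<in> (\<Union>m. dyadic_grid s m)" "v \<in> (\<Union>m. dyadic_grid s m)"
        "real n \<le> norm (X v \<omega> - X u \<omega>)"
        using \<omega> unfolding swing_event_def by fastforce
      have "u \<in> {0..s}" "v \<in> {0..s}" using uv dyadic_grid_subset[OF assms(1)] by blast+
      then have "norm (X v \<omega> - X u \<omega>) \<le> 2 * B"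
        using B[of u] B[of v] norm_triangle_ineq4[of "X v \<omega>" "X u \<omega>"] by linarith
      then show False using n uv(3) by linarith
    qed
    then show ?thesis by blast
  qed
  ultimately have lim: "(\<lambda>n. prob (swing_event s [real n])) \<longlonglongrightarrow> 0" by simp
  show ?thesis
  proof (rule tendstoI)
    fix e :: real assume "0 < e"
    obtain n where n: "prob (swing_event s [real n]) < e"
      using order_tendstoD(2)[OF lim \<open>0 < e\<close>] by (auto simp: eventually_sequentially)
    have "dist (prob (swing_event s [c * a])) 0 < e" if "real n / c \<le> a" for a
    proof -
      have "real n \<le> c * a" using that assms(2) by (simp add: field_simps)
      then have "prob (swing_event s [c * a]) \<le> prob (swing_event s [real n])"
        using assms(1) by (intro finite_measure_mono mono swing_event_sets)
      then show ?thesis using n by simp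
    qed
    then show "eventually (\<lambda>a. dist (prob (swing_event s [c * a])) 0 < e) at_top"
      unfolding eventually_at_top_linorder by blast
  qed
qed

text \<open>Summed over \<open>2 ^ m\<close> steps of length \<open>s / 2 ^ m\<close>, the linear
  term of the bound for one step gives \<open>C * s * a powr (- \<beta>)\<close> for every
  \<open>m\<close>, while the quadratic one gives \<open>K * s^2 / 2 ^ m\<close> and disappears in
  the limit.\<close>

lemma prob_swing_event_tail:
  assumes \<nu>: "sets \<nu> = sets borel" "(\<integral>\<^sup>+x. ennreal (min 1 ((norm x)\<^sup>2)) \<partial>\<nu>) < \<infinity>"
    and A: "linear A"
    and char: "\<And>t u. 0 \<le> t \<Longrightarrow>
      (CLINT \<omega>|M. iexp (u \<bullet> X t \<omega>)) = exp (of_real t * levy_exponent \<gamma> A \<nu> u)"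
    and \<beta>: "0 < \<beta>" "(\<integral>\<^sup>+x\<in>{x. norm x > 1}. ennreal (norm x powr \<beta>) \<partial>\<nu>) < \<infinity>"
    and s: "0 < s"
  shows "\<exists>D\<ge>1. \<forall>a>0. prob (swing_event s [a]) \<le> D * a powr (- \<beta>)"
proof -
  \<comment> \<open>Sizes are rescaled to match the threshold in the bound for a single step, so
    that the recursion starts at \<open>a = 1\<close>.\<close>
  define c where "c = 2 * real DIM('a)"
  have c: "0 < c" by (simp add: c_def)
  obtain C K where CK: "0 \<le> C" "0 \<le> K" "\<And>t a. t \<in> {0..1} \<Longrightarrow> 1 \<le> a \<Longrightarrow>
      prob {\<omega> \<in> space M. c * a \<le> norm (X t \<omega>)} \<le> C * t * a powr (- \<beta>) + K * t\<^sup>2"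
    using prob_norm_ge_le[OF \<nu> A char \<beta>] unfolding c_def by blast
  define q where "q a = prob (swing_event s [c * a])" for a
  have rec: "q (3 * a) \<le> (q a)\<^sup>2 + (C * s) * a powr (- \<beta>)" if a: "1 \<le> a" for a
  proof (rule LIMSEQ_le)
    show "(\<lambda>m. prob {\<omega> \<in> space M. chain (\<lambda>t. X t \<omega>) (dyadic_grid s m) [c * (3 * a)]}) \<longlonglongrightarrow> q (3 * a)"
      unfolding q_def using s by (intro LIMSEQ_prob_swing_event) auto
    have "(\<lambda>m. (q a)\<^sup>2 + (C * s) * a powr (- \<beta>) + K * s\<^sup>2 * (1 / 2) ^ m)
        \<longlonglongrightarrow> (q a)\<^sup>2 + (C * s) * a powr (- \<beta>) + K * s\<^sup>2 * 0"
      by (intro tendsto_intros LIMSEQ_realpow_zero) auto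
    then show "(\<lambda>m. (q a)\<^sup>2 + (C * s) * a powr (- \<beta>) + K * s\<^sup>2 * (1 / 2) ^ m)
        \<longlonglongrightarrow> (q a)\<^sup>2 + (C * s) * a powr (- \<beta>)" by simp
    obtain m0 where m0: "s < 2 ^ m0" using real_arch_pow[of 2 s] by auto
    have "prob {\<omega> \<in> space M. chain (\<lambda>t. X t \<omega>) (dyadic_grid s m) [c * (3 * a)]}
        \<le> (q a)\<^sup>2 + (C * s) * a powr (- \<beta>) + K * s\<^sup>2 * (1 / 2) ^ m" if "m0 \<le> m" for m
    proof -
      have "(2::real) ^ m0 \<le> 2 ^ m" using that by (intro power_increasing) auto
      then have "s \<le> 2 ^ m" using m0 by linarith
      then have "s / 2 ^ m \<in> {0..1}" using s by simp
      then have "2 ^ m * prob {\<omega> \<in> space M. c * a \<le> norm (X (s / 2 ^ m) \<omega>)}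
          \<le> 2 ^ m * (C * (s / 2 ^ m) * a powr (- \<beta>) + K * (s / 2 ^ m)\<^sup>2)"
        using a by (intro mult_left_mono CK(3)) auto
      also have "\<dots> = (C * s) * a powr (- \<beta>) + K * s\<^sup>2 * (1 / 2) ^ m"
        by (simp add: field_simps power2_eq_square power_one_over)
      finally have 1: "2 ^ m * prob {\<omega> \<in> space M. c * a \<le> norm (X (s / 2 ^ m) \<omega>)}
          \<le> (C * s) * a powr (- \<beta>) + K * s\<^sup>2 * (1 / 2) ^ m" .
      have "0 < c * a" using c a by simp
      from prob_grid_event_triple_le[OF s this, of m]
      have "prob (grid_event s m [3 * (c * a)]) \<le> (q a)\<^sup>2 + (C * s) * a powr (- \<beta>) + K * s\<^sup>2 * (1 / 2) ^ m"
        using 1 unfolding q_def by linarith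
      moreover have "c * (3 * a) = 3 * (c * a)" by simp
      ultimately show ?thesis
        using prob_dyadic_grid_le_grid_event[OF s, of m "[3 * (c * a)]"] by (simp only:)
    qed
    then show "\<exists>N. \<forall>m\<ge>N. prob {\<omega> \<in> space M. chain (\<lambda>t. X t \<omega>) (dyadic_grid s m) [c * (3 * a)]}
        \<le> (q a)\<^sup>2 + (C * s) * a powr (- \<beta>) + K * s\<^sup>2 * (1 / 2) ^ m" by blast
  qed
  have "(q \<longlongrightarrow> 0) at_top" unfolding q_def using s c by (intro tendsto_prob_swing_event) auto
  from tail_bound_of_quadratic_recursion[OF this _ _ rec \<beta>(1)]
  obtain D where D: "1 \<le> D" "\<And>a. 1 \<le> a \<Longrightarrow> q a \<le> D * a powr (- \<beta>)"
    unfolding q_def by auto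
  \<comment> \<open>\<open>D'\<close> undoes the rescaling by \<open>c\<close> and makes the bound
    at least 1 for \<open>a < c\<close>, so that it holds for all positive \<open>a\<close>.\<close>
  define D' where "D' = max 1 (c powr \<beta>) * D"
  have D': "1 \<le> D'" "c powr \<beta> * D \<le> D'"
    using D(1) mult_mono[of 1 "max 1 (c powr \<beta>)" 1 D] unfolding D'_def
    by (auto intro: mult_right_mono)
  have "prob (swing_event s [a]) \<le> D' * a powr (- \<beta>)" if a: "0 < a" for a
  proof (cases "c \<le> a")
    case True
    have "prob (swing_event s [a]) = q (a / c)" using c by (simp add: q_def)
    also have "\<dots> \<le> D * (a / c) powr (- \<beta>)" using True c by (intro D(2)) simp
    also have "\<dots> = (c powr \<beta> * D) * a powr (- \<beta>)"
      using a c by (simp add: powr_divide powr_minus field_simps)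
    also have "\<dots> \<le> D' * a powr (- \<beta>)" using D'(2) by (intro mult_right_mono) auto
    finally show ?thesis .
  next
    case False
    have "a powr \<beta> \<le> c powr \<beta>" using False a \<beta>(1) by (intro powr_mono2) auto
    also have "\<dots> \<le> c powr \<beta> * D" using D(1) by (simp add: mult_le_cancel_left1)
    also have "\<dots> \<le> D'" by (rule D'(2))
    finally have "1 \<le> D' * a powr (- \<beta>)" using a by (simp add: powr_minus field_simps)
    then show ?thesis using prob_le_1 order_trans by blast
  qed
  then show ?thesis using D'(1) by blast
qed

section \<open>Measurability and moments for the hull of the path\<close>

lemma path_hull_dyadic_grid:
  assumes "\<omega> \<in> space M" "0 \<le> s"
  shows "path_hull X s \<omega> = closure (convex hull ((\<lambda>t. X t \<omega>) ` (\<Union>m. dyadic_grid s m)))"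
  unfolding path_hull_def using assms
  by (intro closure_hull_dyadic_grid right_continuous_paths)

lemma bounded_dyadic_path:
  assumes "\<omega> \<in> space M" "0 \<le> s"
  shows "bounded ((\<lambda>t. X t \<omega>) ` (\<Union>m. dyadic_grid s m))"
proof (rule bounded_subset[OF bounded_path[OF assms(1), of s]])
  have "(\<Union>m. dyadic_grid s m) \<subseteq> {0..s}" using dyadic_grid_subset[OF assms(2)] by blast
  then show "(\<lambda>t. X t \<omega>) ` (\<Union>m. dyadic_grid s m) \<subseteq> (\<lambda>t. X t \<omega>) ` {0..s}" by (rule image_mono)
qed

lemma compact_path_hull: "\<omega> \<in> space M \<Longrightarrow> compact (path_hull X s \<omega>)"
  unfolding path_hull_def by (simp add: bounded_convex_hull bounded_path)

lemma measurable_parallel_volume_path_hull: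
  assumes "0 \<le> s" "0 \<le> r"
  shows "(\<lambda>\<omega>. parallel_volume (path_hull X s \<omega>) r) \<in> borel_measurable M"
proof -
  have "(\<lambda>\<omega>. parallel_volume (closure (convex hull ((\<lambda>t. X t \<omega>) ` (\<Union>m. dyadic_grid s m)))) r) \<in> borel_measurable M"
  proof (rule measurable_parallel_volume_hull[OF countable_dyadic_grid _ _ _ assms(2)])
    show "(\<Union>m. dyadic_grid s m) \<noteq> {}" by (auto simp: dyadic_grid_def)
    show "random_variable borel (X t)" if t: "t \<in> (\<Union>m. dyadic_grid s m)" for t
    proof -
      obtain m where "t \<in> dyadic_grid s m" using t by blast
      then have "0 \<le> t" using dyadic_grid_subset[OF assms(1), of m] by auto
      then show ?thesis by (rule random_variable_X)
    qed
    show "bounded ((\<lambda>t. X t \<omega>) ` (\<Union>m. dyadic_grid s m))" if "\<omega> \<in> space M" for \<omega>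
      using that assms(1) by (rule bounded_dyadic_path)
  qed
  then show ?thesis
    by (rule measurable_cong[THEN iffD2, rotated]) (simp add: path_hull_dyadic_grid assms)
qed

text \<open>Multiplying the tail bounds adds up the exponents. A threshold 0 carries no information,
  but its trivial bound 1 is at most \<open>D\<close>.\<close>

lemma prob_swing_event_levels_le:
  assumes s: "0 < s" and D: "1 \<le> D" "\<And>a. 0 < a \<Longrightarrow> prob (swing_event s [a]) \<le> D * a powr (- \<beta>)"
    and \<beta>: "0 < \<beta>" and ms: "N \<le> sum_list ms"
  shows "prob (swing_event s (map (\<lambda>m. if m = 0 then 0 else 2 ^ m) ms)) \<le> D ^ length ms * 2 powr (- \<beta> * N)"
proof -
  let ?lev = "\<lambda>m. if m = 0 then 0 else (2::real) ^ m"
  have lev: "prob (swing_event s [?lev m]) \<le> D * 2 powr (- \<beta> * m)" for m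
  proof (cases "m = 0")
    case True
    then show ?thesis using order_trans[OF prob_le_1 D(1), of "swing_event s [0]"] by simp
  next
    case False
    have "prob (swing_event s [2 ^ m]) \<le> D * (2 ^ m) powr (- \<beta>)" by (rule D(2)) simp
    also have "(2 ^ m) powr (- \<beta>) = 2 powr (- \<beta> * m)"
      by (simp add: powr_realpow[symmetric] powr_powr mult.commute)
    finally show ?thesis using False by simp
  qed
  have "prob (swing_event s (map ?lev ms)) \<le> (\<Prod>a\<leftarrow>map ?lev ms. prob (swing_event s [a]))"
    by (rule prob_swing_event_le_prod[OF s])
  also have "\<dots> \<le> D ^ length ms * 2 powr (- \<beta> * sum_list ms)"
  proof (induction ms)
    case (Cons m ms)
    have "(\<Prod>a\<leftarrow>map ?lev (m # ms). prob (swing_event s [a]))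
        \<le> (D * 2 powr (- \<beta> * m)) * (D ^ length ms * 2 powr (- \<beta> * sum_list ms))"
      unfolding list.map prod_list.Cons using lev D(1)
      by (intro mult_mono Cons.IH prod_list_nonneg) auto
    also have "\<dots> = D ^ length (m # ms) * (2 powr (- \<beta> * m) * 2 powr (- \<beta> * sum_list ms))" by simp
    also have "2 powr (- \<beta> * m) * 2 powr (- \<beta> * sum_list ms) = 2 powr (- \<beta> * sum_list (m # ms))"
      by (simp add: powr_add[symmetric] algebra_simps)
    finally show ?case .
  qed simp
  also have "\<dots> \<le> D ^ length ms * 2 powr (- \<beta> * N)"
  proof (intro mult_left_mono[OF powr_mono])
    have "\<beta> * real N \<le> \<beta> * real (sum_list ms)" using \<beta> ms by (intro mult_left_mono) auto
    then show "- \<beta> * real (sum_list ms) \<le> - \<beta> * real N" by simp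
  qed (use D(1) in auto)
  finally show ?thesis .
qed

text \<open>There are \<open>(N + 1) ^ d\<close> lists of \<open>d\<close> exponents up to
  \<open>N\<close>, and each of those with sum at least \<open>N\<close> has probability of order
  \<open>2 powr (- \<beta> * N)\<close>. The union bound therefore costs only a polynomial factor in
  \<open>N\<close>.\<close>

lemma integrable_parallel_volume_powr:
  assumes \<nu>: "sets \<nu> = sets borel" "(\<integral>\<^sup>+x. ennreal (min 1 ((norm x)\<^sup>2)) \<partial>\<nu>) < \<infinity>"
    and A: "linear A"
    and char: "\<And>t u. 0 \<le> t \<Longrightarrow>
      (CLINT \<omega>|M. iexp (u \<bullet> X t \<omega>)) = exp (of_real t * levy_exponent \<gamma> A \<nu> u)"
    and \<beta>: "0 < \<beta>" "(\<integral>\<^sup>+x\<in>{x. norm x > 1}. ennreal (norm x powr \<beta>) \<partial>\<nu>) < \<infinity>"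
    and s: "0 < s" and r: "0 \<le> r" and p: "0 \<le> p" "p < \<beta>"
  shows "integrable M (\<lambda>\<omega>. (1 + parallel_volume (path_hull X s \<omega>) r) powr p)"
proof -
  let ?d = "DIM('a)" and ?T = "\<Union>m. dyadic_grid s m"
  let ?lev = "\<lambda>m. if m = 0 then 0 else (2::real) ^ m"
  obtain D where D: "1 \<le> D" "\<And>a. 0 < a \<Longrightarrow> prob (swing_event s [a]) \<le> D * a powr (- \<beta>)"
    using prob_swing_event_tail[OF \<nu> A char \<beta> s] by blast
  \<comment> \<open>The summand 1 absorbs the 1 added to the volume, since the gap product is at
    least 1.\<close>
  define C0 where "C0 = 1 + 10 ^ ?d * measure lebesgue (cball (0::'a) (real ?d + r))"
  have C0: "0 < C0" unfolding C0_def by (simp add: add_pos_nonneg)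
  have vol: "\<exists>vs. length vs = Suc ?d \<and> sorted vs \<and> set vs \<subseteq> ?T \<and>
      1 + parallel_volume (path_hull X s \<omega>) r \<le> C0 * gap_prod (\<lambda>t. X t \<omega>) vs" if \<omega>: "\<omega> \<in> space M" for \<omega>
  proof -
    have "?T \<noteq> {}" by (auto simp: dyadic_grid_def)
    from measure_parallel_hull_le[OF bounded_dyadic_path[OF \<omega>] this r]
    obtain vs where vs: "length vs = Suc ?d" "sorted vs" "set vs \<subseteq> ?T"
      "parallel_volume (path_hull X s \<omega>) r \<le> (C0 - 1) * gap_prod (\<lambda>t. X t \<omega>) vs"
      unfolding parallel_volume_def using path_hull_dyadic_grid[OF \<omega>] s by (auto simp: C0_def)
    have "1 \<le> gap_prod (\<lambda>t. X t \<omega>) vs" by (rule gap_prod_ge_1)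
    then have "1 + parallel_volume (path_hull X s \<omega>) r \<le> C0 * gap_prod (\<lambda>t. X t \<omega>) vs"
      using vs(4) by (simp add: algebra_simps)
    then show ?thesis using vs by blast
  qed
  show ?thesis
  proof (rule integrable_powr_of_dyadic_tail[OF prob_space_axioms _ _ p])
    show "(\<lambda>\<omega>. 1 + parallel_volume (path_hull X s \<omega>) r) \<in> borel_measurable M"
      using measurable_parallel_volume_path_hull[of s r] s r by simp
    show "0 \<le> 1 + parallel_volume (path_hull X s \<omega>) r" for \<omega>
      using parallel_volume_nonneg[of "path_hull X s \<omega>" r] by simp
    \<comment> \<open>The factor \<open>2 ^ d\<close> makes up for rounding \<open>d\<close> gaps to
      powers of 2.\<close>
    show "0 < C0 * 2 ^ ?d" using C0 by simp
    show "0 \<le> D ^ ?d" using D(1) by simp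
    fix N :: nat
    define L where "L = {ms. set ms \<subseteq> {..N} \<and> length ms = ?d}"
    have L: "finite L" "card L = (N + 1) ^ ?d"
      unfolding L_def by (simp_all add: finite_lists_length_eq card_lists_length_eq)
    define L' where "L' = {ms \<in> L. N \<le> sum_list ms}"
    have L': "finite L'" "card L' \<le> (N + 1) ^ ?d"
      using L card_mono[of L L'] by (auto simp: L'_def)
    have "{\<omega> \<in> space M. C0 * 2 ^ ?d * 2 ^ N < 1 + parallel_volume (path_hull X s \<omega>) r}
        \<subseteq> (\<Union>ms\<in>L'. swing_event s (map ?lev ms))"
    proof safe
      fix \<omega> assume \<omega>: "\<omega> \<in> space M" "C0 * 2 ^ ?d * 2 ^ N < 1 + parallel_volume (path_hull X s \<omega>) r"
      obtain vs where vs: "length vs = Suc ?d" "sorted vs" "set vs \<subseteq> ?T"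
        "1 + parallel_volume (path_hull X s \<omega>) r \<le> C0 * gap_prod (\<lambda>t. X t \<omega>) vs"
        using vol[OF \<omega>(1)] by blast
      have "C0 * 2 ^ (N + ?d) < C0 * gap_prod (\<lambda>t. X t \<omega>) vs"
        using \<omega>(2) vs(4) by (simp add: power_add mult_ac)
      then have "2 ^ (N + ?d) < gap_prod (\<lambda>t. X t \<omega>) vs" using C0 by simp
      from chain_of_gap_prod[OF vs(2,3,1) this]
      obtain ms where "length ms = ?d" "set ms \<subseteq> {..N}" "N \<le> sum_list ms"
        "chain (\<lambda>t. X t \<omega>) ?T (map ?lev ms)" by blast
      then show "\<omega> \<in> (\<Union>ms\<in>L'. swing_event s (map ?lev ms))"
        using \<omega>(1) unfolding L'_def L_def swing_event_def by blast
    qed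
    then have "prob {\<omega> \<in> space M. C0 * 2 ^ ?d * 2 ^ N < 1 + parallel_volume (path_hull X s \<omega>) r}
        \<le> prob (\<Union>ms\<in>L'. swing_event s (map ?lev ms))"
      using L'(1) s by (intro finite_measure_mono sets.finite_UN swing_event_sets) auto
    also have "\<dots> \<le> (\<Sum>ms\<in>L'. prob (swing_event s (map ?lev ms)))"
      using L'(1) s by (intro finite_measure_subadditive_finite) (auto intro: swing_event_sets)
    also have "\<dots> \<le> (\<Sum>ms\<in>L'. D ^ ?d * 2 powr (- \<beta> * N))"
    proof (rule sum_mono)
      fix ms assume "ms \<in> L'"
      then have "length ms = ?d" "N \<le> sum_list ms" by (auto simp: L'_def L_def)
      then show "prob (swing_event s (map ?lev ms)) \<le> D ^ ?d * 2 powr (- \<beta> * N)"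
        using prob_swing_event_levels_le[OF s D \<beta>(1), of N ms] by simp
    qed
    also have "\<dots> = real (card L') * (D ^ ?d * 2 powr (- \<beta> * N))" by simp
    also have "\<dots> \<le> real ((N + 1) ^ ?d) * (D ^ ?d * 2 powr (- \<beta> * N))"
      using L'(2) D(1) by (intro mult_right_mono) (auto simp only: of_nat_le_iff, simp)
    finally show "prob {\<omega> \<in> space M. C0 * 2 ^ ?d * 2 ^ N < 1 + parallel_volume (path_hull X s \<omega>) r}
        \<le> real (N + 1) ^ ?d * D ^ ?d * 2 powr (- \<beta> * N)" by (simp add: mult_ac)
  qed
qed

lemma path_hull_mono: "s \<le> s' \<Longrightarrow> path_hull X s \<omega> \<subseteq> path_hull X s' \<omega>"
  unfolding path_hull_def by (intro closure_mono hull_mono image_mono) auto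

text \<open>Where the Steiner identity holds, the intrinsic volume is a linear combination of
  parallel volumes; elsewhere it is constant. The dividing set is measurable because rational radii
  decide the identity.\<close>

lemma measurable_intrinsic_volume_path_hull:
  assumes "0 \<le> s" "j \<le> DIM('a)"
  shows "(\<lambda>\<omega>. intrinsic_volume j (path_hull X s \<omega>)) \<in> borel_measurable M"
proof -
  let ?d = "DIM('a)"
  obtain L c where Lc: "\<And>K :: 'a set. intrinsic_volume j K =
     (if \<forall>t\<ge>0. parallel_volume K t = (\<Sum>i\<le>?d. t ^ (?d - i) *
            unit_ball_vol (real (?d - i)) * (\<Sum>k\<le>?d. L i k * parallel_volume K (real k)))
      then \<Sum>k\<le>?d. L j k * parallel_volume K (real k) else c j)"
    using intrinsic_volume_representation[where 'a = 'a] assms(2) by blast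
  define pv where "pv r \<omega> = parallel_volume (path_hull X s \<omega>) r" for r \<omega>
  define q where "q t \<omega> = (\<Sum>i\<le>?d. t ^ (?d - i) * unit_ball_vol (real (?d - i)) * (\<Sum>k\<le>?d. L i k * pv (real k) \<omega>))"
    for t \<omega>
  have pv: "pv r \<in> borel_measurable M" if "0 \<le> r" for r
    unfolding pv_def using assms(1) that by (rule measurable_parallel_volume_path_hull)
  have lin: "(\<lambda>\<omega>. \<Sum>k\<le>?d. L i k * pv (real k) \<omega>) \<in> borel_measurable M" for i
    by (intro borel_measurable_sum borel_measurable_times borel_measurable_const) (simp add: pv)
  have q: "q t \<in> borel_measurable M" for t
    unfolding q_def by (intro borel_measurable_sum borel_measurable_times[OF borel_measurable_const lin])
  have "Measurable.pred M (\<lambda>\<omega>. \<forall>r\<in>\<rat>. 0 \<le> r \<longrightarrow> pv r \<omega> = q r \<omega>)"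
  proof (intro pred_countable_Ball countable_rat)
    fix r
    show "Measurable.pred M (\<lambda>\<omega>. 0 \<le> r \<longrightarrow> pv r \<omega> = q r \<omega>)"
    proof (cases "0 \<le> r")
      case True
      have "Measurable.pred M (\<lambda>\<omega>. pv r \<omega> = q r \<omega>)"
        unfolding pred_def using pv[OF True] q by (rule borel_measurable_eq)
      then show ?thesis using True by simp
    qed simp
  qed
  then have "(\<lambda>\<omega>. if \<forall>r\<in>\<rat>. 0 \<le> r \<longrightarrow> pv r \<omega> = q r \<omega>
      then \<Sum>k\<le>?d. L j k * pv (real k) \<omega> else c j) \<in> borel_measurable M"
    by (intro measurable_If lin borel_measurable_const) (simp only: pred_def)
  moreover have "(\<forall>t\<ge>0. pv t \<omega> = q t \<omega>) \<longleftrightarrow> (\<forall>r\<in>\<rat>. 0 \<le> r \<longrightarrow> pv r \<omega> = q r \<omega>)"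
    if \<omega>: "\<omega> \<in> space M" for \<omega>
  proof (rule mono_eq_continuous_iff_Rats)
    show "pv t \<omega> \<le> pv t' \<omega>" if "0 \<le> t" "t \<le> t'" for t t'
      unfolding pv_def using compact_path_hull[OF \<omega>] that by (intro parallel_volume_mono) auto
    show "continuous_on UNIV (\<lambda>t. q t \<omega>)"
      unfolding q_def by (intro continuous_intros)
  qed
  ultimately show ?thesis
    unfolding Lc pv_def[symmetric] q_def[symmetric] by (simp cong: measurable_cong)
qed

end

text \<open>Real \<open>powr\<close> depends only on the absolute value of its base, so an estimate
  of the absolute value of the intrinsic volume carries over to the integrand.\<close>

lemma abs_powr_real: "\<bar>x powr p\<bar> = \<bar>x\<bar> powr p" for x p :: real
  by (simp add: powr_def abs_if ln_minus)

theorem theorem1p1: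
  fixes M :: "'w measure" and X :: "real \<Rightarrow> 'w \<Rightarrow> 'a::euclidean_space"
    and \<nu> :: "'a measure" and p :: real
  assumes "levy_process M X"
    and "is_levy_measure_of M X \<nu>"
    and "0 \<le> p" and "ennreal p < tail_index \<nu>"
  shows "\<forall>j\<le>DIM('a). \<forall>s\<ge>0.
           integrable M (\<lambda>\<omega>. intrinsic_volume j (path_hull X s \<omega>) powr p)"
proof (intro allI impI)
  fix j and s :: real assume j: "j \<le> DIM('a)" and s: "0 \<le> s"
  interpret levy_process M X by fact
  let ?d = "DIM('a)"
  obtain \<gamma> A where levy: "sets \<nu> = sets borel" "(\<integral>\<^sup>+x. ennreal (min 1 ((norm x)\<^sup>2)) \<partial>\<nu>) < \<infinity>"
    "linear A" "\<And>t u. 0 \<le> t \<Longrightarrow> (CLINT \<omega>|M. iexp (u \<bullet> X t \<omega>)) = exp (of_real t * levy_exponent \<gamma> A \<nu> u)"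
    using assms(2) unfolding is_levy_measure_of_def by blast
  obtain \<beta> where \<beta>: "0 < \<beta>" "(\<integral>\<^sup>+x\<in>{x. norm x > 1}. ennreal (norm x powr \<beta>) \<partial>\<nu>) < \<infinity>" "p < \<beta>"
    using assms(3,4) unfolding tail_index_def less_Sup_iff by (auto simp: ennreal_less_iff)
  \<comment> \<open>One variable dominates all parallel volumes of radius at most \<open>d\<close>.
    The horizon \<open>s + 1\<close> includes the case \<open>s = 0\<close>, as the moment bound is
    for positive horizons; the summand 1 keeps \<open>F\<close> above 1, so that constants can be
    absorbed.\<close>
  define F where "F \<omega> = 1 + parallel_volume (path_hull X (s + 1) \<omega>) (real ?d)" for \<omega>
  have F1: "1 \<le> F \<omega>" for \<omega> unfolding F_def using parallel_volume_nonneg by simp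
  have F_int: "integrable M (\<lambda>\<omega>. F \<omega> powr p)"
    unfolding F_def using s assms(3) \<beta>(3)
    by (intro integrable_parallel_volume_powr[OF levy \<beta>(1,2)]) auto
  obtain L c where Lc: "\<And>K :: 'a set. intrinsic_volume j K =
     (if \<forall>t\<ge>0. parallel_volume K t = (\<Sum>i\<le>?d. t ^ (?d - i) *
            unit_ball_vol (real (?d - i)) * (\<Sum>k\<le>?d. L i k * parallel_volume K (real k)))
      then \<Sum>k\<le>?d. L j k * parallel_volume K (real k) else c j)"
    using intrinsic_volume_representation[where 'a = 'a] j by blast
  \<comment> \<open>The last summand covers the branch in which the Steiner identity fails.\<close>
  define B where "B = (\<Sum>k\<le>?d. \<bar>L j k\<bar>) + \<bar>c j\<bar>"
  have B0: "0 \<le> B" by (simp add: B_def sum_nonneg)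
  have bound: "\<bar>intrinsic_volume j (path_hull X s \<omega>)\<bar> \<le> B * F \<omega>" if \<omega>: "\<omega> \<in> space M" for \<omega>
  proof -
    let ?K = "path_hull X s \<omega>"
    have "\<bar>\<Sum>k\<le>?d. L j k * parallel_volume ?K (real k)\<bar> \<le> (\<Sum>k\<le>?d. \<bar>L j k\<bar> * F \<omega>)"
    proof (rule order_trans[OF sum_abs sum_mono])
      fix k assume "k \<in> {..?d}"
      then have "parallel_volume ?K (real k) \<le> parallel_volume (path_hull X (s + 1) \<omega>) (real ?d)"
        using compact_path_hull[OF \<omega>] path_hull_mono[of s "s + 1" \<omega>]
        by (intro parallel_volume_mono) auto
      then have "parallel_volume ?K (real k) \<le> F \<omega>" by (simp add: F_def)
      then show "\<bar>L j k * parallel_volume ?K (real k)\<bar> \<le> \<bar>L j k\<bar> * F \<omega>"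
        using parallel_volume_nonneg[of ?K "real k"] by (simp add: abs_mult mult_left_mono)
    qed
    also have "\<dots> = (\<Sum>k\<le>?d. \<bar>L j k\<bar>) * F \<omega>" by (simp add: sum_distrib_right)
    finally have 1: "\<bar>\<Sum>k\<le>?d. L j k * parallel_volume ?K (real k)\<bar> \<le> (\<Sum>k\<le>?d. \<bar>L j k\<bar>) * F \<omega>" .
    have 2: "(\<Sum>k\<le>?d. \<bar>L j k\<bar>) * F \<omega> \<le> B * F \<omega>" "\<bar>c j\<bar> * F \<omega> \<le> B * F \<omega>"
      unfolding B_def using F1[of \<omega>] by (auto intro!: mult_right_mono sum_nonneg)
    have 3: "\<bar>c j\<bar> * 1 \<le> \<bar>c j\<bar> * F \<omega>" using F1 by (intro mult_left_mono) auto
    have "intrinsic_volume j ?K = (\<Sum>k\<le>?d. L j k * parallel_volume ?K (real k)) \<or> intrinsic_volume j ?K = c j"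
      unfolding Lc[of ?K] by presburger
    then show ?thesis using 1 2 3 by fastforce
  qed
  have int: "integrable M (\<lambda>\<omega>. B powr p * F \<omega> powr p)" using F_int by simp
  show "integrable M (\<lambda>\<omega>. intrinsic_volume j (path_hull X s \<omega>) powr p)"
  proof (rule Bochner_Integration.integrable_bound[OF int])
    show "(\<lambda>\<omega>. intrinsic_volume j (path_hull X s \<omega>) powr p) \<in> borel_measurable M"
      using measurable_intrinsic_volume_path_hull[OF s j] by measurable
    have "norm (intrinsic_volume j (path_hull X s \<omega>) powr p) \<le> norm (B powr p * F \<omega> powr p)"
      if "\<omega> \<in> space M" for \<omega>
    proof -
      have "norm (intrinsic_volume j (path_hull X s \<omega>) powr p) \<le> (B * F \<omega>) powr p"
        unfolding real_norm_def abs_powr_real using bound[OF that] assms(3) by (intro powr_mono2) auto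
      also have "\<dots> = B powr p * F \<omega> powr p" by (rule powr_mult)
      finally show ?thesis by simp
    qed
    then show "AE \<omega> in M. norm (intrinsic_volume j (path_hull X s \<omega>) powr p) \<le> norm (B powr p * F \<omega> powr p)"
      by (intro AE_I2)
  qed
qed

end
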